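(* Let $G$ be a triconed graph with its canonical tree $B_0$. Then every choice of fibres along inclusion meets no obstructed stratum (that is, for every dead stratum $\sigma$ and every choice of fibres along inclusion at the dead strata $\tau\subsetneq\sigma$, a fibre at $\sigma$ exists), and for every fibre system $F$ on $(M(G),B_0)$ the set $\mathcal P^*(F)$ is a pure multicomplex with degree sequence $h(M(G))$. In particular Stanley's conjecture holds for triconed, biconed and coned graphs, i.e. $h(M(G))$ is a pure $O$-sequence for each such graph $G$. For a coned graph $G$, with $B_0$ the star at the dominating vertex $0$, every stratum is live, so the fundamental triangles $(C_i)_{i\in R}$ form a cycle system of $M(G)$, and the set of relaxed coparking functions equals the set of coparking functions $\mathcal P^*(\mathcal C)$ of $\mathcal C=(C_i)_{i\in R}$.
   Context: Graphs are finite multigraphs without loops or coloops (bridges). A set of vertices dominates $G$ if every vertex outside it is adjacent to one of its members. $G$ is coned if it is dominated by a vertex $0$ (with no parallel edges at $0$); biconed if it is dominated by (the ends of) an edge $01$, with no parallel edges at $0$ or $1$; triconed if it is dominated by (the vertices of) a path $1\,0\,2$, with no parallel edges at $0$, $1$ or $2$. Parallel edges between other vertices are allowed. The canonical tree of a triconed graph attaches every vertex to $0$ if it is adjacent to $0$, else to $1$ if adjacent to $1$, else to $2$. $M=M(G)$ is the graphic matroid on the edge set $E$, with basis $B_0$, $R=E\setminus B_0$. For $i\in R$, $C_i$ is the fundamental circuit, the unique circuit in $B_0\cup\{i\}$. For $\sigma\subseteq R$ put $m_\sigma(e)=\#\{i\in\sigma:e\in C_i\}$, $U_\sigma=\{e:m_\sigma(e)=1\}$,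 $A_\sigma=\{e:m_\sigma(e)\ge1\}$. A stratum is a nonempty $\sigma\subseteq R$; it is dead if $U_\sigma$ is independent in $M$ (a forest), live otherwise. The baseline $b_\sigma\in\mathbb N^\sigma$ is $b_\sigma(i)=|C_i\cap U_\sigma|$; $\mathbb N^\sigma$ is identified with the vectors in $\mathbb N^R$ vanishing outside $\sigma$. $\sigma$ can be fired from $a\in\mathbb N^R$ if $a_i\ge b_\sigma(i)$ for all $i\in\sigma$. For dead $\sigma$, $K_\sigma=(M|A_\sigma)/U_\sigma$. $\mathcal C=(C_i)_{i\in R}$ is a cycle system if $U_\sigma$ is dependent for every stratum $\sigma$; $\mathcal P^*(\mathcal C)$ is the set of $a\in\mathbb N^R$ from which no stratum can be fired. For a matroid $N$ of rank $d$, $h(N)=(h_0,\dots,h_d)$ is the $h$-vector of its independence complex: $T_N(x,1)=\sum_kh_kx^{d-k}$. A multicomplex is a finite set of monomials (exponent vectors) closed under division; it is pure if all maximal elements have the same degree $|a|=\sum a_i$; its degree sequence counts elements of each degree (trailing zeros ignored). A pure $O$-sequence is the degree sequence of a pure multicomplex. Fibres (recursively along inclusion): given fibres $F(\tau)$ at all dead $\tau\subsetneq\sigma$, a fibre at a dead stratum $\sigma$ is a set $F(\sigma)\subseteq\mathbb N^\sigma$ such that (i) $F(\sigma)$ is a pure multicomplex with degree sequence $h(K_\sigma)$; (ii) for every $m\in F(\sigma)$, every stratum $\tau\subsetneq\sigma$ that can be fired from $b_\sigma+m$ is dead with $(b_\sigma+m)|_\tau-b_\tau\in F(\tau)$. A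 dead stratum at which no fibre exists, for the fibres chosen strictly inside it, is obstructed. A fibre system $F$ is a choice of a fibre at every dead stratum. The set $\mathcal P^*(F)$ of relaxed coparking functions is the set of $a\in\mathbb N^R$ such that every stratum $\tau$ that can be fired from $a$ is dead with $a|_\tau-b_\tau\in F(\tau)$. *)

theory Defs
  imports "HOL-Computational_Algebra.Polynomial"
begin

section \<open>Multicomplexes and pure O-sequences\<close>

text \<open>
  A monomial in the variables \<open>S\<close> is given by its exponent vector, a function that
  vanishes outside \<open>S\<close>; thus \<open>monomials S\<close> is a subset of \<open>monomials T\<close> whenever
  \<open>S \<subseteq> T\<close>, and divisibility is the pointwise order.
\<close>

definition monomials :: "'i set \<Rightarrow> ('i \<Rightarrow> nat) set" where
  "monomials S = {a. \<forall>i. i \<notin> S \<longrightarrow> a i = 0}"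

definition multicomplex :: "'i set \<Rightarrow> ('i \<Rightarrow> nat) set \<Rightarrow> bool" where
  "multicomplex S P \<longleftrightarrow>
     finite P \<and> P \<subseteq> monomials S \<and> (\<forall>a\<in>P. \<forall>b. b \<le> a \<longrightarrow> b \<in> P)"

definition maximal_in :: "('i \<Rightarrow> nat) set \<Rightarrow> ('i \<Rightarrow> nat) \<Rightarrow> bool" where
  "maximal_in P a \<longleftrightarrow> a \<in> P \<and> (\<forall>b\<in>P. a \<le> b \<longrightarrow> b = a)"

definition pure_multicomplex :: "'i set \<Rightarrow> ('i \<Rightarrow> nat) set \<Rightarrow> bool" where
  "pure_multicomplex S P \<longleftrightarrow>
     multicomplex S P \<and>
     (\<forall>a b. maximal_in P a \<longrightarrow> maximal_in P b \<longrightarrow> sum a S = sum b S)"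

text \<open>
  Degree sequences and \<open>h\<close>-vectors are extended by zeros to all of \<open>nat\<close>, so that
  equality of functions is equality up to trailing zeros.
\<close>

definition degree_seq :: "'i set \<Rightarrow> ('i \<Rightarrow> nat) set \<Rightarrow> nat \<Rightarrow> int" where
  "degree_seq S P k = int (card {a \<in> P. sum a S = k})"

definition pure_O_sequence :: "(nat \<Rightarrow> int) \<Rightarrow> bool" where
  "pure_O_sequence h \<longleftrightarrow>
     (\<exists>(n::nat) P. pure_multicomplex {..<n} P \<and> degree_seq {..<n} P = h)"


section \<open>Matroids\<close>

text \<open>
  The record carries no axioms; below it is used only for graphic matroids and their minors.
\<close>

record 'e matroid =
  ground :: "'e set"
  indep :: "'e set \<Rightarrow> bool"

definition basis_of :: "'e matroid \<Rightarrow> 'e set \<Rightarrow> 'e set \<Rightarrow> bool" where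
  "basis_of N X J \<longleftrightarrow>
     J \<subseteq> X \<and> indep N J \<and> (\<forall>K. J \<subset> K \<and> K \<subseteq> X \<longrightarrow> \<not> indep N K)"

definition basis :: "'e matroid \<Rightarrow> 'e set \<Rightarrow> bool" where
  "basis N B \<longleftrightarrow> basis_of N (ground N) B"

definition circuit :: "'e matroid \<Rightarrow> 'e set \<Rightarrow> bool" where
  "circuit N C \<longleftrightarrow> C \<subseteq> ground N \<and> \<not> indep N C \<and> (\<forall>D. D \<subset> C \<longrightarrow> indep N D)"

definition coloop :: "'e matroid \<Rightarrow> 'e \<Rightarrow> bool" where
  "coloop N e \<longleftrightarrow> e \<in> ground N \<and> (\<forall>B. basis N B \<longrightarrow> e \<in> B)"

definition rank_of :: "'e matroid \<Rightarrow> 'e set \<Rightarrow> nat" where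
  "rank_of N X = Max (card ` {I. I \<subseteq> X \<and> indep N I})"

definition restriction :: "'e matroid \<Rightarrow> 'e set \<Rightarrow> 'e matroid" where
  "restriction N X =
     \<lparr>ground = ground N \<inter> X, indep = (\<lambda>I. I \<subseteq> X \<and> indep N I)\<rparr>"

definition contraction :: "'e matroid \<Rightarrow> 'e set \<Rightarrow> 'e matroid" where
  "contraction N T =
     \<lparr>ground = ground N - T,
      indep = (\<lambda>I. I \<subseteq> ground N - T \<and> (\<exists>J. basis_of N T J \<and> indep N (I \<union> J)))\<rparr>"

text \<open>
  The Tutte polynomial, evaluated in an arbitrary commutative ring; at the indeterminate
  \<open>[:0, 1:]\<close> and at \<open>1\<close> in \<open>int poly\<close> it yields \<open>T(x,1)\<close> as a polynomial in \<open>x\<close>.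
\<close>

definition tutte :: "'e matroid \<Rightarrow> 'a::comm_ring_1 \<Rightarrow> 'a \<Rightarrow> 'a" where
  "tutte N x y =
     (\<Sum>X\<in>Pow (ground N).
        (x - 1) ^ (rank_of N (ground N) - rank_of N X) * (y - 1) ^ (card X - rank_of N X))"

definition h_vector :: "'e matroid \<Rightarrow> nat \<Rightarrow> int" where
  "h_vector N k =
     (if k \<le> rank_of N (ground N)
      then coeff (tutte N [:0, 1:] 1) (rank_of N (ground N) - k)
      else 0)"


section \<open>Strata, fibres and coparking functions\<close>

text \<open>Throughout, \<open>B\<close> is a basis of \<open>M\<close>, and \<open>cobasis M B\<close> is the index set \<open>R\<close>.\<close>

definition cobasis :: "'e matroid \<Rightarrow> 'e set \<Rightarrow> 'e set" where
  "cobasis M B = ground M - B"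

definition fund_circuit :: "'e matroid \<Rightarrow> 'e set \<Rightarrow> 'e \<Rightarrow> 'e set" where
  "fund_circuit M B i = (THE C. circuit M C \<and> C \<subseteq> insert i B)"

definition cover_mult :: "'e matroid \<Rightarrow> 'e set \<Rightarrow> 'e set \<Rightarrow> 'e \<Rightarrow> nat" where
  "cover_mult M B \<sigma> e = card {i \<in> \<sigma>. e \<in> fund_circuit M B i}"

definition once_covered :: "'e matroid \<Rightarrow> 'e set \<Rightarrow> 'e set \<Rightarrow> 'e set" where
  "once_covered M B \<sigma> = {e \<in> ground M. cover_mult M B \<sigma> e = 1}"

definition covered :: "'e matroid \<Rightarrow> 'e set \<Rightarrow> 'e set \<Rightarrow> 'e set" where
  "covered M B \<sigma> = {e \<in> ground M. cover_mult M B \<sigma> e \<ge> 1}"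

definition stratum :: "'e matroid \<Rightarrow> 'e set \<Rightarrow> 'e set \<Rightarrow> bool" where
  "stratum M B \<sigma> \<longleftrightarrow> \<sigma> \<noteq> {} \<and> \<sigma> \<subseteq> cobasis M B"

definition dead :: "'e matroid \<Rightarrow> 'e set \<Rightarrow> 'e set \<Rightarrow> bool" where
  "dead M B \<sigma> \<longleftrightarrow> stratum M B \<sigma> \<and> indep M (once_covered M B \<sigma>)"

definition live :: "'e matroid \<Rightarrow> 'e set \<Rightarrow> 'e set \<Rightarrow> bool" where
  "live M B \<sigma> \<longleftrightarrow> stratum M B \<sigma> \<and> \<not> indep M (once_covered M B \<sigma>)"

definition baseline :: "'e matroid \<Rightarrow> 'e set \<Rightarrow> 'e set \<Rightarrow> 'e \<Rightarrow> nat" where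
  "baseline M B \<sigma> i =
     (if i \<in> \<sigma> then card (fund_circuit M B i \<inter> once_covered M B \<sigma>) else 0)"

definition can_fire :: "'e matroid \<Rightarrow> 'e set \<Rightarrow> 'e set \<Rightarrow> ('e \<Rightarrow> nat) \<Rightarrow> bool" where
  "can_fire M B \<sigma> a \<longleftrightarrow> (\<forall>i\<in>\<sigma>. baseline M B \<sigma> i \<le> a i)"

text \<open>
  The vector \<open>a|\<^sub>\<sigma> - b\<^sub>\<sigma>\<close>; it is used only when \<open>\<sigma>\<close> can be fired from \<open>a\<close>, in which
  case the subtraction on \<open>nat\<close> does not truncate.
\<close>

definition residue :: "'e matroid \<Rightarrow> 'e set \<Rightarrow> 'e set \<Rightarrow> ('e \<Rightarrow> nat) \<Rightarrow> 'e \<Rightarrow> nat" where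
  "residue M B \<sigma> a i = (if i \<in> \<sigma> then a i - baseline M B \<sigma> i else 0)"

definition stratum_minor :: "'e matroid \<Rightarrow> 'e set \<Rightarrow> 'e set \<Rightarrow> 'e matroid" where
  "stratum_minor M B \<sigma> =
     contraction (restriction M (covered M B \<sigma>)) (once_covered M B \<sigma>)"

text \<open>
  \<open>fibre_at M B F \<sigma> X\<close>: the set \<open>X\<close> is a fibre at the dead stratum \<open>\<sigma>\<close>, given the
  fibres \<open>F \<tau>\<close> at the dead \<open>\<tau> \<subset> \<sigma>\<close> (no other values of \<open>F\<close> are used).
\<close>

definition fibre_at ::
  "'e matroid \<Rightarrow> 'e set \<Rightarrow> ('e set \<Rightarrow> ('e \<Rightarrow> nat) set) \<Rightarrow> 'e set \<Rightarrow> ('e \<Rightarrow> nat) set \<Rightarrow> bool"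
  where
  "fibre_at M B F \<sigma> X \<longleftrightarrow>
     dead M B \<sigma> \<and>
     pure_multicomplex \<sigma> X \<and>
     degree_seq \<sigma> X = h_vector (stratum_minor M B \<sigma>) \<and>
     (\<forall>m\<in>X. \<forall>\<tau>. stratum M B \<tau> \<and> \<tau> \<subset> \<sigma> \<and>
         can_fire M B \<tau> (\<lambda>i. baseline M B \<sigma> i + m i) \<longrightarrow>
           dead M B \<tau> \<and> residue M B \<tau> (\<lambda>i. baseline M B \<sigma> i + m i) \<in> F \<tau>)"

text \<open>
  A choice of fibres along inclusion strictly inside \<open>\<sigma>\<close>: every \<open>F \<tau>\<close> is itself a fibre
  relative to the fibres chosen inside \<open>\<tau>\<close>.
\<close>

definition fibres_below ::
  "'e matroid \<Rightarrow> 'e set \<Rightarrow> ('e set \<Rightarrow> ('e \<Rightarrow> nat) set) \<Rightarrow> 'e set \<Rightarrow> bool" where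
  "fibres_below M B F \<sigma> \<longleftrightarrow>
     (\<forall>\<tau>. dead M B \<tau> \<and> \<tau> \<subset> \<sigma> \<longrightarrow> fibre_at M B F \<tau> (F \<tau>))"

definition obstructed ::
  "'e matroid \<Rightarrow> 'e set \<Rightarrow> ('e set \<Rightarrow> ('e \<Rightarrow> nat) set) \<Rightarrow> 'e set \<Rightarrow> bool" where
  "obstructed M B F \<sigma> \<longleftrightarrow>
     dead M B \<sigma> \<and> \<not> (\<exists>X. fibre_at M B F \<sigma> X)"

definition fibre_system ::
  "'e matroid \<Rightarrow> 'e set \<Rightarrow> ('e set \<Rightarrow> ('e \<Rightarrow> nat) set) \<Rightarrow> bool" where
  "fibre_system M B F \<longleftrightarrow> (\<forall>\<sigma>. dead M B \<sigma> \<longrightarrow> fibre_at M B F \<sigma> (F \<sigma>))"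

definition relaxed_coparking ::
  "'e matroid \<Rightarrow> 'e set \<Rightarrow> ('e set \<Rightarrow> ('e \<Rightarrow> nat) set) \<Rightarrow> ('e \<Rightarrow> nat) set" where
  "relaxed_coparking M B F =
     {a \<in> monomials (cobasis M B).
        \<forall>\<tau>. stratum M B \<tau> \<and> can_fire M B \<tau> a \<longrightarrow>
          dead M B \<tau> \<and> residue M B \<tau> a \<in> F \<tau>}"

text \<open>
  The family \<open>(C\<^sub>i)\<close> of fundamental circuits is determined by \<open>M\<close> and \<open>B\<close>, so being
  a cycle system is expressed as a property of the pair.
\<close>

definition cycle_system :: "'e matroid \<Rightarrow> 'e set \<Rightarrow> bool" where
  "cycle_system M B \<longleftrightarrow> (\<forall>\<sigma>. stratum M B \<sigma> \<longrightarrow> \<not> indep M (once_covered M B \<sigma>))"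

definition coparking :: "'e matroid \<Rightarrow> 'e set \<Rightarrow> ('e \<Rightarrow> nat) set" where
  "coparking M B =
     {a \<in> monomials (cobasis M B). \<forall>\<sigma>. stratum M B \<sigma> \<longrightarrow> \<not> can_fire M B \<sigma> a}"


section \<open>Graphs\<close>

record ('v, 'e) multigraph =
  verts :: "'v set"
  edges :: "'e set"
  ends :: "'e \<Rightarrow> 'v set"

text \<open>
  A cycle traverses distinct vertices \<open>vs\<close> and distinct edges \<open>es\<close>; two parallel edges
  form a cycle of length two.
\<close>

definition cycle :: "('v, 'e) multigraph \<Rightarrow> 'e set \<Rightarrow> bool" where
  "cycle G C \<longleftrightarrow>
     C \<subseteq> edges G \<and>
     (\<exists>vs es. vs \<noteq> [] \<and> length es = length vs \<and> distinct vs \<and> distinct es \<and> set es = C \<and>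
        (\<forall>i<length vs. ends G (es ! i) = {vs ! i, vs ! (Suc i mod length vs)}))"

definition forest :: "('v, 'e) multigraph \<Rightarrow> 'e set \<Rightarrow> bool" where
  "forest G X \<longleftrightarrow> X \<subseteq> edges G \<and> (\<forall>C. C \<subseteq> X \<longrightarrow> \<not> cycle G C)"

definition graphic_matroid :: "('v, 'e) multigraph \<Rightarrow> 'e matroid" where
  "graphic_matroid G = \<lparr>ground = edges G, indep = forest G\<rparr>"

text \<open>Finite multigraphs without loops (edges have two distinct ends) or bridges.\<close>

definition graph :: "('v, 'e) multigraph \<Rightarrow> bool" where
  "graph G \<longleftrightarrow>
     finite (verts G) \<and> finite (edges G) \<and>
     (\<forall>e\<in>edges G. ends G e \<subseteq> verts G \<and> card (ends G e) = 2) \<and>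
     (\<forall>e\<in>edges G. \<not> coloop (graphic_matroid G) e)"

definition adjacent :: "('v, 'e) multigraph \<Rightarrow> 'v \<Rightarrow> 'v \<Rightarrow> bool" where
  "adjacent G u v \<longleftrightarrow> u \<noteq> v \<and> (\<exists>e\<in>edges G. ends G e = {u, v})"

definition dominates :: "('v, 'e) multigraph \<Rightarrow> 'v set \<Rightarrow> bool" where
  "dominates G D \<longleftrightarrow> D \<subseteq> verts G \<and> (\<forall>v\<in>verts G - D. \<exists>u\<in>D. adjacent G v u)"

definition no_parallel_at :: "('v, 'e) multigraph \<Rightarrow> 'v \<Rightarrow> bool" where
  "no_parallel_at G v \<longleftrightarrow>
     (\<forall>e\<in>edges G. \<forall>f\<in>edges G. v \<in> ends G e \<and> ends G e = ends G f \<longrightarrow> e = f)"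

definition coned_at :: "('v, 'e) multigraph \<Rightarrow> 'v \<Rightarrow> bool" where
  "coned_at G v0 \<longleftrightarrow> dominates G {v0} \<and> no_parallel_at G v0"

definition coned :: "('v, 'e) multigraph \<Rightarrow> bool" where
  "coned G \<longleftrightarrow> (\<exists>v0. coned_at G v0)"

definition biconed :: "('v, 'e) multigraph \<Rightarrow> bool" where
  "biconed G \<longleftrightarrow>
     (\<exists>v0 v1. adjacent G v0 v1 \<and> dominates G {v0, v1} \<and>
        no_parallel_at G v0 \<and> no_parallel_at G v1)"

text \<open>Here \<open>v0\<close> is the middle vertex of the dominating path \<open>v1, v0, v2\<close>.\<close>

definition triconed_at :: "('v, 'e) multigraph \<Rightarrow> 'v \<Rightarrow> 'v \<Rightarrow> 'v \<Rightarrow> bool" where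
  "triconed_at G v0 v1 v2 \<longleftrightarrow>
     v1 \<noteq> v2 \<and> adjacent G v1 v0 \<and> adjacent G v0 v2 \<and> dominates G {v0, v1, v2} \<and>
     no_parallel_at G v0 \<and> no_parallel_at G v1 \<and> no_parallel_at G v2"

definition triconed :: "('v, 'e) multigraph \<Rightarrow> bool" where
  "triconed G \<longleftrightarrow> (\<exists>v0 v1 v2. triconed_at G v0 v1 v2)"

text \<open>
  The canonical tree is rooted at \<open>v0\<close>, the only vertex that is not attached to another.
  Every edge attaching a vertex is unique, as there are no parallel edges at the path.
\<close>

definition canonical_parent :: "('v, 'e) multigraph \<Rightarrow> 'v \<Rightarrow> 'v \<Rightarrow> 'v \<Rightarrow> 'v \<Rightarrow> 'v" where
  "canonical_parent G v0 v1 v2 v =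
     (if adjacent G v v0 then v0 else if adjacent G v v1 then v1 else v2)"

definition canonical_tree :: "('v, 'e) multigraph \<Rightarrow> 'v \<Rightarrow> 'v \<Rightarrow> 'v \<Rightarrow> 'e set" where
  "canonical_tree G v0 v1 v2 =
     {e \<in> edges G. \<exists>v\<in>verts G - {v0}. ends G e = {v, canonical_parent G v0 v1 v2 v}}"

definition star :: "('v, 'e) multigraph \<Rightarrow> 'v \<Rightarrow> 'e set" where
  "star G v = {e \<in> edges G. v \<in> ends G e}"

end

theory Submission
  imports Defs
begin

text \<open>
  Write \<open>C i\<close> for the fundamental circuits, \<open>U \<sigma>\<close> for the elements covered exactly once by
  \<open>\<sigma>\<close>, \<open>A \<sigma>\<close> for the union of the circuits of \<open>\<sigma>\<close> and \<open>K \<sigma>\<close> for the minor at a dead \<open>\<sigma>\<close>. The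
  degree sequence is computed for every binary matroid with a basis, and so is purity as
  soon as each \<open>h(K \<sigma>)\<close> is nonzero in degree \<open>rank (K \<sigma>)\<close>; the graph enters only through the
  existence of fibres and through the ranks of the minors.

  Degrees. Give a subset \<open>X\<close> of the ground set \<open>E\<close> the weight \<open>t^|X| (1 - t)^(|E| - |X|)\<close>.
  The independent sets have total weight \<open>h(M; t) (1 - t)^|R|\<close>, where \<open>h(M; t)\<close> is the
  polynomial with the coefficients \<open>h(M)\<close>. For each \<open>X\<close> there is a largest \<open>\<sigma>\<close> with
  \<open>U \<sigma> \<subseteq> X\<close>, possibly empty, and \<open>X\<close> is independent if and only if \<open>X \<inter> A \<sigma>\<close> is: for a
  member \<open>D\<close> of the cycle space and \<open>\<rho> = D \<inter> R\<close> one has \<open>U \<rho> \<subseteq> D \<subseteq> A \<rho>\<close>. Hence the weight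
  splits over \<open>\<sigma>\<close> into products. The inner factor is \<open>t^|U \<sigma>| h(K \<sigma>; t) (1 - t)^|\<sigma>|\<close>, or \<open>0\<close>
  if \<open>U \<sigma>\<close> is dependent; the outer factor is the weight of the sets off \<open>A \<sigma>\<close> that contain
  \<open>U \<tau>\<close> for no nonempty \<open>\<tau>\<close>, with \<open>U \<tau>\<close> formed for the family \<open>C i - A \<sigma>\<close>. A relaxed
  coparking function splits in the same way at its largest fireable stratum \<open>\<sigma>\<close>, into the
  baseline, a member of the fibre at \<open>\<sigma>\<close>, and a vector off \<open>\<sigma>\<close> from which nothing can be
  fired. That the outer factors agree is \<open>stable_poly\<close>, a recursion on an element covered
  exactly once; the sum of the products is \<open>degree_poly_relaxed_coparking\<close>.

  Purity. In this splitting the member of the fibre can be raised to the top degree of the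
  fibre, and the outer vector can be raised by a burning procedure (\<open>stable_bump\<close>); the
  resulting degree is the same for all \<open>\<sigma>\<close>.

  Fibres. If \<open>K \<sigma>\<close> has rank \<open>0\<close>, the fibre is \<open>{0}\<close>. If it has rank \<open>1\<close> and \<open>p\<close> elements
  that are not loops, a fibre consists of \<open>0\<close> and of \<open>p - 1\<close> unit vectors. A unit vector at
  \<open>i\<close> is blocked only if it makes a live \<open>\<tau> \<subset> \<sigma>\<close> fireable; then \<open>C i\<close> contains an element of
  \<open>U \<tau>\<close> outside \<open>U \<sigma>\<close>, which is a loop of \<open>K \<sigma>\<close>, and different \<open>i\<close> give different loops
  (\<open>card_blocked\<close>). As \<open>K \<sigma>\<close> has \<open>|\<sigma>| + 1\<close> elements, at least \<open>p - 1\<close> indices are not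
  blocked.

  Graphs. In the canonical tree every vertex outside the dominating path \<open>1 0 2\<close> is a leaf.
  By parity no vertex outside \<open>S = {0, 1, 2}\<close> has degree one in \<open>U \<sigma>\<close>, so each edge of a
  dead \<open>U \<sigma>\<close> lies in a subset whose boundary is contained in \<open>S\<close>; and every further edge of
  \<open>A \<sigma>\<close> can be completed to such a subset by edges of \<open>U \<sigma>\<close>. In a forest, boundaries
  determine edge sets, and the even subsets of \<open>S\<close> form a space of dimension at most two
  over the field with two elements. This leaves rank at most one for \<open>K \<sigma>\<close>, and in rank one
  it forbids \<open>U \<tau> \<subseteq> U \<sigma>\<close> for nonempty \<open>\<tau> \<subset> \<sigma>\<close>. A biconed or coned graph is the degenerate
  case in which \<open>S\<close> has two elements or one; with one element no nonempty boundary is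
  possible, so there are no dead strata.
\<close>

section \<open>Firing in a family of sets\<close>

text \<open>
  This is \<open>U \<sigma>\<close>, for an arbitrary family of sets. Families other than the fundamental
  circuits arise below as \<open>C i - A \<sigma>\<close>.
\<close>

definition once :: "('i \<Rightarrow> 'e set) \<Rightarrow> 'i set \<Rightarrow> 'e set" where
  "once C \<sigma> = {e. \<exists>!i. i \<in> \<sigma> \<and> e \<in> C i}"

definition fires :: "('i \<Rightarrow> 'e set) \<Rightarrow> 'i set \<Rightarrow> ('i \<Rightarrow> nat) \<Rightarrow> bool" where
  "fires C \<sigma> a \<longleftrightarrow> (\<forall>i\<in>\<sigma>. card (C i \<inter> once C \<sigma>) \<le> a i)"

definition stable :: "('i \<Rightarrow> 'e set) \<Rightarrow> 'i set \<Rightarrow> ('i \<Rightarrow> nat) set" where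
  "stable C R = {a \<in> monomials R. \<forall>\<sigma>\<subseteq>R. \<sigma> \<noteq> {} \<longrightarrow> \<not> fires C \<sigma> a}"

lemma card_Collect_eq_1_iff: "card {x. P x} = 1 \<longleftrightarrow> (\<exists>!x. P x)"
proof
  assume "card {x. P x} = 1"
  then obtain x where "{x. P x} = {x}" by (auto simp: card_1_singleton_iff)
  then show "\<exists>!x. P x" by (metis mem_Collect_eq singletonD singletonI)
next
  assume "\<exists>!x. P x"
  then obtain x where "{x. P x} = {x}" by auto
  then show "card {x. P x} = 1" by simp
qed

lemma once_empty [simp]: "once C {} = {}"
  by (auto simp: once_def)

lemma once_subset: "once C \<sigma> \<subseteq> (\<Union>i\<in>\<sigma>. C i)"
  by (auto simp: once_def)

text \<open>
  A larger stratum has smaller baselines. This monotonicity is the reason why unions of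
  fireable strata can be fired and why the burning procedure works.
\<close>

lemma once_antimono: "\<sigma> \<subseteq> \<rho> \<Longrightarrow> i \<in> \<sigma> \<Longrightarrow> C i \<inter> once C \<rho> \<subseteq> C i \<inter> once C \<sigma>"
  by (auto simp: once_def)

lemma once_Union: "once C (\<Union>\<S>) \<subseteq> (\<Union>\<sigma>\<in>\<S>. once C \<sigma>)"
proof
  fix e assume "e \<in> once C (\<Union>\<S>)"
  then obtain i where i: "i \<in> \<Union>\<S>" "e \<in> C i" and u: "\<And>j. j \<in> \<Union>\<S> \<Longrightarrow> e \<in> C j \<Longrightarrow> j = i"
    unfolding once_def by blast
  then obtain \<sigma> where "\<sigma> \<in> \<S>" "i \<in> \<sigma>" by blast
  then have "e \<in> once C \<sigma>" unfolding once_def using i u by blast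
  then show "e \<in> (\<Union>\<sigma>\<in>\<S>. once C \<sigma>)" using \<open>\<sigma> \<in> \<S>\<close> by blast
qed

lemma fires_Union:
  assumes "\<And>i. i \<in> \<Union>\<S> \<Longrightarrow> finite (C i)" "\<And>\<sigma>. \<sigma> \<in> \<S> \<Longrightarrow> fires C \<sigma> a"
  shows "fires C (\<Union>\<S>) a"
  unfolding fires_def
proof
  fix i assume "i \<in> \<Union>\<S>"
  then obtain \<sigma> where s: "\<sigma> \<in> \<S>" "i \<in> \<sigma>" by blast
  have "card (C i \<inter> once C (\<Union>\<S>)) \<le> card (C i \<inter> once C \<sigma>)"
    by (rule card_mono[OF _ once_antimono]) (use assms(1) s in auto)
  also have "\<dots> \<le> a i" using assms(2)[OF s(1)] s(2) by (auto simp: fires_def)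
  finally show "card (C i \<inter> once C (\<Union>\<S>)) \<le> a i" .
qed

lemma fires_mono: "fires C \<sigma> a \<Longrightarrow> (\<And>i. i \<in> \<sigma> \<Longrightarrow> a i \<le> b i) \<Longrightarrow> fires C \<sigma> b"
  unfolding fires_def using le_trans by blast

lemma stableI:
  "a \<in> monomials R \<Longrightarrow> (\<And>\<sigma>. \<sigma> \<subseteq> R \<Longrightarrow> \<sigma> \<noteq> {} \<Longrightarrow> fires C \<sigma> a \<Longrightarrow> False) \<Longrightarrow> a \<in> stable C R"
  unfolding stable_def by blast

lemma stableD: "a \<in> stable C R \<Longrightarrow> \<sigma> \<subseteq> R \<Longrightarrow> \<sigma> \<noteq> {} \<Longrightarrow> \<not> fires C \<sigma> a"
  unfolding stable_def by blast

lemma stable_empty [simp]: "stable C {} = {\<lambda>_. 0}"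
  by (auto simp: stable_def monomials_def)

text \<open>
  Burning. The full index set cannot be fired, so some \<open>a i\<close> lies below
  \<open>card (C i \<inter> once C R)\<close>. Raise it to one less than this bound: as bounds only grow on
  smaller strata, no stratum containing \<open>i\<close> becomes fireable. Then remove \<open>i\<close> and repeat.
  The sets \<open>C i \<inter> once C R\<close> met on the way partition the union of the family, which gives
  the degree.
\<close>

lemma stable_bump:
  assumes "finite R" "\<And>i. i \<in> R \<Longrightarrow> finite (C i)" "a \<in> stable C R"
  shows "\<exists>b\<in>stable C R. a \<le> b \<and> sum b R + card R = card (\<Union>i\<in>R. C i)"
  using assms
proof (induction "card R" arbitrary: R a)
  case 0
  then show ?case by (auto simp: le_fun_def)
next
  case (Suc n)
  then have "R \<noteq> {}" by auto
  then obtain i where i: "i \<in> R" "a i < card (C i \<inter> once C R)"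
    using Suc.prems(3) unfolding stable_def fires_def by (auto simp: not_le)
  let ?R = "R - {i}"
  have "a(i := 0) \<in> stable C ?R"
  proof (rule stableI)
    show "a(i := 0) \<in> monomials ?R" using Suc.prems(3) by (auto simp: stable_def monomials_def)
    fix \<sigma> assume s: "\<sigma> \<subseteq> ?R" "\<sigma> \<noteq> {}" "fires C \<sigma> (a(i := 0))"
    have "fires C \<sigma> a" using s(3) by (rule fires_mono) auto
    moreover have "\<sigma> \<subseteq> R" using s(1) by blast
    ultimately show False using stableD[OF Suc.prems(3)] s(2) by blast
  qed
  moreover have "n = card ?R" using Suc i by auto
  ultimately obtain b where b: "b \<in> stable C ?R" "a(i := 0) \<le> b"
      "sum b ?R + card ?R = card (\<Union>j\<in>?R. C j)"
    using Suc.hyps(1)[of ?R "a(i := 0)"] Suc.prems by auto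
  define c where "c = b(i := card (C i \<inter> once C R) - 1)"
  have ci: "c i < card (C i \<inter> once C R)" using i by (auto simp: c_def)
  have "c \<in> stable C R"
  proof (rule stableI)
    show "c \<in> monomials R" using b(1) i by (auto simp: stable_def monomials_def c_def)
    fix \<sigma> assume s: "\<sigma> \<subseteq> R" "\<sigma> \<noteq> {}" "fires C \<sigma> c"
    show False
    proof (cases "i \<in> \<sigma>")
      case True
      have "card (C i \<inter> once C R) \<le> card (C i \<inter> once C \<sigma>)"
        by (rule card_mono[OF _ once_antimono]) (use s True Suc.prems(2) in auto)
      moreover have "card (C i \<inter> once C \<sigma>) \<le> c i" using s(3) True unfolding fires_def by blast
      ultimately show False using ci by simp
    next
      case False
      then have "fires C \<sigma> b" using s(3) unfolding fires_def c_def
        by (metis fun_upd_other)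
      moreover have "\<sigma> \<subseteq> ?R" using s False by blast
      ultimately show False using stableD[OF b(1)] s by blast
    qed
  qed
  moreover have "a \<le> c"
  proof (rule le_funI)
    fix j show "a j \<le> c j" using b(2) i by (cases "j = i") (auto simp: le_fun_def c_def dest: spec[of _ j])
  qed
  moreover have "sum c R + card R = card (\<Union>j\<in>R. C j)"
  proof -
    have un: "(\<Union>j\<in>R. C j) = (\<Union>j\<in>?R. C j) \<union> (C i \<inter> once C R)" (is "_ = ?A \<union> ?D")
      using i(1) by (auto simp: once_def)
    have "?A \<inter> ?D = {}" using i(1) by (auto simp: once_def)
    then have "card (\<Union>j\<in>R. C j) = card ?A + card ?D"
      unfolding un using Suc.prems(1,2) i(1) by (intro card_Un_disjoint) auto
    moreover have "sum c R = c i + sum b ?R"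
      using Suc.prems(1) i(1) by (simp add: sum.remove c_def)
    moreover have "card R = Suc (card ?R)" using Suc.prems(1) i(1) by (metis card.remove)
    ultimately show ?thesis using b(3) ci by (simp add: c_def)
  qed
  ultimately show ?case by blast
qed

lemma finite_bounded_monomials:
  assumes "finite S"
  shows "finite {a \<in> monomials S. sum a S \<le> n}"
proof (rule finite_subset)
  show "{a \<in> monomials S. sum a S \<le> n} \<subseteq> {f. \<forall>x. (x \<in> S \<longrightarrow> f x \<in> {..n}) \<and> (x \<notin> S \<longrightarrow> f x = 0)}"
    using assms by (auto simp: monomials_def intro: order_trans[OF member_le_sum])
  show "finite {f. \<forall>x. (x \<in> S \<longrightarrow> f x \<in> {..n}) \<and> (x \<notin> S \<longrightarrow> f x = (0::nat))}"
    using assms by (intro finite_set_of_finite_funs) auto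
qed

lemma finite_stable:
  assumes "finite R" "\<And>i. i \<in> R \<Longrightarrow> finite (C i)"
  shows "finite (stable C R)"
proof (rule finite_subset[OF _ finite_bounded_monomials[OF assms(1), of "card (\<Union>i\<in>R. C i)"]])
  show "stable C R \<subseteq> {a \<in> monomials R. sum a R \<le> card (\<Union>i\<in>R. C i)}"
  proof
    fix a assume a: "a \<in> stable C R"
    obtain b where "b \<in> stable C R" "a \<le> b" "sum b R + card R = card (\<Union>i\<in>R. C i)"
      using stable_bump[OF assms a] by blast
    moreover have "sum a R \<le> sum b R" using \<open>a \<le> b\<close> by (intro sum_mono) (auto simp: le_fun_def)
    ultimately show "a \<in> {a \<in> monomials R. sum a R \<le> card (\<Union>i\<in>R. C i)}"
      using a by (auto simp: stable_def)
  qed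
qed

section \<open>Generating polynomials\<close>

definition degree_poly :: "'i set \<Rightarrow> ('i \<Rightarrow> nat) set \<Rightarrow> int poly" where
  "degree_poly S P = (\<Sum>a\<in>P. monom 1 (sum a S))"

text \<open>
  The probability that a random subset of \<open>E\<close> lies in \<open>\<X>\<close>, if every element is chosen
  independently with probability \<open>t\<close>; here \<open>t\<close> is the indeterminate, and \<open>[:1, -1:]\<close> is
  \<open>1 - t\<close>.
\<close>

definition subset_poly :: "'e set \<Rightarrow> 'e set set \<Rightarrow> int poly" where
  "subset_poly E \<X> = (\<Sum>X\<in>\<X>. monom 1 (card X) * [:1, -1:] ^ (card E - card X))"

lemma coeff_degree_poly:
  assumes "finite P"
  shows "coeff (degree_poly S P) k = degree_seq S P k"
proof -
  have "coeff (degree_poly S P) k = (\<Sum>a\<in>P. if sum a S = k then 1 else 0)"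
    by (simp add: degree_poly_def coeff_sum)
  also have "\<dots> = degree_seq S P k"
    using assms by (simp add: degree_seq_def sum.If_cases Int_def)
  finally show ?thesis .
qed

lemma subset_poly_Pow:
  assumes "finite E"
  shows "subset_poly E (Pow E) = 1"
proof -
  have "monom 1 1 + [:1, -1:] = (1 :: int poly)"
    by (simp add: monom_Suc one_pCons)
  then have "(1 :: int poly) = (\<Prod>x\<in>E. monom 1 1 + [:1, -1:])"
    by simp
  also have "\<dots> = subset_poly E (Pow E)"
    using assms unfolding subset_poly_def
    by (subst prod_add) (auto intro!: sum.cong simp: monom_power card_Diff_subset finite_subset)
  finally show ?thesis ..
qed

text \<open>
  Let \<open>e\<close> be covered by \<open>C i\<close> alone. If \<open>a i = 0\<close>, respectively \<open>e \<notin> X\<close>, then no stratum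
  containing \<open>i\<close> can be fired, respectively has its once covered elements inside \<open>X\<close>, and
  \<open>i\<close> can be deleted. If \<open>a i > 0\<close>, respectively \<open>e \<in> X\<close>, then \<open>e\<close> can be removed from
  \<open>C i\<close>, after lowering \<open>a i\<close> by one. So both sides obey the same recursion. It ends when no
  element is covered exactly once: then every vector fires \<open>R\<close> and every \<open>X\<close> contains
  \<open>once C R\<close>, which makes both sides zero unless \<open>R\<close> is empty.
\<close>

lemma stable_poly:
  assumes "finite E" "finite R" "\<And>i. i \<in> R \<Longrightarrow> C i \<subseteq> E"
  shows "degree_poly R (stable C R) * [:1, -1:] ^ card R =
         subset_poly E {X. X \<subseteq> E \<and> (\<forall>\<sigma>\<subseteq>R. \<sigma> \<noteq> {} \<longrightarrow> \<not> once C \<sigma> \<subseteq> X)}"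
  using assms
proof (induction "card E" arbitrary: E R C rule: less_induct)
  case less
  let ?\<X> = "\<lambda>C R E. {X. X \<subseteq> E \<and> (\<forall>\<sigma>\<subseteq>R. \<sigma> \<noteq> {} \<longrightarrow> \<not> once C \<sigma> \<subseteq> X)}"
  have fC: "finite (C i)" if "i \<in> R" for i using less.prems that finite_subset by metis
  consider "R = {}" | "R \<noteq> {}" "once C R = {}" | e where "e \<in> once C R" by blast
  then show ?case
  proof cases
    case 1
    have "?\<X> C R E = Pow E" using 1 by auto
    then show ?thesis using 1 subset_poly_Pow[OF less.prems(1)]
      by (simp add: degree_poly_def)
  next
    case 2
    have "fires C R a" for a using 2 by (simp add: fires_def)
    then have A: "stable C R = {}" using 2(1) by (auto dest: stableD)
    have B: "?\<X> C R E = {}" using 2 by auto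
    show ?thesis unfolding A B by (simp add: degree_poly_def subset_poly_def)
  next
    case 3
    then obtain i where i: "i \<in> R" "e \<in> C i" and uniq: "\<And>j. j \<in> R \<Longrightarrow> e \<in> C j \<Longrightarrow> j = i"
      unfolding once_def by blast
    let ?E = "E - {e}" and ?R = "R - {i}"
    \<comment> \<open>the family in which \<open>e\<close> is contracted; deleting \<open>e\<close> removes the index \<open>i\<close>\<close>
    define C' where "C' = C(i := C i - {e})"
    have eE: "e \<in> E" using i less.prems by blast
    have lt: "card ?E < card E" using eE less.prems(1) by (meson card_Diff1_less)
    have cE: "card E = Suc (card ?E)" using eE less.prems(1) by (metis card.remove)
    have cR: "card R = Suc (card ?R)" using i less.prems(2) by (metis card.remove)
    have IH1: "degree_poly ?R (stable C ?R) * [:1, -1:] ^ card ?R = subset_poly ?E (?\<X> C ?R ?E)"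
      by (rule less.hyps[OF lt]) (use less.prems uniq in blast)+
    have IH2: "degree_poly R (stable C' R) * [:1, -1:] ^ card R = subset_poly ?E (?\<X> C' R ?E)"
      by (rule less.hyps[OF lt]) (use less.prems uniq in \<open>auto simp: C'_def\<close>)
    have eonce: "e \<in> once C \<sigma>" if "\<sigma> \<subseteq> R" "i \<in> \<sigma>" for \<sigma>
      using that i uniq unfolding once_def by blast
    have eonce': "e \<notin> once C \<sigma>" if "\<sigma> \<subseteq> ?R" for \<sigma>
      using that i uniq unfolding once_def by blast
    have once': "once C' \<sigma> = once C \<sigma> - {e}" if "\<sigma> \<subseteq> R" for \<sigma>
    proof -
      have *: "j \<in> \<sigma> \<and> x \<in> C' j \<longleftrightarrow> j \<in> \<sigma> \<and> x \<in> C j \<and> x \<noteq> e" for j x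
        using that uniq by (auto simp: C'_def)
      show ?thesis unfolding once_def * by blast
    qed
    have fin: "finite (stable C R)" "finite (stable C ?R)" "finite (stable C' R)"
      using less.prems fC by (auto intro!: finite_stable simp: C'_def)
    let ?up = "\<lambda>a. a(i := Suc (a i))"
    have fire': "fires C \<sigma> (?up a) \<longleftrightarrow> fires C' \<sigma> a" if "\<sigma> \<subseteq> R" for \<sigma> a
      unfolding fires_def
    proof (intro ball_cong refl)
      fix j assume j: "j \<in> \<sigma>"
      show "card (C j \<inter> once C \<sigma>) \<le> (?up a) j \<longleftrightarrow> card (C' j \<inter> once C' \<sigma>) \<le> a j"
      proof (cases "j = i")
        case True
        have "C i \<inter> once C \<sigma> = insert e (C' i \<inter> once C' \<sigma>)"
          using eonce[OF that] i j True once'[OF that] by (auto simp: C'_def)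
        moreover have "e \<notin> C' i" by (simp add: C'_def)
        moreover have "finite (C' i)" using fC i by (auto simp: C'_def)
        ultimately show ?thesis using True by simp
      next
        case False
        then have "C' j \<inter> once C' \<sigma> = C j \<inter> once C \<sigma>"
          using once'[OF that] uniq j that by (auto simp: C'_def)
        then show ?thesis using False by simp
      qed
    qed
    have split: "stable C R = stable C ?R \<union> ?up ` stable C' R"
    proof (intro equalityI subsetI)
      fix a assume a: "a \<in> stable C R"
      show "a \<in> stable C ?R \<union> ?up ` stable C' R"
      proof (cases "a i")
        case 0
        have "a \<in> stable C ?R"
        proof (rule stableI)
          show "a \<in> monomials ?R" using a 0 by (auto simp: stable_def monomials_def)
          fix \<sigma> assume "\<sigma> \<subseteq> ?R" "\<sigma> \<noteq> {}" "fires C \<sigma> a"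
          then show False using stableD[OF a, of \<sigma>] by blast
        qed
        then show ?thesis by blast
      next
        case (Suc n)
        have up: "?up (a(i := n)) = a" using Suc by auto
        have "a(i := n) \<in> stable C' R"
        proof (rule stableI)
          show "a(i := n) \<in> monomials R" using a i by (auto simp: stable_def monomials_def)
          fix \<sigma> assume "\<sigma> \<subseteq> R" "\<sigma> \<noteq> {}" "fires C' \<sigma> (a(i := n))"
          then have "fires C \<sigma> (?up (a(i := n)))" by (simp only: fire')
          then have "fires C \<sigma> a" by (simp only: up)
          then show False using stableD[OF a \<open>\<sigma> \<subseteq> R\<close> \<open>\<sigma> \<noteq> {}\<close>] by blast
        qed
        then show ?thesis by (intro UnI2 image_eqI[of a ?up "a(i := n)"]) (simp_all only: up)
      qed
    next
      fix a assume "a \<in> stable C ?R \<union> ?up ` stable C' R"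
      then consider "a \<in> stable C ?R" | b where "b \<in> stable C' R" "a = ?up b" by blast
      then show "a \<in> stable C R"
      proof cases
        case 1
        then have a0: "a i = 0" by (auto simp: stable_def monomials_def)
        show ?thesis
        proof (rule stableI)
          show "a \<in> monomials R" using 1 by (auto simp: stable_def monomials_def)
          fix \<sigma> assume s: "\<sigma> \<subseteq> R" "\<sigma> \<noteq> {}" "fires C \<sigma> a"
          show False
          proof (cases "i \<in> \<sigma>")
            case True
            then have "e \<in> C i \<inter> once C \<sigma>" using eonce s i by auto
            then have "card (C i \<inter> once C \<sigma>) > 0" using fC i by (auto simp: card_gt_0_iff)
            then show False using s(3) True a0 by (auto simp: fires_def)
          next
            case False
            then have "\<sigma> \<subseteq> ?R" using s by blast
            then show False using stableD[OF 1] s by blast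
          qed
        qed
      next
        case 2
        show ?thesis unfolding 2(2)
        proof (rule stableI)
          show "?up b \<in> monomials R" using 2 i by (auto simp: stable_def monomials_def)
          fix \<sigma> assume "\<sigma> \<subseteq> R" "\<sigma> \<noteq> {}" "fires C \<sigma> (?up b)"
          then show False using stableD[OF 2(1)] fire'[of \<sigma> b] by blast
        qed
      qed
    qed
    have disj: "stable C ?R \<inter> ?up ` stable C' R = {}"
    proof -
      have "a i = 0" if "a \<in> stable C ?R" for a using that by (auto simp: stable_def monomials_def)
      then show ?thesis by fastforce
    qed
    have inj: "inj_on ?up (stable C' R)"
    proof (rule inj_onI)
      fix a b assume "?up a = ?up b"
      then have eq: "(?up a) j = (?up b) j" for j by simp
      have "a j = b j" for j using eq[of j] by (simp split: if_splits)
      then show "a = b" by blast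
    qed
    have sR: "sum a R = sum a ?R" if "a \<in> stable C ?R" for a
      using that i less.prems(2) by (auto simp: sum.remove stable_def monomials_def)
    have sup: "sum (?up a) R = Suc (sum a R)" for a
      using i less.prems(2) by (simp add: sum.remove)
    have dp: "degree_poly R (stable C R) = degree_poly ?R (stable C ?R)
                 + monom 1 1 * degree_poly R (stable C' R)"
      unfolding degree_poly_def split
      by (subst sum.union_disjoint)
        (use fin disj in \<open>auto simp: sum.reindex[OF inj] o_def sR sup sum_distrib_left mult_monom
          simp del: fun_upd_apply\<close>)
    have Xsplit: "?\<X> C R E = ?\<X> C ?R ?E \<union> insert e ` ?\<X> C' R ?E"
    proof (intro equalityI subsetI)
      fix X assume X: "X \<in> ?\<X> C R E"
      show "X \<in> ?\<X> C ?R ?E \<union> insert e ` ?\<X> C' R ?E"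
      proof (cases "e \<in> X")
        case True
        have "\<not> once C' \<sigma> \<subseteq> X - {e}" if s: "\<sigma> \<subseteq> R" "\<sigma> \<noteq> {}" for \<sigma>
        proof
          assume "once C' \<sigma> \<subseteq> X - {e}"
          then have "once C \<sigma> \<subseteq> X" using once'[OF s(1)] True by blast
          then show False using X s by blast
        qed
        then have "X - {e} \<in> ?\<X> C' R ?E" using X by blast
        moreover have "X = insert e (X - {e})" using True by blast
        ultimately show ?thesis by blast
      next
        case False
        then show ?thesis using X by blast
      qed
    next
      fix X assume "X \<in> ?\<X> C ?R ?E \<union> insert e ` ?\<X> C' R ?E"
      then consider "X \<in> ?\<X> C ?R ?E" | Y where "Y \<in> ?\<X> C' R ?E" "X = insert e Y" by blast
      then show "X \<in> ?\<X> C R E"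
      proof cases
        case 1
        have "\<not> once C \<sigma> \<subseteq> X" if s: "\<sigma> \<subseteq> R" "\<sigma> \<noteq> {}" for \<sigma>
        proof (cases "i \<in> \<sigma>")
          case True
          then have "e \<in> once C \<sigma>" using eonce s by simp
          then show ?thesis using 1 by blast
        next
          case False
          then have "\<sigma> \<subseteq> ?R" using s by blast
          then show ?thesis using 1 s by blast
        qed
        then show ?thesis using 1 by blast
      next
        case 2
        have "\<not> once C \<sigma> \<subseteq> X" if s: "\<sigma> \<subseteq> R" "\<sigma> \<noteq> {}" for \<sigma>
        proof
          assume "once C \<sigma> \<subseteq> X"
          then have "once C' \<sigma> \<subseteq> Y" using once'[OF s(1)] 2 by blast
          then show False using 2 s by blast
        qed
        then show ?thesis using 2 eE by blast
      qed
    qed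
    have Xdisj: "?\<X> C ?R ?E \<inter> insert e ` ?\<X> C' R ?E = {}" by blast
    have Xinj: "inj_on (insert e) (?\<X> C' R ?E)"
    proof (rule inj_onI)
      fix X Y assume "X \<in> ?\<X> C' R ?E" "Y \<in> ?\<X> C' R ?E" and eq: "insert e X = insert e Y"
      then have "e \<notin> X" "e \<notin> Y" by blast+
      then show "X = Y" using insert_ident eq by metis
    qed
    have finX: "finite (?\<X> D Q ?E)" for D and Q :: "'b set"
      by (rule finite_subset[of _ "Pow E"]) (use less.prems(1) in auto)
    have 1: "card E - card X = Suc (card ?E - card X)" if "X \<subseteq> ?E" for X
      using card_mono[OF _ that] less.prems(1) cE by simp
    have 2: "card (insert e X) = Suc (card X)" if "X \<subseteq> ?E" for X
    proof (rule card_insert_disjoint)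
      show "finite X" using that less.prems(1) by (meson finite_Diff finite_subset)
      show "e \<notin> X" using that by blast
    qed
    have "subset_poly E (?\<X> C R E) =
        (\<Sum>X\<in>?\<X> C ?R ?E. monom 1 (card X) * [:1, -1:] ^ (card E - card X)) +
        (\<Sum>X\<in>?\<X> C' R ?E. monom 1 (card (insert e X)) * [:1, -1:] ^ (card E - card (insert e X)))"
      unfolding subset_poly_def Xsplit
      by (subst sum.union_disjoint) (use finX Xdisj in \<open>auto simp: sum.reindex[OF Xinj]\<close>)
    also have "(\<Sum>X\<in>?\<X> C ?R ?E. monom 1 (card X) * [:1, -1:] ^ (card E - card X)) =
        [:1, -1:] * subset_poly ?E (?\<X> C ?R ?E)"
      unfolding subset_poly_def sum_distrib_left
      by (rule sum.cong[OF refl]) (simp add: 1 mult_ac del: mult_pCons_left)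
    also have "(\<Sum>X\<in>?\<X> C' R ?E. monom 1 (card (insert e X)) * [:1, -1:] ^ (card E - card (insert e X)))
        = monom 1 1 * subset_poly ?E (?\<X> C' R ?E)"
      unfolding subset_poly_def sum_distrib_left
    proof (rule sum.cong[OF refl])
      fix X assume "X \<in> ?\<X> C' R ?E"
      then have X: "X \<subseteq> ?E" by blast
      show "monom 1 (card (insert e X)) * [:1, -1:] ^ (card E - card (insert e X)) =
        monom 1 1 * (monom (1::int) (card X) * [:1, -1:] ^ (card ?E - card X))"
        unfolding 2[OF X] cE mult.assoc[symmetric] mult_monom by simp
    qed
    finally show ?thesis unfolding dp IH1[symmetric] IH2[symmetric]
      by (simp add: cR algebra_simps del: mult_pCons_left mult_pCons_right)
  qed
qed

section \<open>The h-polynomial of an independence complex\<close>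

text \<open>
  The polynomial with coefficients \<open>h\<^sub>k\<close>: the coefficients of \<open>T(x,1)\<close> in reversed order.
  Unlike \<open>T(x,1)\<close> it is a sum of weights in the sense of \<open>subset_poly\<close>, up to a power of
  \<open>1 - t\<close>.
\<close>

definition h_poly :: "'e matroid \<Rightarrow> int poly" where
  "h_poly N = (\<Sum>I | indep N I. monom 1 (card I) * [:1, -1:] ^ (rank_of N (ground N) - card I))"

lemma coeff_one_minus_power:
  "coeff ([:1, -1:] ^ n :: int poly) j = (if j \<le> n then coeff ([:-1, 1:] ^ n) (n - j) else 0)"
proof -
  have "[:1, -1 :: int:] ^ n = reflect_poly ([:-1, 1:] ^ n)"
    by (simp add: reflect_poly_power reflect_poly_pCons)
  moreover have "degree ([:-1, 1 :: int:] ^ n) = n" by (simp add: degree_power_eq)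
  ultimately show ?thesis by (simp add: coeff_reflect_poly)
qed

locale independence_complex =
  fixes N :: "'e matroid"
  assumes finite_ground: "finite (ground N)"
    and indep_ground: "indep N I \<Longrightarrow> I \<subseteq> ground N"
    and indep_empty: "indep N {}"
begin

lemma finite_indep: "finite {I. indep N I}"
  by (rule finite_subset[of _ "Pow (ground N)"]) (use finite_ground indep_ground in auto)

lemma card_le_rank_of:
  assumes "indep N I" "I \<subseteq> X"
  shows "card I \<le> rank_of N X"
  unfolding rank_of_def by (rule Max_ge) (use assms finite_indep in \<open>auto intro!: finite_imageI\<close>)

lemma rank_of_attained: "\<exists>I. I \<subseteq> X \<and> indep N I \<and> card I = rank_of N X"
proof -
  have "rank_of N X \<in> card ` {I. I \<subseteq> X \<and> indep N I}"
    unfolding rank_of_def by (rule Max_in) (use indep_empty finite_indep in auto)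
  then show ?thesis by auto
qed

lemma rank_of_eq_card_iff:
  assumes "X \<subseteq> ground N"
  shows "card X \<le> rank_of N X \<longleftrightarrow> indep N X"
proof
  assume r: "card X \<le> rank_of N X"
  obtain I where I: "I \<subseteq> X" "indep N I" "card I = rank_of N X" using rank_of_attained by blast
  then have "I = X" using r assms finite_ground by (intro card_seteq) (auto intro: finite_subset)
  then show "indep N X" using I by simp
qed (auto intro: card_le_rank_of)

lemma rank_of_indep: "indep N X \<Longrightarrow> rank_of N X = card X"
proof (rule antisym)
  assume X: "indep N X"
  obtain I where I: "I \<subseteq> X" "indep N I" "card I = rank_of N X" using rank_of_attained by blast
  show "rank_of N X \<le> card X"
    using I X finite_ground indep_ground by (metis card_mono finite_subset)
  show "card X \<le> rank_of N X" using X card_le_rank_of by blast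
qed

text \<open>
  At \<open>y = 1\<close> the factor \<open>(y - 1)^(|X| - r(X))\<close> kills every \<open>X\<close> that is not independent.
\<close>

lemma tutte_at_one:
  "tutte N ([:0, 1:] :: int poly) 1 =
     (\<Sum>I | indep N I. [:-1, 1:] ^ (rank_of N (ground N) - card I))"
proof -
  have "tutte N ([:0, 1:] :: int poly) 1 = (\<Sum>X\<in>Pow (ground N).
      if indep N X then [:-1, 1:] ^ (rank_of N (ground N) - card X) else 0)"
    unfolding tutte_def
  proof (rule sum.cong[OF refl])
    fix X assume "X \<in> Pow (ground N)"
    then have "card X - rank_of N X = 0 \<longleftrightarrow> indep N X" using rank_of_eq_card_iff by auto
    moreover have "[:0, 1:] - 1 = [:-1, 1 :: int:]" by (simp add: one_pCons)
    ultimately show "([:0, 1:] - 1) ^ (rank_of N (ground N) - rank_of N X) *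
        (1 - 1 :: int poly) ^ (card X - rank_of N X) =
        (if indep N X then [:-1, 1:] ^ (rank_of N (ground N) - card X) else 0)"
      using rank_of_indep by auto
  qed
  also have "\<dots> = (\<Sum>I | indep N I. [:-1, 1:] ^ (rank_of N (ground N) - card I))"
    by (rule sum.mono_neutral_cong_right) (use finite_ground indep_ground in auto)
  finally show ?thesis .
qed

lemma coeff_h_poly: "coeff (h_poly N) k = h_vector N k"
proof -
  define d where "d = rank_of N (ground N)"
  have le: "card I \<le> d" if "indep N I" for I
    unfolding d_def using that indep_ground by (intro card_le_rank_of)
  have *: "coeff (monom 1 (card I) * [:1, -1 :: int:] ^ (d - card I)) k =
      (if k \<le> d then coeff ([:-1, 1:] ^ (d - card I)) (d - k) else 0)" if "indep N I" for I
  proof (cases "card I \<le> k")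
    case True
    then show ?thesis using le[OF that]
      by (auto simp: coeff_monom_mult coeff_one_minus_power le_diff_conv)
  next
    case False
    then have "degree ([:-1, 1 :: int:] ^ (d - card I)) < d - k"
      using le[OF that] by (simp add: degree_power_eq)
    then show ?thesis using False by (simp add: coeff_monom_mult coeff_eq_0)
  qed
  have "coeff (h_poly N) k = (\<Sum>I | indep N I.
      if k \<le> d then coeff ([:-1, 1:] ^ (d - card I)) (d - k) else 0)"
    unfolding h_poly_def coeff_sum d_def[symmetric] by (rule sum.cong) (use * in auto)
  also have "\<dots> = h_vector N k"
    by (simp add: h_vector_def tutte_at_one coeff_sum d_def)
  finally show ?thesis .
qed

lemma h_vector_0: "h_vector N 0 = 1"
proof -
  have "h_vector N 0 = (\<Sum>I | indep N I. if I = {} then 1 else 0)"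
    unfolding coeff_h_poly[symmetric] h_poly_def coeff_sum
  proof (rule sum.cong[OF refl])
    fix I assume "I \<in> {I. indep N I}"
    then have "finite I" using finite_ground indep_ground finite_subset by blast
    then have "card I = 0 \<longleftrightarrow> I = {}" by simp
    then show "coeff (monom 1 (card I) * [:1, - 1:] ^ (rank_of N (ground N) - card I)) 0 =
        (if I = {} then 1 else (0 :: int))"
      by (auto simp: coeff_monom_mult coeff_0_power)
  qed
  also have "\<dots> = 1" using finite_indep indep_empty by (simp add: sum.delta')
  finally show ?thesis .
qed

lemma h_vector_rank_0:
  assumes "rank_of N (ground N) = 0"
  shows "h_vector N = (\<lambda>k. if k = 0 then 1 else 0)"
  using h_vector_0 assms by (auto simp: h_vector_def fun_eq_iff)

lemma h_vector_rank_1: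
  assumes "rank_of N (ground N) = 1"
  shows "h_vector N = (\<lambda>k. if k = 0 then 1 else if k = 1 then int (card {e. indep N {e}}) - 1 else 0)"
proof -
  have eq: "{I. indep N I} = insert {} ((\<lambda>e. {e}) ` {e. indep N {e}})"
  proof (intro equalityI subsetI)
    fix I assume "I \<in> {I. indep N I}"
    then have "indep N I" "finite I" using finite_ground indep_ground finite_subset by blast+
    moreover from this have "card I \<le> 1" using card_le_rank_of[of I "ground N"] indep_ground assms by simp
    ultimately show "I \<in> insert {} ((\<lambda>e. {e}) ` {e. indep N {e}})"
      by (cases "card I = 1") (auto simp: card_1_singleton_iff le_Suc_eq)
  qed (use indep_empty in auto)
  have "finite {e. indep N {e}}"
    by (rule finite_subset[OF _ finite_ground]) (use indep_ground in auto)
  then have "h_poly N = [:1, -1:] + (\<Sum>e | indep N {e}. monom 1 1)"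
    unfolding h_poly_def eq assms
    by (subst sum.insert) (auto simp: sum.reindex inj_on_def)
  then have "coeff (h_poly N) 1 = int (card {e. indep N {e}}) - 1"
    by (simp add: coeff_sum del: sum_constant, simp)
  then show ?thesis using h_vector_0 coeff_h_poly[of 1] assms
    by (auto simp: h_vector_def fun_eq_iff le_Suc_eq)
qed

end

section \<open>Binary matroids and fundamental circuits\<close>

text \<open>
  The predicate \<open>ev\<close> singles out the cycle space, a linear space over the field with two
  elements whose addition is the symmetric difference.
\<close>

locale binary_matroid =
  fixes M :: "'e matroid" and ev :: "'e set \<Rightarrow> bool"
  assumes finite_ground: "finite (ground M)"
    and ev_empty: "ev {}"
    and ev_sym_diff: "ev D \<Longrightarrow> ev D' \<Longrightarrow> D \<subseteq> ground M \<Longrightarrow> D' \<subseteq> ground M \<Longrightarrow> ev (sym_diff D D')"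
    and indep_iff: "indep M X \<longleftrightarrow> X \<subseteq> ground M \<and> (\<forall>D\<subseteq>X. ev D \<longrightarrow> D = {})"
begin

lemma indep_subset: "indep M X \<Longrightarrow> Y \<subseteq> X \<Longrightarrow> indep M Y"
  unfolding indep_iff by blast

lemma indep_finite: "indep M X \<Longrightarrow> finite X"
  using finite_ground finite_subset indep_iff by blast

sublocale independence_complex M
  by unfold_locales (use finite_ground indep_iff in auto)

lemma indep_ev_empty: "indep M X \<Longrightarrow> D \<subseteq> X \<Longrightarrow> ev D \<Longrightarrow> D = {}"
  unfolding indep_iff by blast

text \<open>
  If no element of \<open>J\<close> could be added to \<open>I\<close>, every subset of \<open>J\<close> would be congruent to a
  subset of \<open>I\<close> modulo the cycle space. Two subsets of \<open>J\<close> with the same partner differ by a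
  member of the cycle space inside \<open>J\<close>, hence not at all; so the power set of \<open>J\<close> would
  embed into that of \<open>I\<close>.
\<close>

lemma augment:
  assumes "indep M I" "indep M J" "card I < card J"
  shows "\<exists>e\<in>J - I. indep M (insert e I)"
proof (rule ccontr)
  assume no: "\<not> ?thesis"
  have IJ: "I \<subseteq> ground M" "J \<subseteq> ground M" using assms indep_iff by auto
  have single: "\<exists>c\<subseteq>I. ev (sym_diff {e} c)" if e: "e \<in> J" for e
  proof (cases "e \<in> I")
    case True
    then show ?thesis using ev_empty by (intro exI[of _ "{e}"]) simp
  next
    case False
    then have "\<not> indep M (insert e I)" using no e by blast
    then obtain D where D: "D \<subseteq> insert e I" "ev D" "D \<noteq> {}" using e IJ unfolding indep_iff by blast
    then have "e \<in> D" using indep_ev_empty[OF assms(1)] by blast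
    then have "sym_diff {e} (D - {e}) = D" by blast
    then show ?thesis using D by (intro exI[of _ "D - {e}"]) auto
  qed
  have "\<exists>c\<subseteq>I. ev (sym_diff S c)" if "finite S" "S \<subseteq> J" for S
    using that
  proof (induction S rule: finite_induct)
    case empty
    then show ?case using ev_empty by (intro exI[of _ "{}"]) simp
  next
    case (insert e S)
    then obtain c where c: "c \<subseteq> I" "ev (sym_diff S c)" by auto
    have "e \<in> J" using insert(4) by blast
    then obtain c' where c': "c' \<subseteq> I" "ev (sym_diff {e} c')" using single by blast
    have "sym_diff (sym_diff S c) (sym_diff {e} c') = sym_diff (insert e S) (sym_diff c c')"
      using insert(2) by auto
    moreover have "ev (sym_diff (sym_diff S c) (sym_diff {e} c'))"
      by (rule ev_sym_diff[OF c(2) c'(2)]) (use c c' IJ insert(4) in auto)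
    ultimately show ?case using c c' by (intro exI[of _ "sym_diff c c'"]) auto
  qed
  then have "\<forall>S. \<exists>c. S \<subseteq> J \<longrightarrow> c \<subseteq> I \<and> ev (sym_diff S c)"
    using indep_finite[OF assms(2)] finite_subset by meson
  from choice[OF this] obtain f where f: "\<And>S. S \<subseteq> J \<Longrightarrow> f S \<subseteq> I \<and> ev (sym_diff S (f S))"
    by blast
  have "inj_on f (Pow J)"
  proof (rule inj_onI)
    fix S T assume ST: "S \<in> Pow J" "T \<in> Pow J" "f S = f T"
    have "ev (sym_diff (sym_diff S (f S)) (sym_diff T (f T)))"
      by (rule ev_sym_diff) (use f[of S] f[of T] ST(1,2) IJ in auto)
    moreover have "sym_diff (sym_diff S (f S)) (sym_diff T (f T)) = sym_diff S T"
      unfolding ST(3) by auto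
    ultimately have "sym_diff S T = {}"
      using ST by (intro indep_ev_empty[OF assms(2)]) auto
    then show "S = T" by blast
  qed
  moreover have "f ` Pow J \<subseteq> Pow I" using f by blast
  moreover have fin: "finite I" "finite J" using indep_finite assms by auto
  ultimately have "card (Pow J) \<le> card (Pow I)" by (intro card_inj_on_le[of f]) auto
  then have "(2::nat) ^ card J \<le> 2 ^ card I" using fin by (simp add: card_Pow)
  then show False using assms(3) by simp
qed

lemma extend:
  assumes "indep M I" "I \<subseteq> A" "indep M J" "J \<subseteq> A" "card I \<le> card J"
  shows "\<exists>K. I \<subseteq> K \<and> K \<subseteq> A \<and> indep M K \<and> card K = card J"
  using assms
proof (induction "card J - card I" arbitrary: I)
  case 0
  then show ?case by (intro exI[of _ I]) auto
next
  case (Suc n)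
  then have "card I < card J" by simp
  then obtain e where e: "e \<in> J - I" "indep M (insert e I)" using augment[OF Suc.prems(1,3)] by blast
  moreover have "card (insert e I) = Suc (card I)" using e indep_finite Suc.prems by auto
  ultimately have "\<exists>K. insert e I \<subseteq> K \<and> K \<subseteq> A \<and> indep M K \<and> card K = card J"
    using Suc.prems Suc.hyps(2) by (intro Suc.hyps(1)) auto
  then show ?case by blast
qed

end

locale based_binary_matroid = binary_matroid M ev for M :: "'e matroid" and ev +
  fixes B :: "'e set"
  assumes basis: "basis M B"
begin

abbreviation "E \<equiv> ground M"
abbreviation "R \<equiv> cobasis M B"
abbreviation "C \<equiv> fund_circuit M B"
abbreviation "cover \<sigma> \<equiv> (\<Union>i\<in>\<sigma>. C i)"

lemma indep_B: "indep M B" and B_ground: "B \<subseteq> E"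
  using basis by (auto simp: basis_def basis_of_def)

lemma finite_R: "finite R"
  using finite_ground by (simp add: cobasis_def)

text \<open>
  Two nonempty members of the cycle space inside \<open>insert i B\<close> both contain \<open>i\<close>, so their sum
  lies in the independent set \<open>B\<close> and vanishes.
\<close>

lemma fund_circuit:
  assumes "i \<in> R"
  shows "ev (C i)" "i \<in> C i" "C i \<subseteq> insert i B"
proof -
  have i: "i \<in> E" "i \<notin> B" using assms by (auto simp: cobasis_def)
  then have "\<not> indep M (insert i B)"
    using basis unfolding basis_def basis_of_def by blast
  then obtain D where D: "D \<subseteq> insert i B" "ev D" "D \<noteq> {}"
    using i B_ground unfolding indep_iff by blast
  have mem: "i \<in> D'" if "D' \<subseteq> insert i B" "ev D'" "D' \<noteq> {}" for D'
    using indep_ev_empty[OF indep_B] that by blast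
  have uniq: "D' = D" if D': "D' \<subseteq> insert i B" "ev D'" "D' \<noteq> {}" for D'
  proof -
    have "ev (sym_diff D' D)"
      by (rule ev_sym_diff) (use D D' i B_ground in auto)
    moreover have "sym_diff D' D \<subseteq> B" using mem[OF D'] mem[OF D] D D' by blast
    ultimately have "sym_diff D' D = {}" using indep_ev_empty[OF indep_B] by blast
    then show ?thesis by blast
  qed
  have dep: "D \<subseteq> Y" if Y: "Y \<subseteq> insert i B" "\<not> indep M Y" for Y
  proof -
    obtain D' where "D' \<subseteq> Y" "ev D'" "D' \<noteq> {}"
      using Y i B_ground unfolding indep_iff by blast
    then show ?thesis using uniq[of D'] Y by blast
  qed
  have circ: "circuit M D"
    unfolding circuit_def
  proof (intro conjI allI impI)
    show "D \<subseteq> E" using D i B_ground by blast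
    show "\<not> indep M D" using D unfolding indep_iff by blast
    show "indep M D'" if "D' \<subset> D" for D' using dep[of D'] that D by blast
  qed
  have only: "C' = D" if "circuit M C'" "C' \<subseteq> insert i B" for C'
  proof -
    have "D \<subseteq> C'" using dep that by (auto simp: circuit_def)
    moreover have "\<not> indep M D" using D unfolding indep_iff by blast
    ultimately show ?thesis using that(1) by (auto simp: circuit_def)
  qed
  have "C i = D"
    unfolding fund_circuit_def
  proof (rule the_equality)
    show "circuit M D \<and> D \<subseteq> insert i B" using circ D(1) ..
    show "C' = D" if "circuit M C' \<and> C' \<subseteq> insert i B" for C' using that only by simp
  qed
  then show "ev (C i)" "i \<in> C i" "C i \<subseteq> insert i B" using D mem[OF D] by auto
qed

lemma fund_circuit_ground: "i \<in> R \<Longrightarrow> C i \<subseteq> E"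
  using fund_circuit(3)[of i] B_ground by (auto simp: cobasis_def)

lemma finite_fund_circuit: "i \<in> R \<Longrightarrow> finite (C i)"
  using fund_circuit_ground finite_ground finite_subset by blast

lemma cover_ground: "\<sigma> \<subseteq> R \<Longrightarrow> cover \<sigma> \<subseteq> E"
  using fund_circuit_ground by blast

lemma finite_cover: "\<sigma> \<subseteq> R \<Longrightarrow> finite (cover \<sigma>)"
  by (rule finite_subset[OF cover_ground finite_ground])

lemma fund_circuit_inter_R: "i \<in> R \<Longrightarrow> C i \<inter> R = {i}"
  using fund_circuit(2,3)[of i] by (auto simp: cobasis_def)

lemma cover_inter_R: "\<sigma> \<subseteq> R \<Longrightarrow> cover \<sigma> \<inter> R = \<sigma>"
proof -
  assume "\<sigma> \<subseteq> R"
  then have "C i \<inter> R = {i}" if "i \<in> \<sigma>" for i using fund_circuit_inter_R that by blast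
  moreover have "cover \<sigma> \<inter> R = (\<Union>i\<in>\<sigma>. C i \<inter> R)" by blast
  ultimately show ?thesis by simp
qed

lemma once_inter_R:
  assumes "\<sigma> \<subseteq> R"
  shows "once C \<sigma> \<inter> R = \<sigma>"
proof -
  have "i \<in> once C \<sigma>" if "i \<in> \<sigma>" for i
  proof -
    have "j = i" if "j \<in> \<sigma>" "i \<in> C j" for j
    proof -
      have "i \<in> C j \<inter> R" "j \<in> R" using that \<open>i \<in> \<sigma>\<close> assms by auto
      then show ?thesis using fund_circuit_inter_R[of j] by simp
    qed
    moreover have "i \<in> C i" using that assms fund_circuit(2) by blast
    ultimately show ?thesis unfolding once_def using that by blast
  qed
  then have "\<sigma> \<subseteq> once C \<sigma> \<inter> R" using assms by auto
  moreover have "once C \<sigma> \<inter> R \<subseteq> cover \<sigma> \<inter> R" by (rule Int_mono[OF once_subset order_refl])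
  ultimately show ?thesis unfolding cover_inter_R[OF assms] by (intro equalityI)
qed

lemma self_in_once: "\<sigma> \<subseteq> R \<Longrightarrow> i \<in> \<sigma> \<Longrightarrow> i \<in> once C \<sigma>"
  by (rule IntD1[OF equalityD2[OF once_inter_R, THEN subsetD]])

lemma once_in_R: "\<sigma> \<subseteq> R \<Longrightarrow> i \<in> once C \<sigma> \<Longrightarrow> i \<in> R \<Longrightarrow> i \<in> \<sigma>"
  by (rule equalityD1[OF once_inter_R, THEN subsetD, OF _ IntI])

lemma dependent_fund_circuit: "i \<in> R \<Longrightarrow> C i \<subseteq> X \<Longrightarrow> \<not> indep M X"
  using fund_circuit unfolding indep_iff by blast

text \<open>
  The sum of \<open>D\<close> and of the circuits \<open>C j\<close> with \<open>j \<in> D \<inter> R\<close> lies in \<open>B\<close>, so it is empty.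
\<close>

lemma ev_iff_odd_cover:
  assumes "ev D" "D \<subseteq> E"
  shows "e \<in> D \<longleftrightarrow> odd (card {j \<in> D \<inter> R. e \<in> C j})"
proof -
  define L where "L \<rho> = {e. odd (card {j \<in> \<rho>. e \<in> C j})}" for \<rho>
  have L: "ev (L \<rho>) \<and> L \<rho> \<subseteq> E \<and> L \<rho> \<inter> R = \<rho>" if "finite \<rho>" "\<rho> \<subseteq> R" for \<rho>
    using that
  proof (induction \<rho> rule: finite_induct)
    case empty
    then show ?case using ev_empty by (simp add: L_def)
  next
    case (insert j \<rho>)
    have "{i. (i = j \<or> i \<in> \<rho>) \<and> e \<in> C i} =
        (if e \<in> C j then insert j {i \<in> \<rho>. e \<in> C i} else {i \<in> \<rho>. e \<in> C i})" for e by auto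
    then have eq: "L (insert j \<rho>) = sym_diff (L \<rho>) (C j)"
      using insert(1,2) by (auto simp: L_def split: if_splits)
    have IH: "ev (L \<rho>)" "L \<rho> \<subseteq> E" "L \<rho> \<inter> R = \<rho>" using insert by auto
    have j: "j \<in> R" using insert by blast
    have "ev (sym_diff (L \<rho>) (C j))"
      using IH fund_circuit(1) fund_circuit_ground j by (intro ev_sym_diff) auto
    moreover have "sym_diff (L \<rho>) (C j) \<subseteq> E" using IH fund_circuit_ground[OF j] by blast
    moreover have "sym_diff (L \<rho>) (C j) \<inter> R = insert j \<rho>"
    proof -
      have "sym_diff (L \<rho>) (C j) \<inter> R = sym_diff (L \<rho> \<inter> R) (C j \<inter> R)" by blast
      then show ?thesis unfolding IH(3) fund_circuit_inter_R[OF j] using insert(2) by blast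
    qed
    ultimately show ?case unfolding eq by blast
  qed
  have fin: "finite (D \<inter> R)" using finite_R by blast
  have l: "ev (L (D \<inter> R))" "L (D \<inter> R) \<subseteq> E" "L (D \<inter> R) \<inter> R = D \<inter> R" using L[OF fin] by auto
  have "ev (sym_diff D (L (D \<inter> R)))" using l assms by (intro ev_sym_diff) auto
  moreover have "sym_diff D (L (D \<inter> R)) \<subseteq> B" using l assms by (auto simp: cobasis_def)
  ultimately have "sym_diff D (L (D \<inter> R)) = {}" using indep_ev_empty[OF indep_B] by blast
  then have "D = L (D \<inter> R)" by blast
  then show ?thesis unfolding L_def by blast
qed

text \<open>
  This sandwich is the form in which the cycle space acts on strata: a dependent set
  contains \<open>once C \<rho>\<close> for the trace \<open>\<rho>\<close> of one of its members of the cycle space, and that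
  member stays inside the circuits of \<open>\<rho>\<close>.
\<close>

lemma ev_between:
  assumes "ev D" "D \<subseteq> E" "D \<noteq> {}"
  shows "D \<inter> R \<noteq> {}" "once C (D \<inter> R) \<subseteq> D" "D \<subseteq> cover (D \<inter> R)"
proof -
  show "D \<inter> R \<noteq> {}" using indep_ev_empty[OF indep_B] assms by (auto simp: cobasis_def)
  show "once C (D \<inter> R) \<subseteq> D"
  proof
    fix e assume "e \<in> once C (D \<inter> R)"
    then have "card {j \<in> D \<inter> R. e \<in> C j} = 1" by (simp only: once_def card_Collect_eq_1_iff mem_Collect_eq)
    then have "odd (card {j \<in> D \<inter> R. e \<in> C j})" by (simp only: odd_one not_False_eq_True)
    then show "e \<in> D" by (rule iffD2[OF ev_iff_odd_cover[OF assms(1,2)]])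
  qed
  show "D \<subseteq> cover (D \<inter> R)"
  proof
    fix e assume "e \<in> D"
    then have "odd (card {j \<in> D \<inter> R. e \<in> C j})" by (rule iffD1[OF ev_iff_odd_cover[OF assms(1,2)]])
    then have "{j \<in> D \<inter> R. e \<in> C j} \<noteq> {}" by (metis card.empty even_zero)
    then show "e \<in> cover (D \<inter> R)" by blast
  qed
qed

lemma once_covered_eq:
  assumes "\<sigma> \<subseteq> R"
  shows "once_covered M B \<sigma> = once C \<sigma>"
proof -
  have "once_covered M B \<sigma> = E \<inter> once C \<sigma>"
    unfolding once_covered_def cover_mult_def once_def card_Collect_eq_1_iff by blast
  then show ?thesis using once_subset[of C \<sigma>] cover_ground[OF assms] by blast
qed

lemma covered_eq:
  assumes "\<sigma> \<subseteq> R"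
  shows "covered M B \<sigma> = cover \<sigma>"
proof -
  have "finite \<sigma>" using assms finite_R finite_subset by blast
  then have "1 \<le> card {i \<in> \<sigma>. e \<in> C i} \<longleftrightarrow> e \<in> cover \<sigma>" for e
    by (auto simp: Suc_le_eq card_gt_0_iff)
  then show ?thesis using cover_ground[OF assms] by (auto simp: covered_def cover_mult_def)
qed

lemma baseline_eq:
  "\<sigma> \<subseteq> R \<Longrightarrow> baseline M B \<sigma> i = (if i \<in> \<sigma> then card (C i \<inter> once C \<sigma>) else 0)"
  by (simp add: baseline_def once_covered_eq)

lemma can_fire_eq: "\<sigma> \<subseteq> R \<Longrightarrow> can_fire M B \<sigma> a \<longleftrightarrow> fires C \<sigma> a"
  by (simp add: can_fire_def fires_def baseline_eq)

lemma dead_eq: "dead M B \<sigma> \<longleftrightarrow> \<sigma> \<noteq> {} \<and> \<sigma> \<subseteq> R \<and> indep M (once C \<sigma>)"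
  by (auto simp: dead_def stratum_def once_covered_eq)

lemma sum_baseline:
  assumes "\<sigma> \<subseteq> R"
  shows "sum (baseline M B \<sigma>) \<sigma> = card (once C \<sigma>)"
proof -
  have "once C \<sigma> = (\<Union>i\<in>\<sigma>. C i \<inter> once C \<sigma>)" using once_subset[of C \<sigma>] by blast
  also have "card \<dots> = (\<Sum>i\<in>\<sigma>. card (C i \<inter> once C \<sigma>))"
    using assms finite_R finite_fund_circuit
    by (intro card_UN_disjoint) (auto intro: finite_subset simp: once_def)
  finally show ?thesis using baseline_eq[OF assms] by simp
qed

lemma card_cover: "\<sigma> \<subseteq> R \<Longrightarrow> card (cover \<sigma>) = card (cover \<sigma> \<inter> B) + card \<sigma>"
proof -
  assume s: "\<sigma> \<subseteq> R"
  have "cover \<sigma> = (cover \<sigma> \<inter> B) \<union> \<sigma>"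
    using cover_inter_R[OF s] cover_ground[OF s] by (auto simp: cobasis_def)
  moreover have "(cover \<sigma> \<inter> B) \<inter> \<sigma> = {}" using s by (auto simp: cobasis_def)
  ultimately show ?thesis using finite_cover[OF s] by (metis card_Un_disjoint finite_Un)
qed

text \<open>
  The set \<open>cover \<sigma> \<inter> B\<close> is a basis of \<open>cover \<sigma>\<close>, because adding \<open>i \<in> \<sigma>\<close> to it closes \<open>C i\<close>.
\<close>

lemma card_indep_cover:
  assumes "\<sigma> \<subseteq> R" "indep M I" "I \<subseteq> cover \<sigma>"
  shows "card I + card \<sigma> \<le> card (cover \<sigma>)"
proof (rule ccontr)
  assume "\<not> ?thesis"
  then have "card (cover \<sigma> \<inter> B) < card I" using card_cover[OF assms(1)] by simp
  then obtain e where e: "e \<in> I - (cover \<sigma> \<inter> B)" "indep M (insert e (cover \<sigma> \<inter> B))"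
    using augment[of "cover \<sigma> \<inter> B" I] assms(2) indep_subset[OF indep_B] by blast
  moreover from this have "e \<in> cover \<sigma>" "e \<notin> B" using assms(3) by auto
  moreover from this have "e \<in> R" using cover_ground[OF assms(1)] by (auto simp: cobasis_def)
  ultimately have "e \<in> \<sigma>" using cover_inter_R[OF assms(1)] by blast
  then have "C e \<subseteq> insert e (cover \<sigma> \<inter> B)" "e \<in> R" using fund_circuit(3)[of e] assms(1) by auto
  then show False using dependent_fund_circuit e by blast
qed

lemma extend_cover:
  assumes "\<sigma> \<subseteq> R" "indep M I" "I \<subseteq> cover \<sigma>"
  shows "\<exists>K. I \<subseteq> K \<and> K \<subseteq> cover \<sigma> \<and> indep M K \<and> card K + card \<sigma> = card (cover \<sigma>)"
proof -
  have "card I \<le> card (cover \<sigma> \<inter> B)" using card_indep_cover[OF assms] card_cover[OF assms(1)] by simp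
  then obtain K where "I \<subseteq> K" "K \<subseteq> cover \<sigma>" "indep M K" "card K = card (cover \<sigma> \<inter> B)"
    using extend[OF assms(2,3) indep_subset[OF indep_B Int_lower2] Int_lower1] by blast
  then show ?thesis using card_cover[OF assms(1)] by auto
qed

lemma rank_ground: "rank_of M E = card B"
proof -
  obtain I where I: "indep M I" "card I = rank_of M E" using rank_of_attained by blast
  have "card I \<le> card B"
  proof (rule ccontr)
    assume "\<not> ?thesis"
    then obtain e where "e \<in> I - B" "indep M (insert e B)"
      using augment[OF indep_B I(1)] by auto
    then show False using basis I(1) indep_ground unfolding basis_def basis_of_def by blast
  qed
  then show ?thesis using I card_le_rank_of[OF indep_B B_ground] by simp
qed

lemma card_R: "card E = card B + card R"
  using finite_ground B_ground unfolding cobasis_def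
  by (metis card_Diff_subset card_mono finite_subset le_add_diff_inverse)

lemma h_poly_ground: "h_poly M * [:1, -1:] ^ card R = subset_poly E {X. indep M X}"
  unfolding h_poly_def subset_poly_def sum_distrib_right
proof (rule sum.cong[OF refl])
  fix I assume "I \<in> {I. indep M I}"
  then have "card I \<le> card B" using card_le_rank_of[of I E] indep_ground rank_ground by auto
  then have "card E - card I = (card B - card I) + card R" using card_R by simp
  then show "monom 1 (card I) * [:1, - 1:] ^ (rank_of M E - card I) * [:1, - 1:] ^ card R =
      monom (1 :: int) (card I) * [:1, - 1:] ^ (card E - card I)"
    by (simp only: rank_ground power_add mult.assoc)
qed

section \<open>The minor of a dead stratum\<close>

text \<open>
  An independent set is its own only basis, so contracting \<open>once C \<sigma>\<close> needs no choice.
\<close>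

lemma stratum_minor:
  assumes "\<sigma> \<subseteq> R" "indep M (once C \<sigma>)"
  shows "ground (stratum_minor M B \<sigma>) = cover \<sigma> - once C \<sigma>"
    and "indep (stratum_minor M B \<sigma>) I \<longleftrightarrow> I \<subseteq> cover \<sigma> - once C \<sigma> \<and> indep M (I \<union> once C \<sigma>)"
proof -
  let ?N = "restriction M (cover \<sigma>)"
  have "indep ?N (once C \<sigma>)" using assms once_subset[of C \<sigma>] by (simp add: restriction_def)
  then have "basis_of ?N (once C \<sigma>) J \<longleftrightarrow> J = once C \<sigma>" for J
    unfolding basis_of_def by (metis order_refl psubsetI psubset_subset_trans psubset_eq)
  moreover have "E \<inter> cover \<sigma> = cover \<sigma>" using cover_ground[OF assms(1)] by blast
  ultimately show "ground (stratum_minor M B \<sigma>) = cover \<sigma> - once C \<sigma>"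
    and "indep (stratum_minor M B \<sigma>) I \<longleftrightarrow> I \<subseteq> cover \<sigma> - once C \<sigma> \<and> indep M (I \<union> once C \<sigma>)"
    using once_subset[of C \<sigma>]
    by (auto simp: stratum_minor_def contraction_def restriction_def once_covered_eq covered_eq assms(1))
qed

lemma stratum_minor_complex:
  assumes "\<sigma> \<subseteq> R" "indep M (once C \<sigma>)"
  shows "independence_complex (stratum_minor M B \<sigma>)"
  by unfold_locales (use finite_cover assms in \<open>auto simp: stratum_minor\<close>)

lemma stratum_minor_rank:
  assumes "\<sigma> \<subseteq> R" "indep M (once C \<sigma>)"
  shows "rank_of (stratum_minor M B \<sigma>) (ground (stratum_minor M B \<sigma>))
           + card (once C \<sigma>) + card \<sigma> = card (cover \<sigma>)"
proof -
  let ?K = "stratum_minor M B \<sigma>" and ?U = "once C \<sigma>"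
  interpret K: independence_complex ?K using stratum_minor_complex[OF assms] .
  obtain I where I: "indep ?K I" "card I = rank_of ?K (ground ?K)" using K.rank_of_attained by blast
  then have I': "I \<subseteq> cover \<sigma> - ?U" "indep M (I \<union> ?U)" using stratum_minor(2)[OF assms] by auto
  have "card (I \<union> ?U) = card I + card ?U"
    using I' indep_finite[OF I'(2)] by (intro card_Un_disjoint) auto
  moreover have "card (I \<union> ?U) + card \<sigma> \<le> card (cover \<sigma>)"
    using card_indep_cover[OF assms(1) I'(2)] I' once_subset[of C \<sigma>] by blast
  moreover obtain J where J: "?U \<subseteq> J" "J \<subseteq> cover \<sigma>" "indep M J" "card J + card \<sigma> = card (cover \<sigma>)"
    using extend_cover[OF assms once_subset] by blast
  moreover have "card (J - ?U) \<le> rank_of ?K (ground ?K)"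
    using J by (intro K.card_le_rank_of)
      (auto simp: stratum_minor[OF assms] Un_absorb2 intro!: indep_subset[OF J(3)])
  moreover have "card J = card (J - ?U) + card ?U"
    using J indep_finite[OF J(3)] by (metis card_Diff_subset card_mono finite_subset le_add_diff_inverse2)
  ultimately show ?thesis using I(2) by linarith
qed

text \<open>
  Adding \<open>once C \<sigma>\<close> to the independent sets of the minor gives the sets on the right; the
  powers of \<open>1 - t\<close> match since the minor has \<open>card \<sigma>\<close> more elements than its rank.
\<close>

lemma h_poly_stratum_minor:
  assumes "\<sigma> \<subseteq> R" "indep M (once C \<sigma>)"
  shows "monom 1 (card (once C \<sigma>)) * h_poly (stratum_minor M B \<sigma>) * [:1, -1:] ^ card \<sigma> =
         subset_poly (cover \<sigma>) {X. X \<subseteq> cover \<sigma> \<and> once C \<sigma> \<subseteq> X \<and> indep M X}"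
proof -
  let ?K = "stratum_minor M B \<sigma>" and ?U = "once C \<sigma>"
  interpret K: independence_complex ?K using stratum_minor_complex[OF assms] .
  have eq: "{X. X \<subseteq> cover \<sigma> \<and> ?U \<subseteq> X \<and> indep M X} = (\<lambda>I. I \<union> ?U) ` {I. indep ?K I}"
  proof (intro equalityI subsetI)
    fix X assume X: "X \<in> {X. X \<subseteq> cover \<sigma> \<and> ?U \<subseteq> X \<and> indep M X}"
    have "(X - ?U) \<union> ?U = X" "X - ?U \<subseteq> cover \<sigma> - ?U" using X by blast+
    moreover from this have "indep ?K (X - ?U)"
      using X stratum_minor(2)[OF assms, of "X - ?U"] by (simp only: mem_Collect_eq)
    ultimately show "X \<in> (\<lambda>I. I \<union> ?U) ` {I. indep ?K I}"
      by (metis (no_types, lifting) image_eqI mem_Collect_eq)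
  next
    fix X assume "X \<in> (\<lambda>I. I \<union> ?U) ` {I. indep ?K I}"
    then show "X \<in> {X. X \<subseteq> cover \<sigma> \<and> ?U \<subseteq> X \<and> indep M X}"
      unfolding stratum_minor(2)[OF assms] using once_subset[of C \<sigma>] by blast
  qed
  have inj: "inj_on (\<lambda>I. I \<union> ?U) {I. indep ?K I}"
  proof (rule inj_onI)
    fix I J assume "I \<in> {I. indep ?K I}" "J \<in> {I. indep ?K I}" "I \<union> ?U = J \<union> ?U"
    moreover from this have "I \<inter> ?U = {}" "J \<inter> ?U = {}" using stratum_minor(2)[OF assms] by blast+
    ultimately show "I = J" by blast
  qed
  show ?thesis
    unfolding eq h_poly_def subset_poly_def sum.reindex[OF inj] sum_distrib_left sum_distrib_right o_def
  proof (rule sum.cong[OF refl])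
    fix I assume "I \<in> {I. indep ?K I}"
    then have I: "indep ?K I" by simp
    then have I': "I \<subseteq> cover \<sigma> - ?U" "indep M (I \<union> ?U)" using stratum_minor(2)[OF assms] by auto
    have c: "card (I \<union> ?U) = card ?U + card I"
      using I' indep_finite[OF I'(2)] by (subst card_Un_disjoint) auto
    have "card I \<le> rank_of ?K (ground ?K)" using I K.card_le_rank_of K.indep_ground by blast
    then have d: "card (cover \<sigma>) - card (I \<union> ?U) = (rank_of ?K (ground ?K) - card I) + card \<sigma>"
      using stratum_minor_rank[OF assms] c by simp
    have m: "monom 1 (card (I \<union> ?U)) = monom 1 (card ?U) * monom (1 :: int) (card I)"
      by (simp add: c mult_monom)
    show "monom 1 (card ?U) * (monom 1 (card I) * [:1, - 1:] ^ (rank_of ?K (ground ?K) - card I)) *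
         [:1, - 1:] ^ card \<sigma> =
         monom (1 :: int) (card (I \<union> ?U)) * [:1, - 1:] ^ (card (cover \<sigma>) - card (I \<union> ?U))"
      by (simp only: m d power_add mult.assoc)
  qed
qed

end

section \<open>Maximal strata\<close>

context based_binary_matroid
begin

abbreviation "off \<sigma> \<equiv> (\<lambda>i. C i - cover \<sigma>)"

definition max_fired :: "('e \<Rightarrow> nat) \<Rightarrow> 'e set" where
  "max_fired a = \<Union>{\<sigma>. \<sigma> \<subseteq> R \<and> fires C \<sigma> a}"

definition max_inside :: "'e set \<Rightarrow> 'e set" where
  "max_inside X = \<Union>{\<sigma>. \<sigma> \<subseteq> R \<and> once C \<sigma> \<subseteq> X}"

lemma max_fired_subset: "max_fired a \<subseteq> R"
  by (auto simp: max_fired_def)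

lemma max_inside_subset: "max_inside X \<subseteq> R"
  by (auto simp: max_inside_def)

lemma fires_max_fired: "fires C (max_fired a) a"
  unfolding max_fired_def by (rule fires_Union) (use finite_fund_circuit in auto)

lemma once_max_inside: "once C (max_inside X) \<subseteq> X"
  unfolding max_inside_def using once_Union[of C "{\<sigma>. \<sigma> \<subseteq> R \<and> once C \<sigma> \<subseteq> X}"] by blast

lemma le_max_fired: "\<sigma> \<subseteq> R \<Longrightarrow> fires C \<sigma> a \<Longrightarrow> \<sigma> \<subseteq> max_fired a"
  by (auto simp: max_fired_def)

lemma le_max_inside: "\<sigma> \<subseteq> R \<Longrightarrow> once C \<sigma> \<subseteq> X \<Longrightarrow> \<sigma> \<subseteq> max_inside X"
  by (auto simp: max_inside_def)

lemma once_off: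
  assumes "\<sigma> \<inter> \<tau> = {}"
  shows "once (off \<sigma>) \<tau> = once C (\<sigma> \<union> \<tau>) - cover \<sigma>"
proof (rule set_eqI)
  fix e
  show "e \<in> once (off \<sigma>) \<tau> \<longleftrightarrow> e \<in> once C (\<sigma> \<union> \<tau>) - cover \<sigma>"
  proof (cases "e \<in> cover \<sigma>")
    case False
    then have "i \<in> \<tau> \<and> e \<in> off \<sigma> i \<longleftrightarrow> i \<in> \<sigma> \<union> \<tau> \<and> e \<in> C i" for i by blast
    then have "(\<exists>!i. i \<in> \<tau> \<and> e \<in> off \<sigma> i) \<longleftrightarrow> (\<exists>!i. i \<in> \<sigma> \<union> \<tau> \<and> e \<in> C i)" by presburger
    then show ?thesis using False by (simp only: once_def mem_Collect_eq Diff_iff simp_thms)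
  qed (auto simp: once_def)
qed

lemma once_union_inside: "once C (\<sigma> \<union> \<tau>) \<inter> cover \<sigma> \<subseteq> once C \<sigma>"
  unfolding once_def by blast

lemma once_off_inter:
  assumes "\<sigma> \<inter> \<tau> = {}" "i \<in> \<tau>"
  shows "off \<sigma> i \<inter> once (off \<sigma>) \<tau> = C i \<inter> once C (\<sigma> \<union> \<tau>)"
proof -
  have "e \<notin> cover \<sigma>" if "e \<in> C i" "e \<in> once C (\<sigma> \<union> \<tau>)" for e
    using that assms unfolding once_def by blast
  then show ?thesis unfolding once_off[OF assms(1)] by blast
qed

text \<open>
  Relative to \<open>\<sigma>\<close>, the rest of a larger stratum behaves like a stratum of the family
  \<open>off \<sigma>\<close>. The members of \<open>\<sigma>\<close> impose no further condition, as their baselines have only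
  decreased.
\<close>

lemma fires_off:
  assumes "\<sigma> \<inter> \<tau> = {}" "\<sigma> \<subseteq> R" "\<tau> \<subseteq> R" "fires C \<sigma> a"
  shows "fires (off \<sigma>) \<tau> a \<longleftrightarrow> fires C (\<sigma> \<union> \<tau>) a"
proof -
  have "card (C i \<inter> once C (\<sigma> \<union> \<tau>)) \<le> a i" if "i \<in> \<sigma>" for i
  proof -
    have "card (C i \<inter> once C (\<sigma> \<union> \<tau>)) \<le> card (C i \<inter> once C \<sigma>)"
      by (rule card_mono[OF _ once_antimono]) (use that assms finite_fund_circuit in auto)
    then show ?thesis using assms(4) that by (auto simp: fires_def)
  qed
  moreover have "fires (off \<sigma>) \<tau> a \<longleftrightarrow> (\<forall>i\<in>\<tau>. card (C i \<inter> once C (\<sigma> \<union> \<tau>)) \<le> a i)"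
    unfolding fires_def using once_off_inter[OF assms(1)] by (intro ball_cong) simp_all
  ultimately show ?thesis unfolding fires_def by blast
qed

lemma once_off_subset:
  assumes "\<sigma> \<inter> \<tau> = {}" "once C \<sigma> \<subseteq> X"
  shows "once (off \<sigma>) \<tau> \<subseteq> X \<longleftrightarrow> once C (\<sigma> \<union> \<tau>) \<subseteq> X"
  unfolding once_off[OF assms(1)] using assms(2) once_union_inside[of \<sigma> \<tau>] by blast

lemma max_fired_eq_iff:
  assumes "\<sigma> \<subseteq> R"
  shows "max_fired a = \<sigma> \<longleftrightarrow>
    fires C \<sigma> a \<and> (\<forall>\<tau>\<subseteq>R - \<sigma>. \<tau> \<noteq> {} \<longrightarrow> \<not> fires (off \<sigma>) \<tau> a)" (is "_ \<longleftrightarrow> ?rhs")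
proof
  assume eq: "max_fired a = \<sigma>"
  have f: "fires C \<sigma> a" using fires_max_fired[of a] eq by simp
  have "\<not> fires (off \<sigma>) \<tau> a" if t: "\<tau> \<subseteq> R - \<sigma>" "\<tau> \<noteq> {}" for \<tau>
  proof
    assume "fires (off \<sigma>) \<tau> a"
    then have "fires C (\<sigma> \<union> \<tau>) a" using fires_off[of \<sigma> \<tau> a] t assms f by blast
    then have "\<sigma> \<union> \<tau> \<subseteq> \<sigma>" using le_max_fired[of "\<sigma> \<union> \<tau>" a] eq t assms by auto
    then show False using t by blast
  qed
  then show ?rhs using f by blast
next
  assume r: ?rhs
  let ?\<tau> = "max_fired a - \<sigma>"
  have le: "\<sigma> \<subseteq> max_fired a" by (rule le_max_fired[OF assms conjunct1[OF r]])
  then have "\<sigma> \<union> ?\<tau> = max_fired a" by blast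
  then have "fires (off \<sigma>) ?\<tau> a"
    using fires_off[of \<sigma> ?\<tau> a] fires_max_fired[of a] max_fired_subset[of a] assms r by auto
  moreover have "?\<tau> \<subseteq> R - \<sigma>" using max_fired_subset by blast
  ultimately have "?\<tau> = {}" using r by blast
  then show "max_fired a = \<sigma>" using le by blast
qed

lemma max_inside_eq_iff:
  assumes "\<sigma> \<subseteq> R"
  shows "max_inside X = \<sigma> \<longleftrightarrow>
    once C \<sigma> \<subseteq> X \<and> (\<forall>\<tau>\<subseteq>R - \<sigma>. \<tau> \<noteq> {} \<longrightarrow> \<not> once (off \<sigma>) \<tau> \<subseteq> X)" (is "_ \<longleftrightarrow> ?rhs")
proof
  assume eq: "max_inside X = \<sigma>"
  have f: "once C \<sigma> \<subseteq> X" using once_max_inside[of X] eq by simp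
  have "\<not> once (off \<sigma>) \<tau> \<subseteq> X" if t: "\<tau> \<subseteq> R - \<sigma>" "\<tau> \<noteq> {}" for \<tau>
  proof
    assume "once (off \<sigma>) \<tau> \<subseteq> X"
    moreover have "\<sigma> \<inter> \<tau> = {}" using t by blast
    ultimately have "once C (\<sigma> \<union> \<tau>) \<subseteq> X" using once_off_subset f by blast
    then have "\<sigma> \<union> \<tau> \<subseteq> \<sigma>" using le_max_inside[of "\<sigma> \<union> \<tau>" X] eq t assms by auto
    then show False using t by blast
  qed
  then show ?rhs using f by blast
next
  assume r: ?rhs
  let ?\<tau> = "max_inside X - \<sigma>"
  have le: "\<sigma> \<subseteq> max_inside X" by (rule le_max_inside[OF assms conjunct1[OF r]])
  then have "\<sigma> \<union> ?\<tau> = max_inside X" by blast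
  then have "once (off \<sigma>) ?\<tau> \<subseteq> X"
    using once_off_subset[of \<sigma> ?\<tau> X] once_max_inside[of X] r by auto
  moreover have "?\<tau> \<subseteq> R - \<sigma>" using max_inside_subset by blast
  ultimately have "?\<tau> = {}" using r by blast
  then show "max_inside X = \<sigma>" using le by blast
qed

section \<open>Decomposition of independent sets and of relaxed coparking functions\<close>

definition inner_sets :: "'e set \<Rightarrow> 'e set set" where
  "inner_sets \<sigma> = {X. X \<subseteq> cover \<sigma> \<and> once C \<sigma> \<subseteq> X \<and> indep M X}"

text \<open>
  With \<open>inner_sets\<close> these are the two factors of a cell: the independent sets \<open>X\<close> for which
  \<open>\<sigma>\<close> is the largest stratum with \<open>once C \<sigma> \<subseteq> X\<close>.
\<close>

definition outer_sets :: "'e set \<Rightarrow> 'e set set" where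
  "outer_sets \<sigma> = {X. X \<subseteq> E - cover \<sigma> \<and> (\<forall>\<tau>\<subseteq>R - \<sigma>. \<tau> \<noteq> {} \<longrightarrow> \<not> once (off \<sigma>) \<tau> \<subseteq> X)}"

text \<open>
  A nonempty member \<open>D\<close> of the cycle space inside \<open>X\<close> would give \<open>once C (D \<inter> R) \<subseteq> D \<subseteq> X\<close>,
  so \<open>D \<inter> R\<close> would be part of the largest stratum, and \<open>D\<close> would lie in the circuits of that
  stratum.
\<close>

lemma indep_max_inside:
  assumes "X \<subseteq> E" "indep M (X \<inter> cover (max_inside X))"
  shows "indep M X"
  unfolding indep_iff
proof (intro conjI allI impI)
  fix D assume D: "D \<subseteq> X" "ev D"
  show "D = {}"
  proof (rule ccontr)
    assume "D \<noteq> {}"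
    have DE: "D \<subseteq> E" using D assms by blast
    have "once C (D \<inter> R) \<subseteq> X" using ev_between(2)[OF D(2) DE \<open>D \<noteq> {}\<close>] D(1) by blast
    then have "D \<inter> R \<subseteq> max_inside X" by (intro le_max_inside) auto
    then have "cover (D \<inter> R) \<subseteq> cover (max_inside X)" by blast
    with ev_between(3)[OF D(2) DE \<open>D \<noteq> {}\<close>] have "D \<subseteq> cover (max_inside X)"
      by (rule subset_trans)
    then have "D \<subseteq> X \<inter> cover (max_inside X)" using D(1) by (rule Int_greatest[rotated])
    then show False using indep_ev_empty[OF assms(2)] D(2) \<open>D \<noteq> {}\<close> by blast
  qed
qed (rule assms(1))

lemma indep_cell:
  assumes "\<sigma> \<subseteq> R"
  shows "bij_betw (\<lambda>(X1, X2). X1 \<union> X2) (inner_sets \<sigma> \<times> outer_sets \<sigma>) {X. indep M X \<and> max_inside X = \<sigma>}"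
proof (rule bij_betw_byWitness[where f' = "\<lambda>X. (X \<inter> cover \<sigma>, X - cover \<sigma>)"])
  let ?P = "\<lambda>X. (\<forall>\<tau>\<subseteq>R - \<sigma>. \<tau> \<noteq> {} \<longrightarrow> \<not> once (off \<sigma>) \<tau> \<subseteq> X)"
  have off: "once (off \<sigma>) \<tau> \<inter> cover \<sigma> = {}" for \<tau>
    using once_subset[of "off \<sigma>" \<tau>] by blast
  have P: "?P (X1 \<union> X2) \<longleftrightarrow> ?P X2" if "X1 \<subseteq> cover \<sigma>" for X1 X2
  proof -
    have "once (off \<sigma>) \<tau> \<subseteq> X1 \<union> X2 \<longleftrightarrow> once (off \<sigma>) \<tau> \<subseteq> X2" for \<tau>
      using off[of \<tau>] that by blast
    then show ?thesis by simp
  qed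
  show "\<forall>p\<in>inner_sets \<sigma> \<times> outer_sets \<sigma>.
      (\<lambda>X. (X \<inter> cover \<sigma>, X - cover \<sigma>)) ((\<lambda>(X1, X2). X1 \<union> X2) p) = p"
    by (auto simp: inner_sets_def outer_sets_def)
  show "\<forall>X\<in>{X. indep M X \<and> max_inside X = \<sigma>}.
      (\<lambda>(X1, X2). X1 \<union> X2) (X \<inter> cover \<sigma>, X - cover \<sigma>) = X" by auto
  show "(\<lambda>(X1, X2). X1 \<union> X2) ` (inner_sets \<sigma> \<times> outer_sets \<sigma>) \<subseteq> {X. indep M X \<and> max_inside X = \<sigma>}"
  proof
    fix X assume "X \<in> (\<lambda>(X1, X2). X1 \<union> X2) ` (inner_sets \<sigma> \<times> outer_sets \<sigma>)"
    then obtain X1 X2 where X: "X = X1 \<union> X2" "X1 \<in> inner_sets \<sigma>" "X2 \<in> outer_sets \<sigma>" by auto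
    then have c: "X1 \<subseteq> cover \<sigma>" "once C \<sigma> \<subseteq> X1" "indep M X1" "X2 \<subseteq> E - cover \<sigma>" "?P X2"
      unfolding inner_sets_def outer_sets_def by blast+
    have m: "max_inside X = \<sigma>"
      unfolding max_inside_eq_iff[OF assms] X(1) P[OF c(1)] using c(2,5) by blast
    have "X \<inter> cover \<sigma> = X1" using c X(1) by blast
    then have "indep M (X \<inter> cover (max_inside X))" using c(3) m by simp
    moreover have "X \<subseteq> E" using X(1) c indep_ground by blast
    ultimately show "X \<in> {X. indep M X \<and> max_inside X = \<sigma>}" using indep_max_inside m by blast
  qed
  show "(\<lambda>X. (X \<inter> cover \<sigma>, X - cover \<sigma>)) ` {X. indep M X \<and> max_inside X = \<sigma>}
      \<subseteq> inner_sets \<sigma> \<times> outer_sets \<sigma>"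
  proof
    fix p assume "p \<in> (\<lambda>X. (X \<inter> cover \<sigma>, X - cover \<sigma>)) ` {X. indep M X \<and> max_inside X = \<sigma>}"
    then obtain X where X: "p = (X \<inter> cover \<sigma>, X - cover \<sigma>)" "indep M X" "max_inside X = \<sigma>" by blast
    have m: "once C \<sigma> \<subseteq> X" "?P X" using X(3) unfolding max_inside_eq_iff[OF assms] by blast+
    have "X \<inter> cover \<sigma> \<in> inner_sets \<sigma>"
      unfolding inner_sets_def using indep_subset[OF X(2)] m(1) once_subset[of C \<sigma>] by blast
    moreover have "X - cover \<sigma> \<in> outer_sets \<sigma>"
      unfolding outer_sets_def using m(2) indep_ground[OF X(2)] by blast
    ultimately show "p \<in> inner_sets \<sigma> \<times> outer_sets \<sigma>" using X(1) by blast
  qed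
qed

lemma indep_poly_split:
  "subset_poly E {X. indep M X} =
     (\<Sum>\<sigma>\<in>Pow R. subset_poly (cover \<sigma>) (inner_sets \<sigma>) * subset_poly (E - cover \<sigma>) (outer_sets \<sigma>))"
proof -
  let ?w = "\<lambda>X. monom (1::int) (card X) * [:1, -1:] ^ (card E - card X)"
  have "subset_poly E {X. indep M X} = (\<Sum>\<sigma>\<in>Pow R. \<Sum>X\<in>{X \<in> {X. indep M X}. max_inside X = \<sigma>}. ?w X)"
    unfolding subset_poly_def
    by (rule sum.group[symmetric]) (use finite_indep finite_R max_inside_subset in auto)
  also have "\<dots> = (\<Sum>\<sigma>\<in>Pow R. subset_poly (cover \<sigma>) (inner_sets \<sigma>) * subset_poly (E - cover \<sigma>) (outer_sets \<sigma>))"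
  proof (rule sum.cong[OF refl])
    fix \<sigma> assume "\<sigma> \<in> Pow R"
    then have s: "\<sigma> \<subseteq> R" by simp
    let ?A = "cover \<sigma>"
    have AE: "?A \<subseteq> E" using cover_ground[OF s] .
    have "(\<Sum>X\<in>{X \<in> {X. indep M X}. max_inside X = \<sigma>}. ?w X) =
        (\<Sum>p\<in>inner_sets \<sigma> \<times> outer_sets \<sigma>. ?w (fst p \<union> snd p))"
      using sum.reindex_bij_betw[OF indep_cell[OF s], of ?w] by (simp add: case_prod_unfold)
    also have "\<dots> = (\<Sum>p\<in>inner_sets \<sigma> \<times> outer_sets \<sigma>.
        (monom 1 (card (fst p)) * [:1, -1:] ^ (card ?A - card (fst p))) *
        (monom 1 (card (snd p)) * [:1, -1:] ^ (card (E - ?A) - card (snd p))))"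
    proof (rule sum.cong[OF refl])
      fix p assume "p \<in> inner_sets \<sigma> \<times> outer_sets \<sigma>"
      then obtain X Y where p: "p = (X, Y)" "X \<in> inner_sets \<sigma>" "Y \<in> outer_sets \<sigma>" by auto
      then have X: "X \<subseteq> ?A" and Y: "Y \<subseteq> E - ?A" by (auto simp: inner_sets_def outer_sets_def)
      have fin: "finite ?A" "finite (E - ?A)" using AE finite_ground finite_subset by auto
      have "card (X \<union> Y) = card X + card Y"
        using X Y fin finite_subset by (intro card_Un_disjoint) blast+
      moreover have "card X \<le> card ?A" "card Y \<le> card (E - ?A)" using X Y fin card_mono by blast+
      moreover have "card E = card ?A + card (E - ?A)"
        using fin AE finite_ground by (metis card_Diff_subset card_mono le_add_diff_inverse)
      ultimately have d: "card E - card (X \<union> Y) = (card ?A - card X) + (card (E - ?A) - card Y)"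
        and c: "card (X \<union> Y) = card X + card Y" by auto
      have m: "monom 1 (card (X \<union> Y)) = monom 1 (card X) * monom (1::int) (card Y)"
        by (simp add: c mult_monom)
      show "?w (fst p \<union> snd p) = (monom 1 (card (fst p)) * [:1, -1:] ^ (card ?A - card (fst p))) *
        (monom 1 (card (snd p)) * [:1, -1:] ^ (card (E - ?A) - card (snd p)))"
        by (simp only: p fst_conv snd_conv m d power_add mult.assoc mult.left_commute)
    qed
    also have "\<dots> = subset_poly ?A (inner_sets \<sigma>) * subset_poly (E - ?A) (outer_sets \<sigma>)"
      unfolding subset_poly_def sum_product sum.cartesian_product by (simp add: case_prod_unfold)
    finally show "(\<Sum>X\<in>{X \<in> {X. indep M X}. max_inside X = \<sigma>}. ?w X) =
        subset_poly ?A (inner_sets \<sigma>) * subset_poly (E - ?A) (outer_sets \<sigma>)" .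
  qed
  finally show ?thesis .
qed

definition compose_at :: "'e set \<Rightarrow> ('e \<Rightarrow> nat) \<Rightarrow> ('e \<Rightarrow> nat) \<Rightarrow> 'e \<Rightarrow> nat" where
  "compose_at \<sigma> m c i = baseline M B \<sigma> i + m i + c i"

lemma compose_at:
  assumes "\<sigma> \<subseteq> R" "m \<in> monomials \<sigma>" "c \<in> stable (off \<sigma>) (R - \<sigma>)"
  shows "compose_at \<sigma> m c \<in> monomials R" "max_fired (compose_at \<sigma> m c) = \<sigma>"
    "residue M B \<sigma> (compose_at \<sigma> m c) = m"
    "sum (compose_at \<sigma> m c) R = card (once C \<sigma>) + sum m \<sigma> + sum c (R - \<sigma>)"
    "i \<notin> \<sigma> \<Longrightarrow> compose_at \<sigma> m c i = c i"
proof -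
  have m0: "m i = 0" if "i \<notin> \<sigma>" for i using assms(2) that by (auto simp: monomials_def)
  have c0: "c i = 0" if "i \<notin> R - \<sigma>" for i using assms(3) that unfolding stable_def monomials_def by blast
  have b: "baseline M B \<sigma> i = (if i \<in> \<sigma> then card (C i \<inter> once C \<sigma>) else 0)" for i
    by (rule baseline_eq[OF assms(1)])
  have on: "compose_at \<sigma> m c i = baseline M B \<sigma> i + m i" if "i \<in> \<sigma>" for i
    using c0 that by (simp add: compose_at_def)
  have out: "compose_at \<sigma> m c i = c i" if "i \<notin> \<sigma>" for i
    using m0 that by (simp add: compose_at_def b)
  show "i \<notin> \<sigma> \<Longrightarrow> compose_at \<sigma> m c i = c i" by (rule out)
  have "compose_at \<sigma> m c i = 0" if "i \<notin> R" for i
    using that assms(1) c0 m0 by (auto simp: compose_at_def b)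
  then show "compose_at \<sigma> m c \<in> monomials R" by (simp add: monomials_def)
  show "residue M B \<sigma> (compose_at \<sigma> m c) = m"
    using on m0 by (auto simp: residue_def fun_eq_iff)
  have "fires C \<sigma> (compose_at \<sigma> m c)" unfolding fires_def using on b by simp
  moreover have "\<not> fires (off \<sigma>) \<tau> (compose_at \<sigma> m c)" if "\<tau> \<subseteq> R - \<sigma>" "\<tau> \<noteq> {}" for \<tau>
  proof
    assume "fires (off \<sigma>) \<tau> (compose_at \<sigma> m c)"
    then have "fires (off \<sigma>) \<tau> c" by (rule fires_mono) (use out that in auto)
    then show False using stableD[OF assms(3) that] by blast
  qed
  ultimately show "max_fired (compose_at \<sigma> m c) = \<sigma>" unfolding max_fired_eq_iff[OF assms(1)] by blast
  have "sum (compose_at \<sigma> m c) R = sum (compose_at \<sigma> m c) \<sigma> + sum (compose_at \<sigma> m c) (R - \<sigma>)"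
    using assms(1) finite_R by (metis add.commute sum.subset_diff)
  moreover have "sum (compose_at \<sigma> m c) \<sigma> = sum (baseline M B \<sigma>) \<sigma> + sum m \<sigma>"
    unfolding sum.distrib[symmetric] by (rule sum.cong) (auto simp: on)
  moreover have "sum (compose_at \<sigma> m c) (R - \<sigma>) = sum c (R - \<sigma>)"
    by (rule sum.cong) (auto simp: out)
  ultimately show "sum (compose_at \<sigma> m c) R = card (once C \<sigma>) + sum m \<sigma> + sum c (R - \<sigma>)"
    using sum_baseline[OF assms(1)] by simp
qed

lemma decompose_at:
  assumes "a \<in> monomials R" "max_fired a = \<sigma>"
  shows "(\<lambda>i. if i \<in> \<sigma> then 0 else a i) \<in> stable (off \<sigma>) (R - \<sigma>)"
    "compose_at \<sigma> (residue M B \<sigma> a) (\<lambda>i. if i \<in> \<sigma> then 0 else a i) = a"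
proof -
  have s: "\<sigma> \<subseteq> R" using assms(2) max_fired_subset by blast
  have f: "fires C \<sigma> a" and nf: "\<And>\<tau>. \<tau> \<subseteq> R - \<sigma> \<Longrightarrow> \<tau> \<noteq> {} \<Longrightarrow> \<not> fires (off \<sigma>) \<tau> a"
    using assms(2) unfolding max_fired_eq_iff[OF s] by blast+
  show "(\<lambda>i. if i \<in> \<sigma> then 0 else a i) \<in> stable (off \<sigma>) (R - \<sigma>)"
  proof (rule stableI)
    show "(\<lambda>i. if i \<in> \<sigma> then 0 else a i) \<in> monomials (R - \<sigma>)"
      using assms(1) by (auto simp: monomials_def)
    fix \<tau> assume t: "\<tau> \<subseteq> R - \<sigma>" "\<tau> \<noteq> {}" "fires (off \<sigma>) \<tau> (\<lambda>i. if i \<in> \<sigma> then 0 else a i)"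
    have "fires (off \<sigma>) \<tau> a" using t(3) by (rule fires_mono) auto
    then show False using nf t by blast
  qed
  show "compose_at \<sigma> (residue M B \<sigma> a) (\<lambda>i. if i \<in> \<sigma> then 0 else a i) = a"
    using f by (auto simp: compose_at_def residue_def baseline_eq[OF s] fires_def fun_eq_iff)
qed

text \<open>
  The empty set is treated as a dead stratum with the fibre \<open>{0}\<close>, so that the vectors from
  which nothing can be fired form a cell like any other.
\<close>

definition fibre_or_unit :: "('e set \<Rightarrow> ('e \<Rightarrow> nat) set) \<Rightarrow> 'e set \<Rightarrow> ('e \<Rightarrow> nat) set" where
  "fibre_or_unit F \<sigma> = (if \<sigma> = {} then {\<lambda>_. 0} else if dead M B \<sigma> then F \<sigma> else {})"

lemma residue_cong:
  assumes "\<And>i. i \<in> \<tau> \<Longrightarrow> a i = b i"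
  shows "residue M B \<tau> a = residue M B \<tau> b"
  using assms by (auto simp: residue_def fun_eq_iff)

lemma fires_cong: "(\<And>i. i \<in> \<tau> \<Longrightarrow> a i = b i) \<Longrightarrow> fires C \<tau> a = fires C \<tau> b"
  by (auto simp: fires_def)

text \<open>
  It suffices to test the largest fireable stratum: on it the vector is the baseline plus a
  member of the fibre, and the closure condition of that fibre speaks about all smaller
  strata.
\<close>

lemma relaxed_coparking_iff:
  assumes F: "fibre_system M B F" and a: "a \<in> monomials R"
  shows "a \<in> relaxed_coparking M B F \<longleftrightarrow>
    residue M B (max_fired a) a \<in> fibre_or_unit F (max_fired a)" (is "_ \<longleftrightarrow> ?r")
proof
  let ?\<sigma> = "max_fired a"
  have s: "?\<sigma> \<subseteq> R" by (rule max_fired_subset)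
  assume r: "a \<in> relaxed_coparking M B F"
  show ?r
  proof (cases "?\<sigma> = {}")
    case True
    then show ?thesis by (auto simp: fibre_or_unit_def residue_def)
  next
    case False
    then have "stratum M B ?\<sigma>" using s by (simp add: stratum_def)
    moreover have "can_fire M B ?\<sigma> a" using fires_max_fired can_fire_eq[OF s] by blast
    ultimately have "dead M B ?\<sigma> \<and> residue M B ?\<sigma> a \<in> F ?\<sigma>" using r by (simp add: relaxed_coparking_def)
    then show ?thesis using False by (simp add: fibre_or_unit_def)
  qed
next
  let ?\<sigma> = "max_fired a"
  have s: "?\<sigma> \<subseteq> R" by (rule max_fired_subset)
  assume r: ?r
  have "dead M B \<tau> \<and> residue M B \<tau> a \<in> F \<tau>" if t: "stratum M B \<tau>" "can_fire M B \<tau> a" for \<tau>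
  proof -
    have tR: "\<tau> \<subseteq> R" "\<tau> \<noteq> {}" using t(1) by (auto simp: stratum_def)
    have ft: "fires C \<tau> a" using t(2) can_fire_eq[OF tR(1)] by blast
    then have le: "\<tau> \<subseteq> ?\<sigma>" using le_max_fired tR by blast
    then have d: "dead M B ?\<sigma>" "residue M B ?\<sigma> a \<in> F ?\<sigma>"
      using r tR by (auto simp: fibre_or_unit_def split: if_splits)
    show ?thesis
    proof (cases "\<tau> = ?\<sigma>")
      case True
      then show ?thesis using d by simp
    next
      case False
      define m where "m = residue M B ?\<sigma> a"
      have eq: "baseline M B ?\<sigma> i + m i = a i" if "i \<in> \<tau>" for i
        using fires_max_fired[of a] that le
        by (auto simp: m_def residue_def baseline_eq[OF s] fires_def)
      have "fires C \<tau> (\<lambda>i. baseline M B ?\<sigma> i + m i)"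
        using ft fires_cong[of \<tau> "\<lambda>i. baseline M B ?\<sigma> i + m i" a] eq by simp
      then have "can_fire M B \<tau> (\<lambda>i. baseline M B ?\<sigma> i + m i)" using can_fire_eq[OF tR(1)] by blast
      moreover have "fibre_at M B F ?\<sigma> (F ?\<sigma>)" using F d(1) by (simp add: fibre_system_def)
      ultimately have "dead M B \<tau> \<and> residue M B \<tau> (\<lambda>i. baseline M B ?\<sigma> i + m i) \<in> F \<tau>"
        using t(1) le False d(2) unfolding fibre_at_def m_def[symmetric] by blast
      then show ?thesis
        using residue_cong[of \<tau> "\<lambda>i. baseline M B ?\<sigma> i + m i" a] eq by simp
    qed
  qed
  then show "a \<in> relaxed_coparking M B F" using a by (simp add: relaxed_coparking_def)
qed

lemma fibre_or_unit_monomials: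
  assumes "fibre_system M B F"
  shows "fibre_or_unit F \<sigma> \<subseteq> monomials \<sigma>" "finite (fibre_or_unit F \<sigma>)"
  using assms by (auto simp: fibre_or_unit_def fibre_system_def fibre_at_def pure_multicomplex_def
      multicomplex_def monomials_def)

lemma relaxed_cell:
  assumes F: "fibre_system M B F" and s: "\<sigma> \<subseteq> R"
  shows "bij_betw (\<lambda>(m, c). compose_at \<sigma> m c) (fibre_or_unit F \<sigma> \<times> stable (off \<sigma>) (R - \<sigma>))
           {a \<in> relaxed_coparking M B F. max_fired a = \<sigma>}"
proof (rule bij_betw_byWitness[where f' = "\<lambda>a. (residue M B \<sigma> a, \<lambda>i. if i \<in> \<sigma> then 0 else a i)"])
  let ?P = "fibre_or_unit F \<sigma> \<times> stable (off \<sigma>) (R - \<sigma>)"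
    and ?g = "\<lambda>a. (residue M B \<sigma> a, \<lambda>i. if i \<in> \<sigma> then 0 else a i)"
    and ?Q = "{a \<in> relaxed_coparking M B F. max_fired a = \<sigma>}"
  note comp = compose_at[OF s subsetD[OF fibre_or_unit_monomials(1)[OF F]]]
  show "\<forall>p\<in>?P. ?g ((\<lambda>(m, c). compose_at \<sigma> m c) p) = p"
  proof
    fix p assume "p \<in> ?P"
    then obtain m c where p: "p = (m, c)" "m \<in> fibre_or_unit F \<sigma>" "c \<in> stable (off \<sigma>) (R - \<sigma>)" by blast
    have "c i = 0" if "i \<in> \<sigma>" for i using p(3) that by (auto simp: stable_def monomials_def)
    then have "(\<lambda>i. if i \<in> \<sigma> then 0 else compose_at \<sigma> m c i) = c"
      using comp(5)[OF p(2,3)] by (auto simp: fun_eq_iff)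
    then show "?g ((\<lambda>(m, c). compose_at \<sigma> m c) p) = p"
      unfolding p(1) prod.case using comp(3)[OF p(2,3)] by simp
  qed
  have Q: "a \<in> monomials R" "max_fired a = \<sigma>" "residue M B \<sigma> a \<in> fibre_or_unit F \<sigma>" if "a \<in> ?Q" for a
    using that relaxed_coparking_iff[OF F, of a] by (auto simp: relaxed_coparking_def)
  show "\<forall>a\<in>?Q. (\<lambda>(m, c). compose_at \<sigma> m c) (?g a) = a"
  proof
    fix a assume a: "a \<in> ?Q"
    show "(\<lambda>(m, c). compose_at \<sigma> m c) (?g a) = a"
      unfolding prod.case by (rule decompose_at(2)[OF Q(1)[OF a] Q(2)[OF a]])
  qed
  show "(\<lambda>(m, c). compose_at \<sigma> m c) ` ?P \<subseteq> ?Q"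
  proof
    fix a assume "a \<in> (\<lambda>(m, c). compose_at \<sigma> m c) ` ?P"
    then obtain m c where a: "a = compose_at \<sigma> m c"
      and mc: "m \<in> fibre_or_unit F \<sigma>" "c \<in> stable (off \<sigma>) (R - \<sigma>)" by auto
    show "a \<in> ?Q"
      unfolding a using relaxed_coparking_iff[OF F comp(1)[OF mc]] comp(2,3)[OF mc] mc(1) by simp
  qed
  show "?g ` ?Q \<subseteq> ?P" using Q decompose_at(1) by blast
qed

text \<open>
  This matches the inner factors. At a nonempty \<open>\<sigma>\<close> it restates that the fibre has degree
  sequence \<open>h\<close> of the minor, and both sides are zero if \<open>\<sigma>\<close> is not dead.
\<close>

lemma fibre_poly:
  assumes F: "fibre_system M B F" and s: "\<sigma> \<subseteq> R"
  shows "monom 1 (card (once C \<sigma>)) * degree_poly \<sigma> (fibre_or_unit F \<sigma>) * [:1, -1:] ^ card \<sigma> =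
         subset_poly (cover \<sigma>) (inner_sets \<sigma>)"
proof (cases "indep M (once C \<sigma>)")
  case True
  interpret K: independence_complex "stratum_minor M B \<sigma>" using stratum_minor_complex[OF s True] .
  have "degree_poly \<sigma> (fibre_or_unit F \<sigma>) = h_poly (stratum_minor M B \<sigma>)"
  proof (cases "\<sigma> = {}")
    case e: True
    have "{X. X \<subseteq> {} \<and> {} \<subseteq> X \<and> indep M X} = {{}}" using indep_empty by auto
    then have "h_poly (stratum_minor M B {}) = 1"
      using h_poly_stratum_minor[of "{}"] indep_empty by (simp add: subset_poly_def)
    then show ?thesis using e by (simp add: fibre_or_unit_def degree_poly_def)
  next
    case False
    then have d: "dead M B \<sigma>" using s True by (simp add: dead_eq)
    then have f: "fibre_at M B F \<sigma> (F \<sigma>)" using F by (simp add: fibre_system_def)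
    then have "finite (F \<sigma>)" by (simp add: fibre_at_def pure_multicomplex_def multicomplex_def)
    then have "coeff (degree_poly \<sigma> (F \<sigma>)) k = coeff (h_poly (stratum_minor M B \<sigma>)) k" for k
      using f by (simp add: coeff_degree_poly K.coeff_h_poly fibre_at_def)
    then show ?thesis using d False by (simp add: fibre_or_unit_def poly_eq_iff)
  qed
  then show ?thesis using h_poly_stratum_minor[OF s True] by (simp only: inner_sets_def)
next
  case False
  then have "fibre_or_unit F \<sigma> = {}" using indep_empty by (auto simp: fibre_or_unit_def dead_eq)
  moreover have "inner_sets \<sigma> = {}" unfolding inner_sets_def using False indep_subset by blast
  ultimately show ?thesis by (simp add: degree_poly_def subset_poly_def)
qed

text \<open>
  Both the relaxed coparking functions and the independent sets are partitioned by their
  largest stratum. Cell by cell the inner factors agree by \<open>fibre_poly\<close> and the outer ones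
  by \<open>stable_poly\<close>; the common factor \<open>(1 - t)^|R|\<close> cancels.
\<close>

theorem degree_poly_relaxed_coparking:
  assumes F: "fibre_system M B F" and fin: "finite (relaxed_coparking M B F)"
  shows "degree_poly R (relaxed_coparking M B F) = h_poly M"
proof -
  let ?S = "\<lambda>\<sigma>. stable (off \<sigma>) (R - \<sigma>)"
  have "degree_poly R (relaxed_coparking M B F) =
      (\<Sum>\<sigma>\<in>Pow R. \<Sum>a\<in>{a \<in> relaxed_coparking M B F. max_fired a = \<sigma>}. monom 1 (sum a R))"
    unfolding degree_poly_def
    by (rule sum.group[symmetric]) (use fin finite_R max_fired_subset in auto)
  also have "\<dots> = (\<Sum>\<sigma>\<in>Pow R. monom 1 (card (once C \<sigma>)) * degree_poly \<sigma> (fibre_or_unit F \<sigma>) *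
      degree_poly (R - \<sigma>) (?S \<sigma>))"
  proof (rule sum.cong[OF refl])
    fix \<sigma> assume "\<sigma> \<in> Pow R"
    then have s: "\<sigma> \<subseteq> R" by simp
    have "(\<Sum>a\<in>{a \<in> relaxed_coparking M B F. max_fired a = \<sigma>}. monom 1 (sum a R)) =
        (\<Sum>p\<in>fibre_or_unit F \<sigma> \<times> ?S \<sigma>. monom (1::int) (sum (compose_at \<sigma> (fst p) (snd p)) R))"
      using sum.reindex_bij_betw[OF relaxed_cell[OF F s], of "\<lambda>a. monom (1::int) (sum a R)", symmetric]
      by (simp add: case_prod_unfold)
    also have "\<dots> = (\<Sum>p\<in>fibre_or_unit F \<sigma> \<times> ?S \<sigma>. monom 1 (card (once C \<sigma>)) *
        (monom 1 (sum (fst p) \<sigma>) * monom 1 (sum (snd p) (R - \<sigma>))))"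
    proof (rule sum.cong[OF refl])
      fix p assume p: "p \<in> fibre_or_unit F \<sigma> \<times> ?S \<sigma>"
      then have "fst p \<in> monomials \<sigma>" "snd p \<in> ?S \<sigma>"
        using fibre_or_unit_monomials(1)[OF F, of \<sigma>] by auto
      then show "monom (1::int) (sum (compose_at \<sigma> (fst p) (snd p)) R) = monom 1 (card (once C \<sigma>)) *
        (monom 1 (sum (fst p) \<sigma>) * monom 1 (sum (snd p) (R - \<sigma>)))"
        using compose_at(4)[OF s] by (simp add: mult_monom add.assoc)
    qed
    also have "\<dots> = monom 1 (card (once C \<sigma>)) * (degree_poly \<sigma> (fibre_or_unit F \<sigma>) *
        degree_poly (R - \<sigma>) (?S \<sigma>))"
      unfolding degree_poly_def sum_product sum.cartesian_product
      by (simp only: case_prod_unfold sum_distrib_left)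
    finally show "(\<Sum>a\<in>{a \<in> relaxed_coparking M B F. max_fired a = \<sigma>}. monom 1 (sum a R)) =
        monom 1 (card (once C \<sigma>)) * degree_poly \<sigma> (fibre_or_unit F \<sigma>) * degree_poly (R - \<sigma>) (?S \<sigma>)"
      by (simp only: mult.assoc)
  qed
  finally have "degree_poly R (relaxed_coparking M B F) * [:1, -1:] ^ card R =
      (\<Sum>\<sigma>\<in>Pow R. monom 1 (card (once C \<sigma>)) * degree_poly \<sigma> (fibre_or_unit F \<sigma>) *
      degree_poly (R - \<sigma>) (?S \<sigma>) * [:1, -1:] ^ card R)"
    by (simp only: sum_distrib_right)
  also have "\<dots> = (\<Sum>\<sigma>\<in>Pow R. subset_poly (cover \<sigma>) (inner_sets \<sigma>) * subset_poly (E - cover \<sigma>) (outer_sets \<sigma>))"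
  proof (rule sum.cong[OF refl])
    fix \<sigma> assume "\<sigma> \<in> Pow R"
    then have s: "\<sigma> \<subseteq> R" by simp
    have c: "card R = card \<sigma> + card (R - \<sigma>)"
      using s finite_R by (metis card_Diff_subset card_mono finite_subset le_add_diff_inverse)
    have "degree_poly (R - \<sigma>) (?S \<sigma>) * [:1, -1:] ^ card (R - \<sigma>) = subset_poly (E - cover \<sigma>) (outer_sets \<sigma>)"
      unfolding outer_sets_def
      by (rule stable_poly) (use finite_ground finite_R fund_circuit_ground in auto)
    then show "monom 1 (card (once C \<sigma>)) * degree_poly \<sigma> (fibre_or_unit F \<sigma>) *
      degree_poly (R - \<sigma>) (?S \<sigma>) * [:1, -1:] ^ card R =
      subset_poly (cover \<sigma>) (inner_sets \<sigma>) * subset_poly (E - cover \<sigma>) (outer_sets \<sigma>)"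
      unfolding fibre_poly[OF F s, symmetric] c power_add by (simp only: mult_ac)
  qed
  also have "\<dots> = h_poly M * [:1, -1:] ^ card R"
    by (simp only: h_poly_ground indep_poly_split)
  finally show ?thesis by simp
qed

end

section \<open>Purity\<close>

lemma exists_maximal_above:
  assumes "finite P" "a \<in> P"
  shows "\<exists>b\<in>P. a \<le> b \<and> maximal_in P b"
proof -
  have "\<exists>b\<in>P. a \<le> b \<and> (\<forall>c\<in>P. b \<le> c \<longrightarrow> b = c)"
    using finite_has_maximal2[OF assms] by blast
  then show ?thesis by (auto simp: maximal_in_def)
qed

text \<open>
  The last nonzero degree is attained at a maximal element, so by purity at all of them.
\<close>

lemma pure_multicomplex_below_top:
  assumes P: "pure_multicomplex S P" and top: "degree_seq S P r \<noteq> 0"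
    and above: "\<And>k. r < k \<Longrightarrow> degree_seq S P k = 0" and m: "m \<in> P"
  shows "\<exists>b\<in>P. m \<le> b \<and> sum b S = r"
proof -
  have fin: "finite P" using P by (simp add: pure_multicomplex_def multicomplex_def)
  obtain x where x: "x \<in> P" "sum x S = r"
    using top by (auto simp: degree_seq_def card_eq_0_iff)
  obtain y where y: "y \<in> P" "x \<le> y" "maximal_in P y" using exists_maximal_above[OF fin x(1)] by blast
  obtain b where b: "b \<in> P" "m \<le> b" "maximal_in P b" using exists_maximal_above[OF fin m] by blast
  have "r \<le> sum y S" unfolding x(2)[symmetric] using y(2) by (intro sum_mono) (auto simp: le_fun_def)
  moreover have "\<not> r < sum y S"
  proof
    assume "r < sum y S"
    then have "degree_seq S P (sum y S) = 0" by (rule above)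
    then have "{a \<in> P. sum a S = sum y S} = {}" using fin by (simp add: degree_seq_def)
    then show False using y(1) by blast
  qed
  moreover have "sum b S = sum y S" using P b(3) y(3) unfolding pure_multicomplex_def by blast
  ultimately show ?thesis using b by auto
qed

context based_binary_matroid
begin

abbreviation "minor_rank \<sigma> \<equiv> rank_of (stratum_minor M B \<sigma>) (ground (stratum_minor M B \<sigma>))"

text \<open>
  Decompose \<open>a\<close> at its largest fireable stratum \<open>\<sigma>\<close>, raise the member of the fibre to the
  top degree \<open>minor_rank \<sigma>\<close> and the outer vector as in \<open>stable_bump\<close>. The degrees add up to
  \<open>card (cover R) - card R\<close>, whatever \<open>\<sigma>\<close> is.
\<close>

lemma relaxed_coparking_bump:
  assumes F: "fibre_system M B F"
    and top: "\<And>\<sigma>. dead M B \<sigma> \<Longrightarrow> h_vector (stratum_minor M B \<sigma>) (minor_rank \<sigma>) \<noteq> 0"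
    and a: "a \<in> relaxed_coparking M B F"
  shows "\<exists>b\<in>relaxed_coparking M B F. a \<le> b \<and> sum b R + card R = card (cover R)"
proof -
  define \<sigma> where "\<sigma> = max_fired a"
  define m where "m = residue M B \<sigma> a"
  define c where "c = (\<lambda>i. if i \<in> \<sigma> then 0 else a i)"
  have s: "\<sigma> \<subseteq> R" unfolding \<sigma>_def by (rule max_fired_subset)
  have aR: "a \<in> monomials R" using a by (simp add: relaxed_coparking_def)
  have m: "m \<in> fibre_or_unit F \<sigma>"
    using relaxed_coparking_iff[OF F aR] a by (simp add: m_def \<sigma>_def)
  have c: "c \<in> stable (off \<sigma>) (R - \<sigma>)" "compose_at \<sigma> m c = a"
    unfolding c_def m_def by (rule decompose_at[OF aR], simp add: \<sigma>_def)+
  obtain m' where m': "m' \<in> fibre_or_unit F \<sigma>" "m \<le> m'"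
      "sum m' \<sigma> + card (once C \<sigma>) + card \<sigma> = card (cover \<sigma>)"
  proof (cases "\<sigma> = {}")
    case True
    then show ?thesis using m that[of m] by simp
  next
    case False
    then have d: "dead M B \<sigma>" "m \<in> F \<sigma>" using m by (auto simp: fibre_or_unit_def split: if_splits)
    then have f: "pure_multicomplex \<sigma> (F \<sigma>)" "degree_seq \<sigma> (F \<sigma>) = h_vector (stratum_minor M B \<sigma>)"
      using F by (auto simp: fibre_system_def fibre_at_def)
    obtain b where "b \<in> F \<sigma>" "m \<le> b" "sum b \<sigma> = minor_rank \<sigma>"
      using pure_multicomplex_below_top[OF f(1), of "minor_rank \<sigma>" m] top[OF d(1)] d(2)
      unfolding f(2) by (auto simp: h_vector_def)
    moreover have "minor_rank \<sigma> + card (once C \<sigma>) + card \<sigma> = card (cover \<sigma>)"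
      using d(1) by (intro stratum_minor_rank) (auto simp: dead_eq)
    ultimately show ?thesis using that[of b] d False by (simp add: fibre_or_unit_def)
  qed
  have "finite (R - \<sigma>)" "\<And>i. i \<in> R - \<sigma> \<Longrightarrow> finite (off \<sigma> i)"
    using finite_R finite_fund_circuit by auto
  then obtain c' where c': "c' \<in> stable (off \<sigma>) (R - \<sigma>)" "c \<le> c'"
      "sum c' (R - \<sigma>) + card (R - \<sigma>) = card (\<Union>i\<in>R - \<sigma>. off \<sigma> i)"
    using stable_bump[of "R - \<sigma>" "off \<sigma>" c] c(1) by blast
  define b where "b = compose_at \<sigma> m' c'"
  note comp = compose_at[OF s subsetD[OF fibre_or_unit_monomials(1)[OF F] m'(1)] c'(1), folded b_def]
  have "b \<in> relaxed_coparking M B F"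
    using relaxed_coparking_iff[OF F comp(1)] comp(2,3) m'(1) by simp
  moreover have "a \<le> b"
    unfolding c(2)[symmetric] b_def using m'(2) c'(2)
    by (auto simp: le_fun_def compose_at_def intro: add_mono)
  moreover have "sum b R + card R = card (cover R)"
  proof -
    have un: "cover R = cover \<sigma> \<union> (\<Union>i\<in>R - \<sigma>. off \<sigma> i)" using s by blast
    have fin: "finite (cover R)" using finite_cover[of R] by blast
    then have "finite (cover \<sigma>)" "finite (\<Union>i\<in>R - \<sigma>. off \<sigma> i)" unfolding un by blast+
    then have "card (cover R) = card (cover \<sigma>) + card (\<Union>i\<in>R - \<sigma>. off \<sigma> i)"
      unfolding un by (intro card_Un_disjoint) auto
    moreover have "card R = card \<sigma> + card (R - \<sigma>)"
      using s finite_R by (metis card_Diff_subset card_mono finite_subset le_add_diff_inverse)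
    ultimately show ?thesis using comp(4) m'(3) c'(3) by linarith
  qed
  ultimately show ?thesis by blast
qed

lemma relaxed_coparking_downward:
  assumes F: "fibre_system M B F" and a: "a \<in> relaxed_coparking M B F" and "b \<le> a"
  shows "b \<in> relaxed_coparking M B F"
proof -
  have le: "b i \<le> a i" for i using \<open>b \<le> a\<close> by (simp add: le_fun_def)
  have "dead M B \<tau> \<and> residue M B \<tau> b \<in> F \<tau>" if t: "stratum M B \<tau>" "can_fire M B \<tau> b" for \<tau>
  proof -
    have "can_fire M B \<tau> a" using t(2) le unfolding can_fire_def using le_trans by blast
    then have d: "dead M B \<tau>" "residue M B \<tau> a \<in> F \<tau>"
      using a t(1) by (auto simp: relaxed_coparking_def)
    have "residue M B \<tau> b \<le> residue M B \<tau> a" using le by (auto simp: le_fun_def residue_def diff_le_mono)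
    moreover have "multicomplex \<tau> (F \<tau>)"
      using F d(1) by (simp add: fibre_system_def fibre_at_def pure_multicomplex_def)
    ultimately show ?thesis using d by (auto simp: multicomplex_def)
  qed
  moreover have "b \<in> monomials R"
    using a le by (auto simp: relaxed_coparking_def monomials_def) (metis le_zero_eq)
  ultimately show ?thesis by (simp add: relaxed_coparking_def)
qed

theorem pure_relaxed_coparking:
  assumes F: "fibre_system M B F"
    and top: "\<And>\<sigma>. dead M B \<sigma> \<Longrightarrow> h_vector (stratum_minor M B \<sigma>) (minor_rank \<sigma>) \<noteq> 0"
  shows "pure_multicomplex R (relaxed_coparking M B F)"
    and "degree_seq R (relaxed_coparking M B F) = h_vector M"
proof -
  let ?P = "relaxed_coparking M B F"
  have "?P \<subseteq> {a \<in> monomials R. sum a R \<le> card (cover R)}"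
  proof
    fix a assume a: "a \<in> ?P"
    obtain b where "a \<le> b" "sum b R + card R = card (cover R)"
      using relaxed_coparking_bump[OF F top a] by blast
    moreover have "sum a R \<le> sum b R" using \<open>a \<le> b\<close> by (intro sum_mono) (simp add: le_fun_def)
    ultimately show "a \<in> {a \<in> monomials R. sum a R \<le> card (cover R)}"
      using a by (simp add: relaxed_coparking_def)
  qed
  then have fin: "finite ?P" using finite_bounded_monomials[OF finite_R] by (rule finite_subset)
  have "sum a R + card R = card (cover R)" if a: "maximal_in ?P a" for a
  proof -
    have aP: "a \<in> ?P" using a by (simp add: maximal_in_def)
    obtain b where b: "b \<in> ?P" "a \<le> b" "sum b R + card R = card (cover R)"
      using relaxed_coparking_bump[OF F top aP] by blast
    then have "b = a" using a by (simp add: maximal_in_def)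
    then show ?thesis using b(3) by simp
  qed
  then have "sum a R = sum b R" if "maximal_in ?P a" "maximal_in ?P b" for a b
    using that by (metis add_right_cancel)
  moreover have "?P \<subseteq> monomials R" by (auto simp: relaxed_coparking_def)
  ultimately show "pure_multicomplex R ?P"
    using fin relaxed_coparking_downward[OF F]
    unfolding pure_multicomplex_def multicomplex_def by blast
  show "degree_seq R ?P = h_vector M"
    using degree_poly_relaxed_coparking[OF F fin]
    by (simp add: fun_eq_iff coeff_h_poly[symmetric] coeff_degree_poly[OF fin, symmetric])
qed

section \<open>Existence of fibres\<close>

abbreviation "non_loops \<sigma> \<equiv> {e. indep (stratum_minor M B \<sigma>) {e}}"

text \<open>
  The set \<open>cover \<sigma>\<close> is a union of circuits, so the minor has no coloops. Concretely, for a
  non-loop \<open>e \<in> C i\<close> a basis of \<open>cover \<sigma>\<close> that contains \<open>C i - {e}\<close> avoids \<open>e\<close>, and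
  augmenting \<open>once C \<sigma>\<close> from this basis yields a second non-loop.
\<close>

lemma two_le_card_non_loops:
  assumes d: "dead M B \<sigma>" and r: "minor_rank \<sigma> = 1"
  shows "2 \<le> card (non_loops \<sigma>)"
proof -
  let ?U = "once C \<sigma>"
  have s: "\<sigma> \<subseteq> R" "indep M ?U" using d by (auto simp: dead_eq)
  note minor = stratum_minor[OF s]
  interpret K: independence_complex "stratum_minor M B \<sigma>" using stratum_minor_complex[OF s] .
  obtain I where I: "indep (stratum_minor M B \<sigma>) I" "card I = 1" using K.rank_of_attained r by metis
  then obtain e where e: "e \<in> non_loops \<sigma>" by (auto simp: card_1_singleton_iff)
  then have eA: "e \<in> cover \<sigma>" "e \<notin> ?U" unfolding minor by auto
  then obtain i where i: "i \<in> \<sigma>" "e \<in> C i" by blast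
  have iR: "i \<in> R" using i s by blast
  have "indep M (C i - {e})"
    unfolding indep_iff
  proof (intro conjI allI impI)
    show "C i - {e} \<subseteq> E" using fund_circuit_ground[OF iR] by blast
    fix D assume D: "D \<subseteq> C i - {e}" "ev D"
    show "D = {}"
    proof (rule ccontr)
      assume "D \<noteq> {}"
      have "i \<in> D" using indep_ev_empty[OF indep_B _ D(2)] \<open>D \<noteq> {}\<close> D(1) fund_circuit(3)[OF iR] by blast
      have "ev (sym_diff D (C i))"
        by (rule ev_sym_diff) (use D fund_circuit[OF iR] fund_circuit_ground[OF iR] in auto)
      moreover have "sym_diff D (C i) \<subseteq> B"
        using D(1) \<open>i \<in> D\<close> fund_circuit(2,3)[OF iR] by blast
      ultimately have "sym_diff D (C i) = {}" using indep_ev_empty[OF indep_B] by blast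
      then show False using D(1) i(2) by blast
    qed
  qed
  then obtain J where J: "C i - {e} \<subseteq> J" "J \<subseteq> cover \<sigma>" "indep M J" "card J + card \<sigma> = card (cover \<sigma>)"
    using extend_cover[OF s(1), of "C i - {e}"] i(1) by blast
  have "e \<notin> J"
  proof
    assume "e \<in> J"
    then have "C i \<subseteq> J" using J(1) by blast
    then show False using dependent_fund_circuit[OF iR] J(3) by blast
  qed
  have "card ?U < card J" using J(4) stratum_minor_rank[OF s] r by simp
  then obtain f where f: "f \<in> J - ?U" "indep M (insert f ?U)" using augment[OF s(2) J(3)] by blast
  then have "f \<in> non_loops \<sigma>" "f \<noteq> e" using J(2) \<open>e \<notin> J\<close> by (auto simp: minor)
  moreover have "finite (non_loops \<sigma>)"
    by (rule finite_subset[OF _ K.finite_ground]) (use K.indep_ground in auto)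
  ultimately have "card {e, f} \<le> card (non_loops \<sigma>)" using e by (intro card_mono) auto
  then show ?thesis using \<open>f \<noteq> e\<close> by simp
qed

lemma h_vector_top_nonzero:
  assumes d: "dead M B \<sigma>" and r: "minor_rank \<sigma> \<le> 1"
  shows "h_vector (stratum_minor M B \<sigma>) (minor_rank \<sigma>) \<noteq> 0"
proof -
  have s: "\<sigma> \<subseteq> R" "indep M (once C \<sigma>)" using d by (auto simp: dead_eq)
  interpret K: independence_complex "stratum_minor M B \<sigma>" using stratum_minor_complex[OF s] .
  show ?thesis
  proof (cases "minor_rank \<sigma> = 0")
    case True
    then show ?thesis using K.h_vector_0 by simp
  next
    case False
    then have "minor_rank \<sigma> = 1" using r by simp
    then show ?thesis using K.h_vector_rank_1 two_le_card_non_loops[OF d] by simp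
  qed
qed

lemma zero_in_fibre:
  assumes "fibre_at M B F \<tau> X"
  shows "(\<lambda>_. 0) \<in> X"
proof -
  have d: "dead M B \<tau>" using assms by (simp add: fibre_at_def)
  then have s: "\<tau> \<subseteq> R" "indep M (once C \<tau>)" by (auto simp: dead_eq)
  interpret K: independence_complex "stratum_minor M B \<tau>" using stratum_minor_complex[OF s] .
  have "degree_seq \<tau> X 0 = 1" using assms K.h_vector_0 by (simp add: fibre_at_def)
  then obtain a where "a \<in> X" by (force simp: degree_seq_def card_1_singleton_iff)
  moreover have "multicomplex \<tau> X" using assms by (simp add: fibre_at_def pure_multicomplex_def)
  moreover have "(\<lambda>_. 0) \<le> a" by (simp add: le_fun_def)
  ultimately show ?thesis unfolding multicomplex_def by blast
qed

definition unit_at :: "'e \<Rightarrow> 'e \<Rightarrow> nat" where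
  "unit_at i = (\<lambda>j. if j = i then 1 else 0)"

text \<open>
  The indices whose unit vector cannot belong to a fibre at \<open>\<sigma>\<close>, because it makes a live
  stratum inside \<open>\<sigma>\<close> fireable.
\<close>

definition blocked :: "'e set \<Rightarrow> 'e set" where
  "blocked \<sigma> = {i \<in> \<sigma>. \<exists>\<tau>\<subset>\<sigma>. i \<in> \<tau> \<and> \<not> indep M (once C \<tau>) \<and>
      fires C \<tau> (\<lambda>j. baseline M B \<sigma> j + unit_at i j)}"

lemma inter_once_eq:
  assumes "\<sigma> \<subseteq> R" "\<tau> \<subseteq> \<sigma>" "i \<in> \<tau>" "card (C i \<inter> once C \<tau>) \<le> baseline M B \<sigma> i"
  shows "C i \<inter> once C \<tau> = C i \<inter> once C \<sigma>"
proof -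
  have "finite (C i)" using assms finite_fund_circuit by blast
  moreover have "card (C i \<inter> once C \<tau>) \<le> card (C i \<inter> once C \<sigma>)"
    using assms baseline_eq[OF assms(1), of i] by auto
  ultimately show ?thesis using once_antimono[OF assms(2,3), of C] card_seteq[of "C i \<inter> once C \<tau>"] by blast
qed

lemma once_subset_if:
  assumes "\<And>i. i \<in> \<tau> \<Longrightarrow> C i \<inter> once C \<tau> \<subseteq> X"
  shows "once C \<tau> \<subseteq> X"
  using assms once_subset[of C \<tau>] by blast

text \<open>
  Let \<open>\<tau>\<close> be a live stratum that blocks \<open>i\<close>. Firing leaves room for one element \<open>e\<close> of
  \<open>once C \<tau>\<close> outside \<open>once C \<sigma>\<close>, and \<open>e \<in> C i\<close>. Since \<open>once C \<tau>\<close> is dependent but \<open>once C \<sigma>\<close>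
  is not, \<open>e\<close> lies on a circuit \<open>D \<subseteq> once C \<tau>\<close> and is a loop of the minor. The circuit \<open>D\<close>
  is determined by \<open>e\<close>, as it lies in \<open>insert e (once C \<sigma>)\<close>. Some \<open>j \<in> D \<inter> R\<close> has \<open>e \<in> C j\<close>;
  it belongs to \<open>\<tau>\<close>, so it equals \<open>i\<close> because \<open>\<tau>\<close> covers \<open>e\<close> only once. Thus \<open>e\<close> determines
  \<open>i\<close>, and the blocked indices are at most as many as the loops. The minor has \<open>card \<sigma> + 1\<close>
  elements in all.
\<close>

lemma card_blocked:
  assumes d: "dead M B \<sigma>" and r: "minor_rank \<sigma> = 1"
  shows "card (blocked \<sigma>) + card (non_loops \<sigma>) \<le> card \<sigma> + 1"
proof -
  let ?U = "once C \<sigma>" and ?A = "cover \<sigma>"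
  have s: "\<sigma> \<subseteq> R" "indep M ?U" using d by (auto simp: dead_eq)
  note minor = stratum_minor[OF s]
  interpret K: independence_complex "stratum_minor M B \<sigma>" using stratum_minor_complex[OF s] .
  have finA: "finite ?A" using finite_cover[OF s(1)] .
  have wit: "\<exists>e \<tau> D. \<tau> \<subseteq> \<sigma> \<and> i \<in> \<tau> \<and> e \<in> C i \<and> e \<in> ?A - ?U \<and> D \<subseteq> once C \<tau> \<and>
      once C \<tau> \<subseteq> insert e ?U \<and> ev D \<and> e \<in> D" if i: "i \<in> blocked \<sigma>" for i
  proof -
    obtain \<tau> where t: "\<tau> \<subseteq> \<sigma>" "i \<in> \<tau>" "\<not> indep M (once C \<tau>)"
        "fires C \<tau> (\<lambda>j. baseline M B \<sigma> j + unit_at i j)"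
      using i unfolding blocked_def by blast
    have tR: "\<tau> \<subseteq> R" using t(1) s(1) by blast
    have other: "C j \<inter> once C \<tau> \<subseteq> ?U" if "j \<in> \<tau>" "j \<noteq> i" for j
    proof -
      have "card (C j \<inter> once C \<tau>) \<le> baseline M B \<sigma> j"
        using t(4) that by (auto simp: fires_def unit_at_def)
      then show ?thesis using inter_once_eq[OF s(1) t(1) that(1)] by blast
    qed
    have iR: "i \<in> R" using t(2) tR by blast
    have fin: "finite (C i)" using finite_fund_circuit[OF iR] .
    have sub: "C i \<inter> ?U \<subseteq> C i \<inter> once C \<tau>" by (rule once_antimono[OF t(1,2)])
    have "card (C i \<inter> once C \<tau>) \<le> card (C i \<inter> ?U) + 1"
    proof -
      have "card (C i \<inter> once C \<tau>) \<le> baseline M B \<sigma> i + unit_at i i"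
        using t(2,4) by (simp only: fires_def)
      then show ?thesis using t(1,2) by (auto simp: baseline_eq[OF s(1)] unit_at_def)
    qed
    then have "card ((C i \<inter> once C \<tau>) - (C i \<inter> ?U)) \<le> 1"
      using sub fin by (subst card_Diff_subset) (auto intro: finite_subset)
    moreover have "finite ((C i \<inter> once C \<tau>) - (C i \<inter> ?U))" using fin by blast
    moreover have "(C i \<inter> once C \<tau>) - (C i \<inter> ?U) \<noteq> {}"
    proof
      assume "(C i \<inter> once C \<tau>) - (C i \<inter> ?U) = {}"
      then have "C i \<inter> once C \<tau> \<subseteq> ?U" by blast
      then have "C j \<inter> once C \<tau> \<subseteq> ?U" if "j \<in> \<tau>" for j using other that by (cases "j = i") auto
      then have "once C \<tau> \<subseteq> ?U" by (rule once_subset_if)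
      then show False using t(3) indep_subset[OF s(2)] by blast
    qed
    ultimately obtain e where e: "(C i \<inter> once C \<tau>) - (C i \<inter> ?U) = {e}"
      by (metis card_1_singletonE card_eq_0_iff le_0_eq le_SucE One_nat_def)
    then have e': "e \<in> C i" "e \<notin> ?U" "C i \<inter> once C \<tau> \<subseteq> insert e ?U" by blast+
    have U: "once C \<tau> \<subseteq> insert e ?U"
    proof (rule once_subset_if)
      fix j assume "j \<in> \<tau>" then show "C j \<inter> once C \<tau> \<subseteq> insert e ?U"
        using other e'(3) by (cases "j = i") auto
    qed
    have "once C \<tau> \<subseteq> E" using once_subset[of C \<tau>] cover_ground[OF tR] by blast
    then obtain D where D: "D \<subseteq> once C \<tau>" "ev D" "D \<noteq> {}" using t(3) unfolding indep_iff by blast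
    have "e \<in> D" using indep_ev_empty[OF s(2) _ D(2)] D U by blast
    moreover have "e \<in> ?A" using e'(1) t(1,2) by blast
    ultimately show ?thesis using t(1,2) e' U D by blast
  qed
  then obtain g where g: "\<And>i. i \<in> blocked \<sigma> \<Longrightarrow> \<exists>\<tau> D. \<tau> \<subseteq> \<sigma> \<and> i \<in> \<tau> \<and> g i \<in> C i \<and> g i \<in> ?A - ?U \<and>
      D \<subseteq> once C \<tau> \<and> once C \<tau> \<subseteq> insert (g i) ?U \<and> ev D \<and> g i \<in> D" by metis
  have inj: "inj_on g (blocked \<sigma>)"
  proof (rule inj_onI)
    fix i i' assume i: "i \<in> blocked \<sigma>" "i' \<in> blocked \<sigma>" "g i = g i'"
    obtain \<tau> D where t: "\<tau> \<subseteq> \<sigma>" "i \<in> \<tau>" "g i \<in> C i" "g i \<in> ?A - ?U"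
      "D \<subseteq> once C \<tau>" "once C \<tau> \<subseteq> insert (g i) ?U" "ev D" "g i \<in> D" using g[OF i(1)] by blast
    obtain \<tau>' D' where t': "\<tau>' \<subseteq> \<sigma>" "i' \<in> \<tau>'" "g i \<in> C i'"
      "D' \<subseteq> once C \<tau>'" "once C \<tau>' \<subseteq> insert (g i) ?U" "ev D'" "g i \<in> D'" using g[OF i(2)] i(3) by auto
    have UE: "?U \<subseteq> E" "g i \<in> E" using once_subset[of C \<sigma>] cover_ground[OF s(1)] t(4) by blast+
    have DE: "D \<subseteq> E" "D' \<subseteq> E" using t t' UE by blast+
    have "ev (sym_diff D D')" using ev_sym_diff t(7) t'(6) DE by blast
    moreover have "sym_diff D D' \<subseteq> ?U" using t t' by blast
    ultimately have "sym_diff D D' = {}" using indep_ev_empty[OF s(2)] by blast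
    then have eq: "D' = D" by blast
    have "D \<noteq> {}" using t(8) by blast
    then obtain j where j: "j \<in> D" "j \<in> R" "g i \<in> C j" using ev_between(3)[OF t(7) DE(1)] t(8) by blast
    \<comment> \<open>applied below to \<open>(\<tau>, i)\<close> and to \<open>(\<tau>', i')\<close>, which share the element \<open>g i\<close> and the
       circuit \<open>D\<close>\<close>
    have "j = k" if k: "\<rho> \<subseteq> \<sigma>" "k \<in> \<rho>" "g i \<in> C k" "D \<subseteq> once C \<rho>" for \<rho> k
    proof -
      have "j \<in> once C \<rho> \<inter> R" using j k(4) by blast
      then have "j \<in> \<rho>" using once_inter_R[of \<rho>] k(1) s(1) by blast
      moreover have "g i \<in> once C \<rho>" using t(8) k(4) by blast
      ultimately show ?thesis using j(3) k(2,3) unfolding once_def by blast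
    qed
    from this[OF t(1,2,3,5)] this[OF t'(1,2,3) t'(4)[unfolded eq]] show "i = i'" by simp
  qed
  have "g ` blocked \<sigma> \<inter> non_loops \<sigma> = {}"
  proof -
    have "\<not> indep M (insert (g i) ?U)" if "i \<in> blocked \<sigma>" for i
      using g[OF that] indep_ev_empty[of "insert (g i) ?U"] by blast
    then show ?thesis by (auto simp: minor)
  qed
  moreover have sub: "g ` blocked \<sigma> \<subseteq> ?A - ?U" "non_loops \<sigma> \<subseteq> ?A - ?U"
    using g by (blast, auto simp: minor)
  moreover have fin: "finite (g ` blocked \<sigma>)" "finite (non_loops \<sigma>)"
    using sub finA by (auto intro: finite_subset)
  ultimately have "card (g ` blocked \<sigma>) + card (non_loops \<sigma>) \<le> card (?A - ?U)"
    using finA by (subst card_Un_disjoint[symmetric]) (auto intro!: card_mono)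
  moreover have "card (?A - ?U) + card ?U = card ?A"
    using once_subset[of C \<sigma>] finA by (metis card_Diff_subset card_mono finite_subset le_add_diff_inverse2)
  moreover have "1 + card ?U + card \<sigma> = card ?A" using stratum_minor_rank[OF s] r by simp
  ultimately show ?thesis unfolding card_image[OF inj] by linarith
qed

lemma residue_zero_below:
  assumes below: "fibres_below M B F \<sigma>"
    and t: "stratum M B \<tau>" "\<tau> \<subset> \<sigma>" "indep M (once C \<tau>)"
    and res: "\<And>i. i \<in> \<tau> \<Longrightarrow> a i = baseline M B \<tau> i"
  shows "dead M B \<tau> \<and> residue M B \<tau> a \<in> F \<tau>"
proof -
  have "dead M B \<tau>" using t by (simp add: dead_eq stratum_def)
  moreover from this have "(\<lambda>_. 0) \<in> F \<tau>" using below t(2) zero_in_fibre unfolding fibres_below_def by blast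
  moreover have "residue M B \<tau> a = (\<lambda>_. 0)" using res by (auto simp: residue_def)
  ultimately show ?thesis by simp
qed

text \<open>
  Firing \<open>\<tau>\<close> from the baseline of \<open>\<sigma>\<close> is possible only if the two baselines agree on \<open>\<tau>\<close>.
  Then \<open>once C \<tau> \<subseteq> once C \<sigma>\<close> is independent and the residue is zero.
\<close>

lemma baseline_condition:
  assumes below: "fibres_below M B F \<sigma>" and d: "dead M B \<sigma>"
    and t: "stratum M B \<tau>" "\<tau> \<subset> \<sigma>" "can_fire M B \<tau> a"
    and a: "\<And>i. i \<in> \<tau> \<Longrightarrow> a i = baseline M B \<sigma> i"
  shows "dead M B \<tau> \<and> residue M B \<tau> a \<in> F \<tau>" "once C \<tau> \<subseteq> once C \<sigma>"
proof -
  have s: "\<sigma> \<subseteq> R" "indep M (once C \<sigma>)" and tR: "\<tau> \<subseteq> R" "\<tau> \<subseteq> \<sigma>"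
    using d t(1,2) by (auto simp: dead_eq stratum_def)
  have eq: "C i \<inter> once C \<tau> = C i \<inter> once C \<sigma>" if "i \<in> \<tau>" for i
  proof (rule inter_once_eq[OF s(1) tR(2) that])
    have "card (C i \<inter> once C \<tau>) \<le> a i"
      using t(3) that unfolding can_fire_eq[OF tR(1)] fires_def by blast
    then show "card (C i \<inter> once C \<tau>) \<le> baseline M B \<sigma> i" by (simp only: a[OF that])
  qed
  then show U: "once C \<tau> \<subseteq> once C \<sigma>" by (intro once_subset_if) auto
  have "a i = baseline M B \<tau> i" if "i \<in> \<tau>" for i
    using a[OF that] that tR eq[OF that] baseline_eq[OF s(1), of i] baseline_eq[OF tR(1), of i] by auto
  then show "dead M B \<tau> \<and> residue M B \<tau> a \<in> F \<tau>"
    by (intro residue_zero_below[OF below t(1,2) indep_subset[OF s(2) U]])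
qed

text \<open>
  If \<open>i \<in> \<tau>\<close>, the added unit must be used up: otherwise the baselines would agree on \<open>\<tau>\<close>,
  which is excluded by \<open>sep\<close>. So the residue is zero, and \<open>\<tau>\<close> is dead because \<open>i\<close> is not
  blocked.
\<close>

lemma unit_condition:
  assumes below: "fibres_below M B F \<sigma>" and d: "dead M B \<sigma>"
    and sep: "\<And>\<tau>. \<tau> \<subset> \<sigma> \<Longrightarrow> \<tau> \<noteq> {} \<Longrightarrow> \<not> once C \<tau> \<subseteq> once C \<sigma>"
    and i: "i \<in> \<sigma> - blocked \<sigma>"
    and t: "stratum M B \<tau>" "\<tau> \<subset> \<sigma>" "can_fire M B \<tau> (\<lambda>j. baseline M B \<sigma> j + unit_at i j)"
  shows "dead M B \<tau> \<and> residue M B \<tau> (\<lambda>j. baseline M B \<sigma> j + unit_at i j) \<in> F \<tau>"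
proof -
  let ?a = "\<lambda>j. baseline M B \<sigma> j + unit_at i j"
  have s: "\<sigma> \<subseteq> R" "indep M (once C \<sigma>)" and tR: "\<tau> \<subseteq> R" "\<tau> \<subseteq> \<sigma>" "\<tau> \<noteq> {}"
    using d t(1,2) by (auto simp: dead_eq stratum_def)
  have ft: "fires C \<tau> ?a" using t(3) can_fire_eq[OF tR(1)] by blast
  show ?thesis
  proof (cases "i \<in> \<tau>")
    case False
    then have "?a j = baseline M B \<sigma> j" if "j \<in> \<tau>" for j using that by (auto simp: unit_at_def)
    then show ?thesis by (rule baseline_condition(1)[OF below d t])
  next
    case True
    have ind: "indep M (once C \<tau>)" using i True t(2) ft unfolding blocked_def by blast
    have eq: "C j \<inter> once C \<tau> = C j \<inter> once C \<sigma>" if "j \<in> \<tau>" "j \<noteq> i" for j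
    proof (rule inter_once_eq[OF s(1) tR(2) that(1)])
      have "card (C j \<inter> once C \<tau>) \<le> baseline M B \<sigma> j + unit_at i j"
        using ft that(1) by (simp only: fires_def)
      then show "card (C j \<inter> once C \<tau>) \<le> baseline M B \<sigma> j" using that(2) by (simp add: unit_at_def)
    qed
    have ne: "C i \<inter> once C \<tau> \<noteq> C i \<inter> once C \<sigma>"
    proof
      assume "C i \<inter> once C \<tau> = C i \<inter> once C \<sigma>"
      then have "C j \<inter> once C \<tau> \<subseteq> once C \<sigma>" if "j \<in> \<tau>" for j using eq that by (cases "j = i") auto
      then have "once C \<tau> \<subseteq> once C \<sigma>" by (rule once_subset_if)
      then show False using sep t(2) tR(3) by blast
    qed
    have "card (C i \<inter> once C \<tau>) = baseline M B \<sigma> i + 1"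
    proof (rule antisym)
      show "card (C i \<inter> once C \<tau>) \<le> baseline M B \<sigma> i + 1"
        using ft True by (auto simp: fires_def unit_at_def)
      show "baseline M B \<sigma> i + 1 \<le> card (C i \<inter> once C \<tau>)"
      proof (rule ccontr)
        assume "\<not> ?thesis"
        then have "card (C i \<inter> once C \<tau>) \<le> baseline M B \<sigma> i" by simp
        then show False using inter_once_eq[OF s(1) tR(2) True] ne by blast
      qed
    qed
    then have "?a j = baseline M B \<tau> j" if "j \<in> \<tau>" for j
      using that eq tR True baseline_eq[OF s(1), of j] baseline_eq[OF tR(1), of j]
      by (cases "j = i") (auto simp: unit_at_def)
    then show ?thesis by (rule residue_zero_below[OF below t(1,2) ind])
  qed
qed

lemma unit_family_pure:
  assumes "finite \<sigma>" "I \<subseteq> \<sigma>" "I \<noteq> {}"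
  shows "pure_multicomplex \<sigma> (insert (\<lambda>_. 0) (unit_at ` I))"
    "degree_seq \<sigma> (insert (\<lambda>_. 0) (unit_at ` I)) = (\<lambda>k. if k = 0 then 1 else if k = 1 then int (card I) else 0)"
proof -
  let ?X = "insert (\<lambda>_. 0) (unit_at ` I)"
  have fin: "finite I" using assms finite_subset by blast
  have deg: "sum (unit_at i) \<sigma> = 1" if "i \<in> I" for i
    using assms that by (auto simp: unit_at_def)
  have le: "b = (\<lambda>_. 0) \<or> b = unit_at i" if b: "b \<le> unit_at i" for b i
  proof -
    have *: "b j \<le> unit_at i j" for j using b by (simp add: le_fun_def)
    have "b j = 0" if "j \<noteq> i" for j using *[of j] that by (simp add: unit_at_def)
    moreover have "b i = 0 \<or> b i = 1" using *[of i] by (auto simp: unit_at_def)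
    ultimately have "(\<forall>j. b j = 0) \<or> (\<forall>j. b j = unit_at i j)" by (metis unit_at_def)
    then show ?thesis by (auto simp: fun_eq_iff)
  qed
  have down: "b \<in> ?X" if a: "a \<in> ?X" and ba: "b \<le> a" for a b
  proof -
    consider "a = (\<lambda>_. 0)" | i where "i \<in> I" "a = unit_at i" using a by blast
    then show ?thesis
    proof cases
      case 1
      then have "b = (\<lambda>_. 0)" using ba by (simp add: le_fun_def fun_eq_iff)
      then show ?thesis by simp
    next
      case 2
      then show ?thesis using le[of b i] ba by blast
    qed
  qed
  have "?X \<subseteq> monomials \<sigma>" using assms by (auto simp: monomials_def unit_at_def split: if_splits)
  then have mc: "multicomplex \<sigma> ?X" using fin down unfolding multicomplex_def by blast
  have one: "sum a \<sigma> = 1" if a: "maximal_in ?X a" for a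
  proof -
    obtain i where i: "i \<in> I" using assms by blast
    have "a \<noteq> (\<lambda>_. 0)"
    proof
      assume "a = (\<lambda>_. 0)"
      then have "unit_at i = (\<lambda>_. 0)" using a i by (auto simp: maximal_in_def le_fun_def)
      then show False by (metis unit_at_def zero_neq_one)
    qed
    then show ?thesis using a deg by (auto simp: maximal_in_def)
  qed
  show "pure_multicomplex \<sigma> ?X" unfolding pure_multicomplex_def using mc one by simp
  have inj: "inj_on unit_at I" by (rule inj_onI) (metis unit_at_def zero_neq_one)
  have "{a \<in> ?X. sum a \<sigma> = k} = (if k = 0 then {\<lambda>_. 0} else if k = 1 then unit_at ` I else {})" for k
    using deg by auto
  then show "degree_seq \<sigma> ?X = (\<lambda>k. if k = 0 then 1 else if k = 1 then int (card I) else 0)"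
    using card_image[OF inj] by (auto simp: degree_seq_def fun_eq_iff)
qed

text \<open>
  In rank one the \<open>h\<close>-vector of the minor is \<open>(1, p - 1)\<close> with \<open>p = card (non_loops \<sigma>)\<close>, and
  \<open>card_blocked\<close> leaves \<open>p - 1\<close> unit vectors to choose.
\<close>

lemma fibre_exists:
  assumes below: "fibres_below M B F \<sigma>" and d: "dead M B \<sigma>" and r: "minor_rank \<sigma> \<le> 1"
    and sep: "\<And>\<tau>. minor_rank \<sigma> = 1 \<Longrightarrow> \<tau> \<subset> \<sigma> \<Longrightarrow> \<tau> \<noteq> {} \<Longrightarrow> \<not> once C \<tau> \<subseteq> once C \<sigma>"
  shows "\<exists>X. fibre_at M B F \<sigma> X"
proof -
  have s: "\<sigma> \<subseteq> R" "indep M (once C \<sigma>)" using d by (auto simp: dead_eq)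
  have fin: "finite \<sigma>" using s(1) finite_R finite_subset by blast
  interpret K: independence_complex "stratum_minor M B \<sigma>" using stratum_minor_complex[OF s] .
  have zero: "dead M B \<tau> \<and> residue M B \<tau> (\<lambda>i. baseline M B \<sigma> i + 0) \<in> F \<tau>"
    if "stratum M B \<tau>" "\<tau> \<subset> \<sigma>" "can_fire M B \<tau> (\<lambda>i. baseline M B \<sigma> i + 0)" for \<tau>
    by (rule baseline_condition(1)[OF below d that]) simp
  show ?thesis
  proof (cases "minor_rank \<sigma> = 0")
    case True
    have "pure_multicomplex \<sigma> {\<lambda>_. 0}"
    proof -
      have "b = (\<lambda>_. 0)" if "b \<le> (\<lambda>_. 0)" for b :: "'e \<Rightarrow> nat"
        using that by (simp add: le_fun_def fun_eq_iff)
      then show ?thesis by (simp add: pure_multicomplex_def multicomplex_def monomials_def maximal_in_def)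
    qed
    moreover have "degree_seq \<sigma> {\<lambda>_. 0} = h_vector (stratum_minor M B \<sigma>)"
      unfolding K.h_vector_rank_0[OF True]
    proof
      fix k :: nat
      have "{a \<in> {\<lambda>_. 0}. sum a \<sigma> = k} = (if k = 0 then {\<lambda>_. 0} else {})" by auto
      then show "degree_seq \<sigma> {\<lambda>_. 0} k = (if k = 0 then 1 else 0)" by (simp add: degree_seq_def)
    qed
    ultimately have "fibre_at M B F \<sigma> {\<lambda>_. 0}" unfolding fibre_at_def using d zero by blast
    then show ?thesis by blast
  next
    case False
    then have r1: "minor_rank \<sigma> = 1" using r by simp
    have two: "2 \<le> card (non_loops \<sigma>)" by (rule two_le_card_non_loops[OF d r1])
    have "blocked \<sigma> \<subseteq> \<sigma>" by (auto simp: blocked_def)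
    then have "card (\<sigma> - blocked \<sigma>) = card \<sigma> - card (blocked \<sigma>)"
      using fin by (intro card_Diff_subset) (auto intro: finite_subset)
    then have "card (non_loops \<sigma>) - 1 \<le> card (\<sigma> - blocked \<sigma>)" using card_blocked[OF d r1] by linarith
    then obtain I where I: "I \<subseteq> \<sigma> - blocked \<sigma>" "card I = card (non_loops \<sigma>) - 1"
      using obtain_subset_with_card_n by metis
    have "I \<noteq> {}" using I(2) two by auto
    moreover have I\<sigma>: "I \<subseteq> \<sigma>" using I(1) by blast
    ultimately have "pure_multicomplex \<sigma> (insert (\<lambda>_. 0) (unit_at ` I))"
      "degree_seq \<sigma> (insert (\<lambda>_. 0) (unit_at ` I)) = h_vector (stratum_minor M B \<sigma>)"
      using unit_family_pure[OF fin, of I] I(2) two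
      by (auto simp: K.h_vector_rank_1[OF r1] fun_eq_iff of_nat_diff)
    moreover have "dead M B \<tau> \<and> residue M B \<tau> (\<lambda>i. baseline M B \<sigma> i + m i) \<in> F \<tau>"
      if m: "m \<in> insert (\<lambda>_. 0) (unit_at ` I)" and t: "stratum M B \<tau>" "\<tau> \<subset> \<sigma>"
        "can_fire M B \<tau> (\<lambda>i. baseline M B \<sigma> i + m i)" for m \<tau>
    proof (cases "m = (\<lambda>_. 0)")
      case True
      then show ?thesis using zero t by simp
    next
      case False
      then obtain i where i: "i \<in> \<sigma> - blocked \<sigma>" "m = unit_at i" using m I(1) by blast
      show ?thesis unfolding i(2)
        by (rule unit_condition[OF below d sep[OF r1] i(1) t(1,2) t(3)[unfolded i(2)]])
    qed
    ultimately have "fibre_at M B F \<sigma> (insert (\<lambda>_. 0) (unit_at ` I))"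
      unfolding fibre_at_def using d by blast
    then show ?thesis by blast
  qed
qed

end

section \<open>Building a fibre system\<close>

lemma fibre_at_cong:
  assumes "\<And>\<tau>. \<tau> \<subset> \<sigma> \<Longrightarrow> F \<tau> = G \<tau>"
  shows "fibre_at M B F \<sigma> X \<longleftrightarrow> fibre_at M B G \<sigma> X"
proof -
  have "(\<tau> \<subset> \<sigma> \<longrightarrow> r \<in> F \<tau>) = (\<tau> \<subset> \<sigma> \<longrightarrow> r \<in> G \<tau>)" for \<tau> r using assms by simp
  then show ?thesis unfolding fibre_at_def by blast
qed

text \<open>
  The conditions at \<open>\<sigma>\<close> only involve fibres at proper subsets, so fibres can be chosen in
  the order of cardinality.
\<close>

lemma exists_fibre_system:
  assumes fin: "finite (cobasis M B)"
    and step: "\<And>F \<sigma>. fibres_below M B F \<sigma> \<Longrightarrow> \<not> obstructed M B F \<sigma>"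
  shows "\<exists>F. fibre_system M B F"
proof -
  have finite: "finite \<sigma>" if "dead M B \<sigma>" for \<sigma>
    using that fin finite_subset by (auto simp: dead_def stratum_def)
  have "\<exists>F. \<forall>\<sigma>. dead M B \<sigma> \<and> card \<sigma> < n \<longrightarrow> fibre_at M B F \<sigma> (F \<sigma>)" for n
  proof (induction n)
    case 0
    then show ?case by simp
  next
    case (Suc n)
    then obtain F where F: "\<And>\<sigma>. dead M B \<sigma> \<Longrightarrow> card \<sigma> < n \<Longrightarrow> fibre_at M B F \<sigma> (F \<sigma>)" by blast
    \<comment> \<open>keep the fibres at smaller strata, so that the fibres chosen at size \<open>n\<close> remain
       compatible\<close>
    define G where "G \<sigma> = (if card \<sigma> < n then F \<sigma> else (SOME X. fibre_at M B F \<sigma> X))" for \<sigma>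
    have "fibre_at M B G \<sigma> (G \<sigma>)" if s: "dead M B \<sigma>" "card \<sigma> < Suc n" for \<sigma>
    proof -
      have less: "card \<tau> < n" if "\<tau> \<subset> \<sigma>" for \<tau>
        using psubset_card_mono[OF finite[OF s(1)] that] s(2) by simp
      have "fibre_at M B G \<sigma> X \<longleftrightarrow> fibre_at M B F \<sigma> X" for X
        using less by (intro fibre_at_cong) (simp add: G_def)
      moreover have "fibre_at M B F \<sigma> (G \<sigma>)"
      proof (cases "card \<sigma> < n")
        case True
        then show ?thesis using F s(1) by (simp add: G_def)
      next
        case False
        have "fibres_below M B F \<sigma>" unfolding fibres_below_def using F less by blast
        then have "\<exists>X. fibre_at M B F \<sigma> X" using step s(1) by (auto simp: obstructed_def)
        then show ?thesis using False by (simp add: G_def someI_ex)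
      qed
      ultimately show ?thesis by blast
    qed
    then show ?case by blast
  qed
  then obtain F where F: "\<forall>\<sigma>. dead M B \<sigma> \<and> card \<sigma> < Suc (card (cobasis M B)) \<longrightarrow> fibre_at M B F \<sigma> (F \<sigma>)"
    by blast
  have "card \<sigma> < Suc (card (cobasis M B))" if "dead M B \<sigma>" for \<sigma>
    using that fin by (auto simp: dead_def stratum_def less_Suc_eq_le intro: card_mono)
  then have "fibre_system M B F" using F by (simp add: fibre_system_def)
  then show ?thesis by blast
qed

section \<open>Boundaries of edge sets and the cycle space\<close>

lemma odd_card_sym_diff:
  assumes "finite A" "finite B"
  shows "odd (card (sym_diff A B)) \<longleftrightarrow> odd (card A) \<noteq> odd (card B)"
proof -
  have "card (sym_diff A B) = card (A - B) + card (B - A)"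
    using assms by (intro card_Un_disjoint) auto
  moreover have "card A = card (A - B) + card (A \<inter> B)" "card B = card (B - A) + card (A \<inter> B)"
    using assms by (metis card_Diff_subset_Int card_mono finite_Int inf_le1 le_add_diff_inverse2,
        metis card_Diff_subset_Int card_mono finite_Int inf_commute inf_le1 le_add_diff_inverse2)
  ultimately show ?thesis by auto
qed

locale finite_multigraph =
  fixes G :: "('v, 'e) multigraph"
  assumes finite_edges: "finite (edges G)"
    and card_ends: "e \<in> edges G \<Longrightarrow> card (ends G e) = 2"
begin

definition edges_at :: "'e set \<Rightarrow> 'v \<Rightarrow> 'e set" where
  "edges_at X v = {e \<in> X. v \<in> ends G e}"

text \<open>
  The boundary modulo two; its kernel is the cycle space of the graph.
\<close>

definition boundary :: "'e set \<Rightarrow> 'v set" where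
  "boundary X = {v. odd (card (edges_at X v))}"

lemma boundary_empty [simp]: "boundary {} = {}"
  by (simp add: boundary_def edges_at_def)

lemma finite_sub: "X \<subseteq> edges G \<Longrightarrow> finite X"
  using finite_edges finite_subset by blast

lemma finite_ends: "e \<in> edges G \<Longrightarrow> finite (ends G e)"
  using card_ends card.infinite by fastforce

lemma other_end:
  assumes "e \<in> edges G" "v \<in> ends G e"
  shows "\<exists>u. ends G e = {u, v} \<and> u \<noteq> v"
proof -
  obtain a b where "ends G e = {a, b}" "a \<noteq> b" using card_ends[OF assms(1)] by (auto simp: card_2_iff)
  then show ?thesis using assms(2) by (metis insert_commute insert_iff singletonD)
qed

lemma boundary_sym_diff:
  assumes "X \<subseteq> edges G" "Y \<subseteq> edges G"
  shows "boundary (sym_diff X Y) = sym_diff (boundary X) (boundary Y)"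
proof -
  have "edges_at (sym_diff X Y) v = sym_diff (edges_at X v) (edges_at Y v)" for v
    by (auto simp: edges_at_def)
  moreover have "finite (edges_at X v)" "finite (edges_at Y v)" for v
    using finite_sub assms by (auto simp: edges_at_def)
  ultimately have "v \<in> boundary (sym_diff X Y) \<longleftrightarrow> v \<in> sym_diff (boundary X) (boundary Y)" for v
    unfolding boundary_def mem_Collect_eq by (simp add: odd_card_sym_diff) blast
  then show ?thesis by blast
qed

lemma boundary_single: "boundary {e} = ends G e"
proof -
  have "edges_at {e} v = (if v \<in> ends G e then {e} else {})" for v by (auto simp: edges_at_def)
  then show ?thesis by (auto simp: boundary_def)
qed

lemma boundary_subset: "boundary X \<subseteq> (\<Union>e\<in>X. ends G e)"
proof
  fix v assume "v \<in> boundary X"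
  then have "edges_at X v \<noteq> {}" by (metis boundary_def card.empty even_zero mem_Collect_eq)
  then show "v \<in> (\<Union>e\<in>X. ends G e)" by (auto simp: edges_at_def)
qed

lemma finite_boundary: "X \<subseteq> edges G \<Longrightarrow> finite (boundary X)"
  using finite_sub finite_ends by (intro finite_subset[OF boundary_subset]) blast

lemma even_card_boundary:
  assumes "X \<subseteq> edges G"
  shows "even (card (boundary X))"
proof -
  have "finite X" using assms finite_sub by blast
  then show ?thesis using assms
  proof (induction X rule: finite_induct)
    case (insert e X)
    then have "boundary (sym_diff {e} X) = sym_diff (ends G e) (boundary X)"
      using boundary_sym_diff[of "{e}" X] boundary_single by simp
    moreover have "sym_diff {e} X = insert e X" using insert(2) by blast
    moreover have "even (card (ends G e))" "finite (ends G e)" "finite (boundary X)"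
      using insert.prems card_ends finite_ends finite_boundary by auto
    ultimately show ?case using odd_card_sym_diff[of "ends G e" "boundary X"] insert by simp
  qed simp
qed

lemma boundary_cycle:
  assumes "cycle G Q"
  shows "boundary Q = {}" "Q \<noteq> {}"
proof -
  obtain vs es where c: "vs \<noteq> []" "length es = length vs" "distinct vs" "distinct es" "set es = Q"
    and en: "\<And>i. i < length vs \<Longrightarrow> ends G (es ! i) = {vs ! i, vs ! (Suc i mod length vs)}"
    and QE: "Q \<subseteq> edges G"
    using assms by (auto simp: cycle_def)
  let ?n = "length vs"
  have n0: "?n > 0" using c(1) by simp
  have "es ! 0 \<in> edges G" using c(2,5) n0 QE by (metis nth_mem subsetD)
  then have "card (ends G (es ! 0)) = 2" by (rule card_ends)
  then have "?n \<noteq> 1" using en[OF n0] by auto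
  then have n2: "?n \<ge> 2" using n0 by linarith
  show "Q \<noteq> {}" using c n0 by (metis length_0_conv set_empty)
  have "even (card (edges_at Q v))" for v
  proof (cases "v \<in> set vs")
    case False
    have "edges_at Q v = {}"
    proof (rule ccontr)
      assume "edges_at Q v \<noteq> {}"
      then obtain j where "j < ?n" "v \<in> ends G (es ! j)"
        using c(2,5) by (auto simp: edges_at_def in_set_conv_nth)
      then have "v = vs ! j \<or> v = vs ! (Suc j mod ?n)" using en by simp
      then show False using False \<open>j < ?n\<close> n0 by auto
    qed
    then show ?thesis by simp
  next
    case True
    then obtain k where k: "k < ?n" "v = vs ! k" by (auto simp: in_set_conv_nth)
    define p where "p = (if k = 0 then ?n - 1 else k - 1)"
    have p: "p < ?n" "p \<noteq> k" using k n2 by (auto simp: p_def)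
    have suc: "Suc j mod ?n = k \<longleftrightarrow> j = p" if "j < ?n" for j
      using that k n0 by (cases "Suc j = ?n") (auto simp: p_def)
    have at: "v \<in> ends G (es ! j) \<longleftrightarrow> j = k \<or> j = p" if "j < ?n" for j
    proof -
      have "Suc j mod ?n < ?n" using n0 by simp
      then have "v \<in> ends G (es ! j) \<longleftrightarrow> k = j \<or> k = Suc j mod ?n"
        unfolding en[OF that] k(2) using nth_eq_iff_index_eq[OF c(3)] k(1) that by auto
      then show ?thesis using suc[OF that] by auto
    qed
    have "edges_at Q v = {es ! k, es ! p}"
    proof (intro equalityI subsetI)
      fix e assume "e \<in> edges_at Q v"
      then obtain j where "j < ?n" "e = es ! j" "v \<in> ends G (es ! j)"
        using c(2,5) by (auto simp: edges_at_def in_set_conv_nth)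
      then show "e \<in> {es ! k, es ! p}" using at by auto
    next
      fix e assume "e \<in> {es ! k, es ! p}"
      then show "e \<in> edges_at Q v" using at k(1) p(1) c(2,5) by (auto simp: edges_at_def)
    qed
    moreover have "es ! k \<noteq> es ! p" using nth_eq_iff_index_eq[OF c(4)] k(1) p c(2) by auto
    ultimately show ?thesis by simp
  qed
  then show "boundary Q = {}" by (simp add: boundary_def)
qed

definition walk :: "'e set \<Rightarrow> 'v list \<Rightarrow> 'e list \<Rightarrow> bool" where
  "walk D vs es \<longleftrightarrow> length vs = Suc (length es) \<and> distinct vs \<and>
     (\<forall>j<length es. es ! j \<in> D \<and> ends G (es ! j) = {vs ! j, vs ! Suc j})"

lemma walk_Cons:
  assumes "walk D vs es" "f \<in> D" "ends G f = {u, vs ! 0}" "u \<notin> set vs"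
  shows "walk D (u # vs) (f # es)"
  unfolding walk_def
proof (intro conjI allI impI)
  fix j assume "j < length (f # es)"
  then show "(f # es) ! j \<in> D" "ends G ((f # es) ! j) = {(u # vs) ! j, (u # vs) ! Suc j}"
    using assms by (cases j; simp add: walk_def)+
qed (use assms in \<open>auto simp: walk_def\<close>)

lemma exists_longest_walk:
  assumes D: "D \<subseteq> edges G" "e \<in> D"
  obtains vs es where "walk D vs es" "es \<noteq> []"
    "\<And>vs' es'. walk D vs' es' \<Longrightarrow> length es' \<le> length es"
proof -
  let ?V = "\<Union>e\<in>D. ends G e"
  have fin: "finite ?V" using D finite_sub finite_ends by blast
  have bound: "length es \<le> card ?V" if w: "walk D vs es" for vs es
  proof (cases "es = []")
    case False
    have "vs ! j \<in> ?V" if "j < length vs" for j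
    proof (cases "j < length es")
      case True
      then show ?thesis using w unfolding walk_def by blast
    next
      case False
      then have "j = Suc (length es - 1)" "length es - 1 < length es"
        using that w \<open>es \<noteq> []\<close> by (auto simp: walk_def)
      then show ?thesis using w unfolding walk_def by blast
    qed
    then have "set vs \<subseteq> ?V" by (auto simp: in_set_conv_nth)
    then have "card (set vs) \<le> card ?V" using fin card_mono by blast
    then show ?thesis using w by (simp add: walk_def distinct_card)
  qed simp
  obtain u v where uv: "ends G e = {u, v}" "u \<noteq> v"
    using card_ends D by (metis card_2_iff subsetD)
  then have w1: "walk D [u, v] [e]" using D by (simp add: walk_def)
  have "\<exists>p. walk D (fst p) (snd p) \<and> (\<forall>q. walk D (fst q) (snd q) \<longrightarrow> length (snd q) \<le> length (snd p))"
    by (rule ex_has_greatest_nat[of _ "([u, v], [e])" _ "Suc (card ?V)"])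
      (use w1 bound in \<open>auto simp: less_Suc_eq_le\<close>)
  then obtain p where p: "walk D (fst p) (snd p)"
    "\<And>q. walk D (fst q) (snd q) \<Longrightarrow> length (snd q) \<le> length (snd p)" by blast
  have "length [e] \<le> length (snd p)" using p(2)[of "([u, v], [e])"] w1 by simp
  then have "snd p \<noteq> []" by auto
  then show ?thesis using that[of "fst p" "snd p"] p by auto
qed

text \<open>
  The first vertex of a longest walk in \<open>D\<close> has even degree in \<open>D\<close>, hence a second edge.
  This edge must lead back to the walk, where it closes a cycle.
\<close>

lemma even_contains_cycle:
  assumes D: "D \<subseteq> edges G" "D \<noteq> {}" "boundary D = {}"
  shows "\<exists>Q\<subseteq>D. cycle G Q"
proof -
  obtain e where "e \<in> D" using D by blast
  then obtain vs es where w: "walk D vs es" "es \<noteq> []"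
    and longest: "\<And>vs' es'. walk D vs' es' \<Longrightarrow> length es' \<le> length es"
    using exists_longest_walk[OF D(1)] by blast
  have len: "length vs = Suc (length es)" and dist: "distinct vs"
    and step: "\<And>j. j < length es \<Longrightarrow> es ! j \<in> D \<and> ends G (es ! j) = {vs ! j, vs ! Suc j}"
    using w(1) by (auto simp: walk_def)
  let ?v = "vs ! 0"
  have e0: "es ! 0 \<in> edges_at D ?v" using step[of 0] w(2) by (auto simp: edges_at_def)
  have "even (card (edges_at D ?v))" using D(3) by (auto simp: boundary_def)
  then have "edges_at D ?v \<noteq> {es ! 0}" by auto
  then obtain f where f: "f \<in> D" "?v \<in> ends G f" "f \<noteq> es ! 0" using e0 by (auto simp: edges_at_def)
  then obtain u where u: "ends G f = {u, ?v}" "u \<noteq> ?v" using other_end D(1) by blast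
  have "u \<in> set vs"
  proof (rule ccontr)
    assume "u \<notin> set vs"
    then have "walk D (u # vs) (f # es)" using walk_Cons w(1) f(1) u(1) by blast
    then show False using longest by fastforce
  qed
  then obtain k where k: "k < length vs" "u = vs ! k" by (auto simp: in_set_conv_nth)
  have k0: "k > 0" using u(2) k by (cases k) auto
  have kl: "k \<le> length es" using k len by simp
  let ?vs = "take (Suc k) vs" and ?es = "take k es @ [f]"
  have lens: "length ?vs = Suc k" "length ?es = Suc k" using k kl by auto
  have nf: "es ! j \<noteq> f" if "j < k" for j
  proof (cases j)
    case 0
    then show ?thesis using f(3) by simp
  next
    case (Suc i)
    have "j < length es" using that kl by simp
    then have "?v \<notin> ends G (es ! j)"
      using step[of j] Suc len nth_eq_iff_index_eq[OF dist, of 0] by auto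
    then show ?thesis using f(2) by blast
  qed
  have de: "distinct (take k es)"
    unfolding distinct_conv_nth
  proof (intro allI impI)
    fix i j assume ij: "i < length (take k es)" "j < length (take k es)" "i \<noteq> j"
    then have l: "i < length es" "j < length es" by auto
    have "es ! i \<noteq> es ! j"
    proof
      assume "es ! i = es ! j"
      then have eq: "{vs ! i, vs ! Suc i} = {vs ! j, vs ! Suc j}" using step[OF l(1)] step[OF l(2)] by simp
      then have "vs ! i = vs ! j \<or> (vs ! i = vs ! Suc j \<and> vs ! Suc i = vs ! j)" by (auto simp: doubleton_eq_iff)
      then show False using nth_eq_iff_index_eq[OF dist] l len ij(3) by auto
    qed
    then show "take k es ! i \<noteq> take k es ! j" using ij by simp
  qed
  have "cycle G (set ?es)"
    unfolding cycle_def
  proof (intro conjI exI)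
    have "set (take k es) \<subseteq> D" using step by (auto simp: in_set_conv_nth)
    then show "set ?es \<subseteq> edges G" using f(1) D(1) by auto
    show "?vs \<noteq> []" using lens by auto
    show "length ?es = length ?vs" using lens by simp
    show "distinct ?vs" using dist by simp
    have "f \<notin> set (take k es)" using nf kl by (auto simp: in_set_conv_nth)
    then show "distinct ?es" using de by simp
    show "set ?es = set ?es" ..
    show "\<forall>i<length ?vs. ends G (?es ! i) = {?vs ! i, ?vs ! (Suc i mod length ?vs)}"
    proof (intro allI impI)
      fix i assume "i < length ?vs"
      then have "i < k \<or> i = k" using lens by auto
      then show "ends G (?es ! i) = {?vs ! i, ?vs ! (Suc i mod length ?vs)}"
      proof
        assume "i < k"
        then show ?thesis using step[of i] kl lens by (simp add: nth_append)
      next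
        assume "i = k"
        then show ?thesis using u(1) k(2) kl lens by (simp add: nth_append)
      qed
    qed
  qed
  moreover have "set ?es \<subseteq> D" using step f(1) by (auto simp: in_set_conv_nth)
  ultimately show ?thesis by blast
qed

lemma forest_iff: "forest G X \<longleftrightarrow> X \<subseteq> edges G \<and> (\<forall>D\<subseteq>X. boundary D = {} \<longrightarrow> D = {})"
proof -
  have "(\<forall>Q\<subseteq>X. \<not> cycle G Q) \<longleftrightarrow> (\<forall>D\<subseteq>X. boundary D = {} \<longrightarrow> D = {})" if X: "X \<subseteq> edges G"
  proof
    assume n: "\<forall>Q\<subseteq>X. \<not> cycle G Q"
    show "\<forall>D\<subseteq>X. boundary D = {} \<longrightarrow> D = {}"
    proof (intro allI impI)
      fix D assume D: "D \<subseteq> X" "boundary D = {}"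
      show "D = {}"
      proof (rule ccontr)
        assume "D \<noteq> {}"
        then obtain Q where "Q \<subseteq> D" "cycle G Q" using even_contains_cycle[of D] D X by blast
        then show False using n D(1) by blast
      qed
    qed
  next
    assume n: "\<forall>D\<subseteq>X. boundary D = {} \<longrightarrow> D = {}"
    show "\<forall>Q\<subseteq>X. \<not> cycle G Q" using n boundary_cycle by blast
  qed
  then show ?thesis unfolding forest_def by blast
qed

sublocale binary_matroid "graphic_matroid G" "\<lambda>D. boundary D = {}"
proof
  show "finite (ground (graphic_matroid G))" using finite_edges by (simp add: graphic_matroid_def)
  show "boundary {} = {}" by simp
  show "boundary (sym_diff D D') = {}" if "boundary D = {}" "boundary D' = {}"
      "D \<subseteq> ground (graphic_matroid G)" "D' \<subseteq> ground (graphic_matroid G)" for D D'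
    using boundary_sym_diff[of D D'] that by (simp add: graphic_matroid_def)
  show "indep (graphic_matroid G) X \<longleftrightarrow>
      X \<subseteq> ground (graphic_matroid G) \<and> (\<forall>D\<subseteq>X. boundary D = {} \<longrightarrow> D = {})" for X
    using forest_iff by (simp add: graphic_matroid_def)
qed

lemma indep_forest [simp]: "indep (graphic_matroid G) X \<longleftrightarrow> forest G X"
  by (simp add: graphic_matroid_def)

lemma forest_subset: "forest G X \<Longrightarrow> Y \<subseteq> X \<Longrightarrow> forest G Y"
  unfolding forest_def by blast

lemma forest_edges: "forest G X \<Longrightarrow> X \<subseteq> edges G"
  by (simp add: forest_def)

lemma forest_even: "forest G X \<Longrightarrow> Y \<subseteq> X \<Longrightarrow> boundary Y = {} \<Longrightarrow> Y = {}"
  unfolding forest_iff by blast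

lemma boundary_inj:
  assumes "forest G X" "Y \<subseteq> X" "Y' \<subseteq> X" "boundary Y = boundary Y'"
  shows "Y = Y'"
proof -
  have "Y \<subseteq> edges G" "Y' \<subseteq> edges G" using assms forest_edges by blast+
  then have "boundary (sym_diff Y Y') = {}" using boundary_sym_diff assms(4) by simp
  moreover have "sym_diff Y Y' \<subseteq> X" using assms by blast
  ultimately have "sym_diff Y Y' = {}" by (intro forest_even[OF assms(1)])
  then show ?thesis by blast
qed

text \<open>
  Boundaries embed the power set of \<open>X\<close> into that of \<open>Z\<close>, and they miss the singletons,
  which are odd.
\<close>

lemma card_forest_less:
  assumes "forest G X" "finite Z" "z \<in> Z" "\<And>e. e \<in> X \<Longrightarrow> ends G e \<subseteq> Z"
  shows "card X < card Z"
proof -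
  have X: "X \<subseteq> edges G" using assms(1) forest_edges by blast
  have inj: "inj_on boundary (Pow X)" by (rule inj_onI) (use boundary_inj[OF assms(1)] in blast)
  have sub: "boundary ` Pow X \<subseteq> Pow Z"
  proof
    fix b assume "b \<in> boundary ` Pow X"
    then obtain Y where Y: "Y \<subseteq> X" "b = boundary Y" by blast
    then have "b \<subseteq> (\<Union>e\<in>Y. ends G e)" using boundary_subset[of Y] by simp
    then show "b \<in> Pow Z" using assms(4) Y(1) by blast
  qed
  have "{z} \<notin> boundary ` Pow X"
  proof
    assume "{z} \<in> boundary ` Pow X"
    then obtain Y where "Y \<subseteq> X" "boundary Y = {z}" by force
    then have "even (card {z})" using even_card_boundary[of Y] X by auto
    then show False by simp
  qed
  then have "boundary ` Pow X \<subset> Pow Z" using sub assms(3) by blast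
  then have "card (boundary ` Pow X) < card (Pow Z)" using assms(2) by (intro psubset_card_mono) auto
  then have "(2::nat) ^ card X < 2 ^ card Z"
    using assms(2) finite_sub[OF X] by (simp add: card_image[OF inj] card_Pow)
  then show ?thesis by simp
qed

lemma sum_degrees:
  assumes "X \<subseteq> edges G" "finite Z" "\<And>e. e \<in> X \<Longrightarrow> ends G e \<subseteq> Z"
  shows "(\<Sum>u\<in>Z. card (edges_at X u)) = 2 * card X"
proof -
  have "card {u \<in> Z. u \<in> ends G e} = 2" if "e \<in> X" for e
  proof -
    have "{u \<in> Z. u \<in> ends G e} = ends G e" using assms(3)[OF that] by blast
    then show ?thesis using card_ends assms(1) that by auto
  qed
  then show ?thesis
    unfolding edges_at_def using assms(2) finite_sub[OF assms(1)]
    by (intro sum_multicount) auto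
qed

text \<open>
  A forest without leaves outside \<open>S\<close> leads from each end of each edge to \<open>S\<close> without using
  that edge. Otherwise let \<open>Z\<close> be the set of vertices reached from \<open>x\<close> without \<open>i\<close>. Then \<open>Z\<close>
  misses \<open>S\<close> and the other end of \<open>i\<close>. Inside \<open>Z\<close> all degrees are at least two, except that
  \<open>x\<close> has lost \<open>i\<close>. So the degree sum is at least \<open>2 |Z| - 1\<close>, but a forest on \<open>Z\<close> has at
  most \<open>|Z| - 1\<close> edges.
\<close>

lemma reach_special:
  assumes X: "forest G X" and free: "\<And>w. w \<notin> S \<Longrightarrow> card (edges_at X w) \<noteq> 1"
    and i: "i \<in> X" "x \<in> ends G i"
  shows "\<exists>s\<in>S. \<exists>Y\<subseteq>X - {i}. boundary Y = sym_diff {x} {s}"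
proof (rule ccontr)
  assume no: "\<not> ?thesis"
  have XE: "X \<subseteq> edges G" using X forest_edges by blast
  define Z where "Z = {u. \<exists>Y\<subseteq>X - {i}. boundary Y = sym_diff {x} {u}}"
  define XZ where "XZ = {e \<in> X - {i}. ends G e \<inter> Z \<noteq> {}}"
  have xZ: "x \<in> Z" unfolding Z_def by (intro CollectI exI[of _ "{}"]) simp
  have ZS: "Z \<inter> S = {}" using no by (auto simp: Z_def)
  obtain y where y: "ends G i = {x, y}" "y \<noteq> x"
    using other_end[of i x] XE i by (metis insert_commute subsetD)
  have yZ: "y \<notin> Z"
  proof
    assume "y \<in> Z"
    then obtain Y where Y: "Y \<subseteq> X - {i}" "boundary Y = sym_diff {x} {y}" unfolding Z_def by blast
    have "boundary Y = boundary {i}" using Y(2) y by (auto simp: boundary_single)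
    then have "Y = {i}" using boundary_inj[OF X, of Y "{i}"] Y(1) i(1) by blast
    then show False using Y(1) by blast
  qed
  have closed: "ends G e \<subseteq> Z" if e: "e \<in> XZ" for e
  proof
    fix v assume v: "v \<in> ends G e"
    obtain u where u: "u \<in> ends G e" "u \<in> Z" using e by (auto simp: XZ_def)
    show "v \<in> Z"
    proof (cases "v = u")
      case False
      have eX: "e \<in> X - {i}" "e \<in> edges G" using e XE by (auto simp: XZ_def)
      have uv: "ends G e = {u, v}" using card_ends[OF eX(2)] u(1) v False by (auto simp: card_2_iff)
      obtain Y where Y: "Y \<subseteq> X - {i}" "boundary Y = sym_diff {x} {u}" using u(2) unfolding Z_def by blast
      have "boundary (sym_diff Y {e}) = sym_diff (sym_diff {x} {u}) {u, v}"
        using boundary_sym_diff[of Y "{e}"] Y XE eX by (auto simp: boundary_single uv)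
      also have "\<dots> = sym_diff {x} {v}" using False by blast
      finally have "boundary (sym_diff Y {e}) = sym_diff {x} {v}" .
      moreover have "sym_diff Y {e} \<subseteq> X - {i}" using Y(1) eX(1) by blast
      ultimately show ?thesis
        unfolding Z_def by (intro CollectI exI[of _ "sym_diff Y {e}"] conjI)
    qed (use u in simp)
  qed
  have touched: "edges_at (X - {i}) u \<noteq> {}" if uZ: "u \<in> Z" and ux: "u \<noteq> x" for u
  proof -
    obtain Y where Y: "Y \<subseteq> X - {i}" "boundary Y = sym_diff {x} {u}" using uZ unfolding Z_def by blast
    then have "u \<in> boundary Y" using ux by blast
    then have "u \<in> (\<Union>e\<in>Y. ends G e)" using boundary_subset[of Y] by blast
    then show ?thesis using Y(1) by (auto simp: edges_at_def)
  qed
  have finX: "finite X" using finite_sub XE by blast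
  have "Z \<subseteq> insert x (\<Union>e\<in>X. ends G e)" using touched by (auto simp: edges_at_def)
  moreover have "finite (insert x (\<Union>e\<in>X. ends G e))" using finX finite_ends XE by blast
  ultimately have finZ: "finite Z" by (rule finite_subset)
  have XZ: "forest G XZ" by (rule forest_subset[OF X]) (auto simp: XZ_def)
  have less: "card XZ < card Z" by (rule card_forest_less[OF XZ finZ xZ closed])
  have at: "edges_at XZ u = edges_at X u - {i}" if "u \<in> Z" for u
    using that by (auto simp: edges_at_def XZ_def)
  have degx: "card (edges_at XZ x) \<ge> 1"
  proof -
    have iat: "i \<in> edges_at X x" using i by (simp add: edges_at_def)
    have fin: "finite (edges_at X x)" using finX by (simp add: edges_at_def)
    have "card (edges_at X x) \<noteq> 1" using free xZ ZS by blast
    moreover have "card (edges_at X x) \<noteq> 0" using fin iat by auto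
    moreover have "card (edges_at XZ x) = card (edges_at X x) - 1"
      unfolding at[OF xZ] using fin iat by simp
    ultimately show ?thesis by linarith
  qed
  have degu: "card (edges_at XZ u) \<ge> 2" if u: "u \<in> Z - {x}" for u
  proof -
    have "i \<notin> edges_at X u" using u y yZ by (auto simp: edges_at_def)
    then have eq: "edges_at XZ u = edges_at X u" using at u by auto
    have "card (edges_at X u) \<noteq> 1" using free u ZS by blast
    moreover have "edges_at X u \<noteq> {}" using touched[of u] u by (auto simp: edges_at_def)
    moreover have "finite (edges_at X u)" using finX by (simp add: edges_at_def)
    ultimately have "card (edges_at X u) \<ge> 2" by (metis One_nat_def card_eq_0_iff less_2_cases not_le)
    then show ?thesis unfolding eq .
  qed
  have XZE: "XZ \<subseteq> edges G" using XE by (auto simp: XZ_def)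
  have "2 * card XZ = card (edges_at XZ x) + (\<Sum>u\<in>Z - {x}. card (edges_at XZ u))"
    using sum_degrees[OF XZE finZ closed] finZ xZ by (simp add: sum.remove)
  moreover have "(\<Sum>u\<in>Z - {x}. card (edges_at XZ u)) \<ge> 2 * card (Z - {x})"
    using sum_mono[of "Z - {x}" "\<lambda>_. 2" "\<lambda>u. card (edges_at XZ u)"] degu by (simp add: mult.commute)
  moreover have "card Z = Suc (card (Z - {x}))" using finZ xZ by (metis card.remove)
  ultimately show False using less degx by linarith
qed

lemma special_join:
  assumes X: "X \<subseteq> edges G" and e: "e \<in> edges G" "e \<notin> X"
    and reach: "\<And>v. v \<in> ends G e \<Longrightarrow> \<exists>s\<in>S. \<exists>Y\<subseteq>X. boundary Y = sym_diff {v} {s}"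
  shows "\<exists>Y\<subseteq>insert e X. e \<in> Y \<and> boundary Y \<subseteq> S"
proof -
  obtain u v where uv: "ends G e = {u, v}" "u \<noteq> v" using card_ends[OF e(1)] by (auto simp: card_2_iff)
  obtain s Y where Y: "s \<in> S" "Y \<subseteq> X" "boundary Y = sym_diff {u} {s}" using reach[of u] uv by blast
  obtain s' Y' where Y': "s' \<in> S" "Y' \<subseteq> X" "boundary Y' = sym_diff {v} {s'}" using reach[of v] uv by blast
  let ?W = "sym_diff (sym_diff Y Y') {e}"
  have "boundary ?W = sym_diff (sym_diff (boundary Y) (boundary Y')) (ends G e)"
  proof -
    have "Y \<subseteq> edges G" "Y' \<subseteq> edges G" "sym_diff Y Y' \<subseteq> edges G" using X Y(2) Y'(2) by blast+
    then show ?thesis using boundary_sym_diff[of "sym_diff Y Y'" "{e}"] boundary_sym_diff[of Y Y'] e(1)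
      by (simp add: boundary_single)
  qed
  also have "\<dots> \<subseteq> S" unfolding Y(3) Y'(3) uv using Y(1) Y'(1) uv(2) by blast
  finally have "boundary ?W \<subseteq> S" .
  moreover have "e \<in> ?W" "?W \<subseteq> insert e X" using Y(2) Y'(2) e(2) by blast+
  ultimately show ?thesis by blast
qed

lemma special_path_through:
  assumes X: "forest G X" and free: "\<And>w. w \<notin> S \<Longrightarrow> card (edges_at X w) \<noteq> 1" and i: "i \<in> X"
  shows "\<exists>Y\<subseteq>X. i \<in> Y \<and> boundary Y \<subseteq> S"
proof -
  have "X \<subseteq> edges G" using X forest_edges by blast
  then have "\<exists>Y\<subseteq>insert i (X - {i}). i \<in> Y \<and> boundary Y \<subseteq> S"
    using reach_special[OF X free i] i by (intro special_join) auto
  then show ?thesis using i by (simp add: insert_absorb)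
qed

end

section \<open>Trees with at most three inner vertices\<close>

text \<open>
  The nonempty even subsets of a set of three elements are its pairs, and any two of the
  three pairs add up to the third.
\<close>

lemma even_subsets_of_three:
  assumes S: "finite S" "card S \<le> 3"
    and A: "A \<subseteq> S" "even (card A)" "A \<noteq> {}"
    and A': "A' \<subseteq> S" "even (card A')" "A' \<noteq> {}"
    and A'': "A'' \<subseteq> S" "even (card A'')" "A'' \<noteq> {}"
    and ne: "A \<noteq> A'" "A \<noteq> A''" "A' \<noteq> A''"
  shows "sym_diff A A' = A''"
proof -
  have two: "card T = 2" if "T \<subseteq> S" "even (card T)" "T \<noteq> {}" for T
  proof -
    have "card T \<le> 3" using card_mono[OF S(1) that(1)] S(2) by linarith
    moreover have "card T \<noteq> 0" using that(3) finite_subset[OF that(1) S(1)] by simp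
    ultimately show ?thesis using that(2) by presburger
  qed
  have "card S = 3"
  proof (rule ccontr)
    assume "card S \<noteq> 3"
    then have "card S \<le> 2" using S(2) by linarith
    then have "T = S" if "T \<subseteq> S" "even (card T)" "T \<noteq> {}" for T
      using two[OF that] S(1) that(1) by (intro card_seteq) auto
    then show False using A A' ne(1) by metis
  qed
  then have "\<exists>a. a \<in> S \<and> T = S - {a}" if "T \<subseteq> S" "even (card T)" "T \<noteq> {}" for T
  proof -
    have "card (S - T) = 1"
      using two[OF that] \<open>card S = 3\<close> S(1) that(1) by (simp add: card_Diff_subset finite_subset)
    then obtain a where "S - T = {a}" by (auto simp: card_1_singleton_iff)
    then show ?thesis using that(1) by blast
  qed
  from this[OF A] this[OF A'] this[OF A''] obtain a a' a''
    where a: "a \<in> S" "A = S - {a}" "a' \<in> S" "A' = S - {a'}" "a'' \<in> S" "A'' = S - {a''}" by auto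
  then have "card {a, a', a''} = 3" using ne by auto
  then have "{a, a', a''} = S" using a \<open>card S = 3\<close> S(1) by (intro card_seteq) auto
  then show ?thesis using a ne by auto
qed

text \<open>
  Spanning trees whose vertices are all leaves except for at most three, the spine \<open>S\<close>.
\<close>

locale spined_graph = finite_multigraph G for G :: "('v, 'e) multigraph" +
  fixes B :: "'e set" and S :: "'v set"
  assumes tree: "basis (graphic_matroid G) B"
    and finite_spine: "finite S" and card_spine: "card S \<le> 3"
    and leaf: "w \<notin> S \<Longrightarrow> e \<in> B \<Longrightarrow> f \<in> B \<Longrightarrow> w \<in> ends G e \<Longrightarrow> w \<in> ends G f \<Longrightarrow> e = f"
begin

sublocale based_binary_matroid "graphic_matroid G" "\<lambda>D. boundary D = {}" B
  by unfold_locales (rule tree)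

lemma ground_eq: "ground (graphic_matroid G) = edges G"
  by (simp add: graphic_matroid_def)

lemma circuit_edges: "i \<in> R \<Longrightarrow> C i \<subseteq> edges G"
  using fund_circuit_ground ground_eq by simp

lemma circuit_even: "i \<in> R \<Longrightarrow> even (card (edges_at (C i) w))"
  using fund_circuit(1)[of i] by (auto simp: boundary_def)

text \<open>
  The circuit \<open>C i\<close> has even degree at \<open>w\<close> and at most two candidates for edges there,
  namely \<open>i\<close> and the tree edge at the leaf \<open>w\<close>. So it uses both or none; \<open>circuit_leaf\<close> is
  the converse.
\<close>

lemma circuit_end:
  assumes i: "i \<in> R" and e: "e \<in> B" "e \<in> C i" "w \<in> ends G e" "w \<notin> S"
  shows "w \<in> ends G i"
proof (rule ccontr)
  assume n: "w \<notin> ends G i"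
  have "edges_at (C i) w = {e}"
  proof (intro equalityI subsetI)
    fix f assume "f \<in> edges_at (C i) w"
    then have f: "f \<in> C i" "w \<in> ends G f" by (auto simp: edges_at_def)
    then have "f \<in> B" using fund_circuit(3)[OF i] n by blast
    then show "f \<in> {e}" using leaf[OF e(4) _ e(1) f(2) e(3)] by simp
  qed (use e in \<open>simp add: edges_at_def\<close>)
  then show False using circuit_even[OF i, of w] by simp
qed

lemma circuit_leaf:
  assumes i: "i \<in> R" and w: "w \<in> ends G i"
  shows "\<exists>e\<in>B. e \<in> C i \<and> w \<in> ends G e"
proof -
  have "edges_at (C i) w \<noteq> {i}" using circuit_even[OF i, of w] by auto
  moreover have "i \<in> edges_at (C i) w" using fund_circuit(2)[OF i] w by (simp add: edges_at_def)
  ultimately obtain e where "e \<in> edges_at (C i) w" "e \<noteq> i" by blast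
  then show ?thesis using fund_circuit(3)[OF i] by (auto simp: edges_at_def)
qed

lemma R_not_B: "i \<in> R \<Longrightarrow> i \<notin> B"
  by (simp add: cobasis_def)

text \<open>
  At a vertex \<open>w\<close> outside the spine, the tree edge is covered by the members of \<open>\<tau>\<close> at \<open>w\<close>
  and by no others. If there is just one of them, both it and the tree edge belong to
  \<open>once C \<tau>\<close>.
\<close>

lemma no_leaf_off_spine:
  assumes t: "\<tau> \<subseteq> R" and w: "w \<notin> S"
  shows "card (edges_at (once C \<tau>) w) \<noteq> 1"
proof
  assume "card (edges_at (once C \<tau>) w) = 1"
  then obtain f where f: "edges_at (once C \<tau>) w = {f}" by (auto simp: card_1_singleton_iff)
  then have fo: "f \<in> once C \<tau>" "w \<in> ends G f" by (auto simp: edges_at_def)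
  have only: "i = f" if "i \<in> \<tau>" "w \<in> ends G i" for i
  proof -
    have "i \<in> edges_at (once C \<tau>) w" using self_in_once[OF t that(1)] that(2) by (simp add: edges_at_def)
    then show ?thesis using f by simp
  qed
  show False
  proof (cases "f \<in> B")
    case True
    obtain i where i: "i \<in> \<tau>" "f \<in> C i" using fo(1) once_subset[of C \<tau>] by blast
    have iR: "i \<in> R" using i(1) t by blast
    have "w \<in> ends G i" by (rule circuit_end[OF iR True i(2) fo(2) w])
    then have "i = f" using only[OF i(1)] by simp
    then show False using R_not_B[OF iR] True by simp
  next
    case False
    have "f \<in> edges G" using fo(1) once_subset[of C \<tau>] circuit_edges t by blast
    then have "f \<in> R" using False by (simp add: cobasis_def ground_eq)
    then have ft: "f \<in> \<tau>" using once_in_R[OF t fo(1)] by blast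
    obtain e where e: "e \<in> B" "e \<in> C f" "w \<in> ends G e" using circuit_leaf[OF \<open>f \<in> R\<close> fo(2)] by blast
    have "j = f" if j: "j \<in> \<tau>" "e \<in> C j" for j
      using only[OF j(1)] circuit_end[OF _ e(1) j(2) e(3) w] j(1) t by blast
    then have "e \<in> once C \<tau>" unfolding once_def using ft e(2) by blast
    then have "e \<in> edges_at (once C \<tau>) w" using e(3) by (simp add: edges_at_def)
    then have "e = f" using f by simp
    then show False using e(1) False by simp
  qed
qed

text \<open>
  In a forest, different edge sets have different boundaries, so the statement about
  boundaries reduces to \<open>even_subsets_of_three\<close>.
\<close>

lemma three_spine_paths:
  assumes X: "forest G X"
    and Y: "Y \<subseteq> X" "Y \<noteq> {}" "boundary Y \<subseteq> S"
    and Y': "Y' \<subseteq> X" "Y' \<noteq> {}" "boundary Y' \<subseteq> S"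
    and Y'': "Y'' \<subseteq> X" "Y'' \<noteq> {}" "boundary Y'' \<subseteq> S"
    and ne: "Y \<noteq> Y'" "Y \<noteq> Y''" "Y' \<noteq> Y''"
  shows "Y'' = sym_diff Y Y'"
proof -
  have E: "Y \<subseteq> edges G" "Y' \<subseteq> edges G" "Y'' \<subseteq> edges G" using X Y(1) Y'(1) Y''(1) forest_edges by blast+
  have inj: "Z = Z'" if "Z \<subseteq> X" "Z' \<subseteq> X" "boundary Z = boundary Z'" for Z Z'
    using boundary_inj[OF X that] .
  have "sym_diff (boundary Y) (boundary Y') = boundary Y''"
  proof (rule even_subsets_of_three[OF finite_spine card_spine])
    show "boundary Y \<subseteq> S" "boundary Y' \<subseteq> S" "boundary Y'' \<subseteq> S" by fact+
    show "even (card (boundary Y))" "even (card (boundary Y'))" "even (card (boundary Y''))"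
      using even_card_boundary E by blast+
    show "boundary Y \<noteq> {}" "boundary Y' \<noteq> {}" "boundary Y'' \<noteq> {}"
      using forest_even[OF X] Y Y' Y'' by blast+
    show "boundary Y \<noteq> boundary Y'" "boundary Y \<noteq> boundary Y''" "boundary Y' \<noteq> boundary Y''"
      using inj Y(1) Y'(1) Y''(1) ne by blast+
  qed
  then have "boundary Y'' = boundary (sym_diff Y Y')" using boundary_sym_diff E by simp
  then show ?thesis by (rule inj[rotated 2]) (use Y(1) Y'(1) Y''(1) in auto)
qed

lemma dead_forest: "dead (graphic_matroid G) B \<sigma> \<Longrightarrow> \<sigma> \<subseteq> R \<and> \<sigma> \<noteq> {} \<and> forest G (once C \<sigma>)"
  by (simp add: dead_eq)

lemma spine_path_inside:
  assumes "\<tau> \<subseteq> R" "forest G (once C \<tau>)" "i \<in> once C \<tau>"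
  shows "\<exists>Y\<subseteq>once C \<tau>. i \<in> Y \<and> boundary Y \<subseteq> S"
  by (rule special_path_through[OF assms(2) no_leaf_off_spine[OF assms(1)] assms(3)])

text \<open>
  Each end of \<open>e\<close> lies on the spine or, by \<open>circuit_end\<close>, on a member of \<open>\<sigma>\<close>, from where
  \<open>once C \<sigma>\<close> leads to the spine.
\<close>

lemma spine_path_extra:
  assumes d: "dead (graphic_matroid G) B \<sigma>" and e: "e \<in> cover \<sigma>" "e \<notin> once C \<sigma>"
  shows "\<exists>Y\<subseteq>insert e (once C \<sigma>). e \<in> Y \<and> boundary Y \<subseteq> S"
proof -
  let ?U = "once C \<sigma>"
  have s: "\<sigma> \<subseteq> R" and U: "forest G ?U" using dead_forest[OF d] by auto
  have UE: "?U \<subseteq> edges G" using U forest_edges by blast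
  obtain i where i: "i \<in> \<sigma>" "e \<in> C i" using e(1) by blast
  have iR: "i \<in> R" using i s by blast
  have eE: "e \<in> edges G" using circuit_edges[OF iR] i by blast
  have sU: "\<sigma> \<subseteq> ?U" using self_in_once[OF s] by blast
  then have "e \<noteq> i" using e(2) i(1) by blast
  then have eB: "e \<in> B" using fund_circuit(3)[OF iR] i(2) by blast
  have "\<exists>s\<in>S. \<exists>Y\<subseteq>?U. boundary Y = sym_diff {v} {s}" if v: "v \<in> ends G e" for v
  proof (cases "v \<in> S")
    case True
    then show ?thesis by (intro bexI[of _ v] exI[of _ "{}"]) auto
  next
    case False
    have "v \<in> ends G i" by (rule circuit_end[OF iR eB i(2) v False])
    have "\<exists>s\<in>S. \<exists>Y\<subseteq>?U - {i}. boundary Y = sym_diff {v} {s}"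
    proof (rule reach_special[OF U])
      show "card (edges_at ?U w) \<noteq> 1" if "w \<notin> S" for w by (rule no_leaf_off_spine[OF s that])
      show "i \<in> ?U" using sU i(1) by blast
    qed fact
    then show ?thesis by blast
  qed
  then show ?thesis by (rule special_join[OF UE eE e(2)])
qed

text \<open>
  Two independent elements \<open>e\<close> and \<open>f\<close> of the minor give spine paths \<open>Y \<ni> e\<close> and \<open>Y' \<ni> f\<close>,
  besides a path \<open>Y''\<close> inside \<open>once C \<sigma>\<close>. Then \<open>Y''\<close> cannot be the sum of the first two.
\<close>

lemma minor_rank_le_1:
  assumes d: "dead (graphic_matroid G) B \<sigma>"
  shows "minor_rank \<sigma> \<le> 1"
proof (rule ccontr)
  assume big: "\<not> ?thesis"
  let ?U = "once C \<sigma>"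
  have s: "\<sigma> \<subseteq> R" "\<sigma> \<noteq> {}" "forest G ?U" using dead_forest[OF d] by auto
  then have s': "\<sigma> \<subseteq> R" "indep (graphic_matroid G) ?U" by auto
  interpret K: independence_complex "stratum_minor (graphic_matroid G) B \<sigma>"
    using stratum_minor_complex[OF s'] .
  obtain I where I: "indep (stratum_minor (graphic_matroid G) B \<sigma>) I" "card I = minor_rank \<sigma>"
    using K.rank_of_attained by blast
  then have "2 \<le> card I" using big by simp
  then obtain T where "T \<subseteq> I" "card T = 2" by (metis obtain_subset_with_card_n)
  then obtain e f where ef: "e \<in> I" "f \<in> I" "e \<noteq> f" by (auto simp: card_2_iff)
  have I': "I \<subseteq> cover \<sigma> - ?U" "forest G (I \<union> ?U)" using I(1) stratum_minor(2)[OF s'] by auto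
  let ?X = "I \<union> ?U"
  obtain Y where Y: "Y \<subseteq> insert e ?U" "e \<in> Y" "boundary Y \<subseteq> S"
    using spine_path_extra[OF d, of e] ef(1) I'(1) by blast
  obtain Y' where Y': "Y' \<subseteq> insert f ?U" "f \<in> Y'" "boundary Y' \<subseteq> S"
    using spine_path_extra[OF d, of f] ef(2) I'(1) by blast
  obtain i where i: "i \<in> \<sigma>" using s(2) by blast
  from spine_path_inside[OF s(1,3) self_in_once[OF s(1) i]]
  obtain Y'' where Y'': "Y'' \<subseteq> ?U" "i \<in> Y''" "boundary Y'' \<subseteq> S" by blast
  have out: "e \<notin> ?U" "f \<notin> ?U" using ef I'(1) by auto
  have not_in: "e \<notin> Y'" "e \<notin> Y''" "f \<notin> Y''" using Y'(1) Y''(1) ef(3) out by blast+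
  have "Y'' = sym_diff Y Y'"
  proof (rule three_spine_paths[OF I'(2)])
    show "Y \<subseteq> ?X" "Y' \<subseteq> ?X" "Y'' \<subseteq> ?X" using Y(1) Y'(1) Y''(1) ef by blast+
    show "Y \<noteq> {}" "Y' \<noteq> {}" "Y'' \<noteq> {}" using Y(2) Y'(2) Y''(2) by blast+
    show "Y \<noteq> Y'" "Y \<noteq> Y''" "Y' \<noteq> Y''" using Y(2) Y'(2) not_in by blast+
  qed (fact Y(3) Y'(3) Y''(3))+
  then show False using Y(2) not_in by blast
qed

text \<open>
  Otherwise there are three spine paths: one through an element \<open>e\<close> that is not a loop of
  the minor, one inside \<open>once C \<tau>\<close>, and one inside \<open>once C \<sigma>\<close> through some \<open>j \<in> \<sigma> - \<tau>\<close>. Only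
  the first contains \<open>e\<close>, so it is not the sum of the other two.
\<close>

lemma once_not_below:
  assumes d: "dead (graphic_matroid G) B \<sigma>" and r: "minor_rank \<sigma> = 1"
    and t: "\<tau> \<subset> \<sigma>" "\<tau> \<noteq> {}"
  shows "\<not> once C \<tau> \<subseteq> once C \<sigma>"
proof
  let ?U = "once C \<sigma>"
  assume le: "once C \<tau> \<subseteq> ?U"
  have s: "\<sigma> \<subseteq> R" "forest G ?U" using dead_forest[OF d] by auto
  then have s': "\<sigma> \<subseteq> R" "indep (graphic_matroid G) ?U" by auto
  have tR: "\<tau> \<subseteq> R" using t s by blast
  have "non_loops \<sigma> \<noteq> {}" using two_le_card_non_loops[OF d r] by (metis card.empty not_numeral_le_zero)
  then obtain e where "e \<in> non_loops \<sigma>" by blast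
  then have e: "e \<in> cover \<sigma>" "e \<notin> ?U" "forest G (insert e ?U)"
    using stratum_minor(2)[OF s', of "{e}"] by auto
  obtain Y where Y: "Y \<subseteq> insert e ?U" "e \<in> Y" "boundary Y \<subseteq> S" using spine_path_extra[OF d e(1,2)] by blast
  obtain i where i: "i \<in> \<tau>" using t by blast
  from spine_path_inside[OF tR forest_subset[OF s(2) le] self_in_once[OF tR i]]
  obtain Y' where Y': "Y' \<subseteq> once C \<tau>" "i \<in> Y'" "boundary Y' \<subseteq> S" by blast
  obtain j where j: "j \<in> \<sigma>" "j \<notin> \<tau>" using t by blast
  from spine_path_inside[OF s self_in_once[OF s(1) j(1)]]
  obtain Y'' where Y'': "Y'' \<subseteq> ?U" "j \<in> Y''" "boundary Y'' \<subseteq> S" by blast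
  have jt: "j \<notin> once C \<tau>" using once_in_R[OF tR] j s(1) by blast
  have not_in: "e \<notin> Y'" "e \<notin> Y''" "j \<notin> Y'" using Y'(1) Y''(1) e(2) le jt by blast+
  have "Y = sym_diff Y' Y''"
  proof (rule three_spine_paths[OF e(3)])
    show "Y \<subseteq> insert e ?U" "Y' \<subseteq> insert e ?U" "Y'' \<subseteq> insert e ?U" using Y(1) Y'(1) Y''(1) le by blast+
    show "Y \<noteq> {}" "Y' \<noteq> {}" "Y'' \<noteq> {}" using Y(2) Y'(2) Y''(2) by blast+
    show "Y' \<noteq> Y''" "Y' \<noteq> Y" "Y'' \<noteq> Y" using Y(2) Y''(2) not_in by blast+
  qed (fact Y(3) Y'(3) Y''(3))+
  then show False using Y(2) not_in by blast
qed

theorem no_obstruction: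
  assumes "fibres_below (graphic_matroid G) B F \<sigma>"
  shows "\<not> obstructed (graphic_matroid G) B F \<sigma>"
proof
  assume "obstructed (graphic_matroid G) B F \<sigma>"
  then have d: "dead (graphic_matroid G) B \<sigma>" and no: "\<not> (\<exists>X. fibre_at (graphic_matroid G) B F \<sigma> X)"
    by (simp_all add: obstructed_def)
  have "\<exists>X. fibre_at (graphic_matroid G) B F \<sigma> X"
    by (rule fibre_exists[OF assms d minor_rank_le_1[OF d] once_not_below[OF d]])
  then show False using no by contradiction
qed

theorem relaxed_coparking_pure:
  assumes "fibre_system (graphic_matroid G) B F"
  shows "pure_multicomplex R (relaxed_coparking (graphic_matroid G) B F)"
    and "degree_seq R (relaxed_coparking (graphic_matroid G) B F) = h_vector (graphic_matroid G)"
  by (rule pure_relaxed_coparking[OF assms h_vector_top_nonzero[OF _ minor_rank_le_1]]; assumption)+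

text \<open>
  A spine path inside \<open>once C \<sigma>\<close> would have a nonempty even boundary, which does not fit
  into a spine with at most one vertex.
\<close>

lemma no_dead_if_single:
  assumes "card S \<le> 1"
  shows "\<not> dead (graphic_matroid G) B \<sigma>"
proof
  assume d: "dead (graphic_matroid G) B \<sigma>"
  then have s: "\<sigma> \<subseteq> R" "\<sigma> \<noteq> {}" "forest G (once C \<sigma>)" using dead_forest by auto
  then obtain i where i: "i \<in> \<sigma>" by blast
  from spine_path_inside[OF s(1,3) self_in_once[OF s(1) i]]
  obtain Y where Y: "Y \<subseteq> once C \<sigma>" "i \<in> Y" "boundary Y \<subseteq> S" by blast
  have "Y \<subseteq> edges G" using Y(1) s(3) forest_edges by blast
  then have "even (card (boundary Y))" by (rule even_card_boundary)
  moreover have "card (boundary Y) \<le> 1" using card_mono[OF finite_spine Y(3)] assms by linarith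
  ultimately have "card (boundary Y) = 0" by presburger
  then have "boundary Y = {}" using finite_subset[OF Y(3) finite_spine] by simp
  then show False using forest_even[OF s(3) Y(1)] Y(2) by blast
qed

end

section \<open>Canonical trees\<close>

text \<open>
  The vertices may coincide, so that \<open>v1 = v2\<close> describes biconed and \<open>v0 = v1 = v2\<close> coned
  graphs.
\<close>

definition dominating_spine :: "('v, 'e) multigraph \<Rightarrow> 'v \<Rightarrow> 'v \<Rightarrow> 'v \<Rightarrow> bool" where
  "dominating_spine G v0 v1 v2 \<longleftrightarrow>
     (v1 = v0 \<or> adjacent G v1 v0) \<and> (v2 = v0 \<or> adjacent G v2 v0) \<and> dominates G {v0, v1, v2} \<and>
     no_parallel_at G v0 \<and> no_parallel_at G v1 \<and> no_parallel_at G v2"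

lemma adjacent_sym: "adjacent G u v \<Longrightarrow> adjacent G v u"
  by (auto simp: adjacent_def insert_commute)

lemma triconed_spine: "triconed_at G v0 v1 v2 \<Longrightarrow> dominating_spine G v0 v1 v2"
  by (auto simp: triconed_at_def dominating_spine_def adjacent_sym)

lemma coned_spine: "coned_at G v0 \<Longrightarrow> dominating_spine G v0 v0 v0"
  by (simp add: coned_at_def dominating_spine_def)

text \<open>
  A vertex outside the spine is nobody's parent, so its only tree edge is the one to its
  parent, which is unique as there are no parallel edges at the spine. The tree is spanning
  because it connects every vertex to \<open>v0\<close>.
\<close>

lemma canonical_tree_spined:
  fixes G :: "('v, 'e) multigraph"
  assumes G: "graph G" and sp: "dominating_spine G v0 v1 v2"
  shows "spined_graph G (canonical_tree G v0 v1 v2) {v0, v1, v2}"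
proof -
  interpret finite_multigraph G by unfold_locales (use G in \<open>auto simp: graph_def\<close>)
  let ?B = "canonical_tree G v0 v1 v2" and ?S = "{v0, v1, v2}" and ?p = "canonical_parent G v0 v1 v2"
  have par: "?p v \<in> ?S" for v by (simp add: canonical_parent_def)
  have parS: "?p v = v0" if "v \<in> ?S" "v \<noteq> v0" for v
    using sp that by (auto simp: canonical_parent_def dominating_spine_def)
  have nopar: "e = f" if "s \<in> ?S" "e \<in> edges G" "f \<in> edges G" "s \<in> ends G e" "ends G e = ends G f" for s e f
  proof -
    have "no_parallel_at G s" using sp that(1) by (auto simp: dominating_spine_def)
    then show ?thesis using that by (simp add: no_parallel_at_def)
  qed
  have adj: "adjacent G v (?p v)" if v: "v \<in> verts G - {v0}" for v
  proof (cases "v \<in> ?S")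
    case True
    then show ?thesis using v sp parS[OF True] by (auto simp: dominating_spine_def)
  next
    case False
    then obtain u where "u \<in> ?S" "adjacent G v u"
      using v sp unfolding dominating_spine_def dominates_def by blast
    then show ?thesis by (auto simp: canonical_parent_def)
  qed
  have tree_edge: "\<exists>e\<in>?B. ends G e = {v, ?p v}" if "v \<in> verts G - {v0}" for v
    using adj[OF that] that unfolding adjacent_def canonical_tree_def by blast
  have BE: "?B \<subseteq> edges G" by (auto simp: canonical_tree_def)
  have child: "\<exists>v\<in>verts G - {v0}. ends G e = {v, ?p v}" if "e \<in> ?B" for e
    using that by (simp add: canonical_tree_def)
  have at: "ends G e = {w, ?p w}" if "e \<in> ?B" "w \<in> ends G e" "w \<notin> ?S" for e w
    using child[OF that(1)] that(2,3) par by (metis insertE singletonD)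
  have leaf: "e = f" if "w \<notin> ?S" "e \<in> ?B" "f \<in> ?B" "w \<in> ends G e" "w \<in> ends G f" for w e f
    using nopar[of "?p w" e f] at[of e w] at[of f w] that par BE by blast
  have forest: "forest G ?B"
    unfolding forest_iff
  proof (intro conjI allI impI)
    fix D assume D: "D \<subseteq> ?B" "boundary D = {}"
    have even: "even (card (edges_at D w))" for w using D(2) by (auto simp: boundary_def)
    have inS: "\<exists>v\<in>?S - {v0}. ends G e = {v, v0}" if e: "e \<in> D" for e
    proof -
      obtain v where v: "v \<in> verts G - {v0}" "ends G e = {v, ?p v}" using child e D(1) by blast
      have "v \<in> ?S"
      proof (rule ccontr)
        assume n: "v \<notin> ?S"
        have "f = e" if "f \<in> D" "v \<in> ends G f" for f
        proof (rule leaf[OF n])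
          show "f \<in> ?B" "e \<in> ?B" using that(1) e D(1) by auto
          show "v \<in> ends G f" "v \<in> ends G e" using that(2) v(2) by auto
        qed
        moreover have "v \<in> ends G e" using v(2) by simp
        ultimately have "edges_at D v = {e}" using e unfolding edges_at_def by blast
        then show False using even[of v] by simp
      qed
      then show ?thesis using v parS[of v] by auto
    qed
    show "D = {}"
    proof (rule ccontr)
      assume "D \<noteq> {}"
      then obtain e where e: "e \<in> D" by blast
      obtain v where v: "v \<in> ?S - {v0}" "ends G e = {v, v0}" using inS[OF e] by blast
      have "f = e" if f: "f \<in> D" "v \<in> ends G f" for f
      proof -
        obtain u where u: "u \<in> ?S - {v0}" "ends G f = {u, v0}" using inS[OF f(1)] by blast
        then have "ends G f = ends G e" using f(2) v by auto
        moreover have "v0 \<in> ends G f" using u(2) by simp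
        moreover have "f \<in> edges G" "e \<in> edges G" using f(1) e D(1) BE by auto
        ultimately show ?thesis using nopar[of v0 f e] by simp
      qed
      moreover have "v \<in> ends G e" using v(2) by simp
      ultimately have "edges_at D v = {e}" using e unfolding edges_at_def by blast
      then show False using even[of v] by simp
    qed
  qed (rule BE)
  have root: "\<exists>Y\<subseteq>?B. boundary Y = sym_diff {s} {v0}" if s: "s \<in> ?S" "s \<in> verts G" for s
  proof (cases "s = v0")
    case True
    then show ?thesis by (intro exI[of _ "{}"]) simp
  next
    case False
    then obtain e where e: "e \<in> ?B" "ends G e = {s, v0}" using tree_edge[of s] s parS[OF s(1)] by auto
    then show ?thesis using False by (intro exI[of _ "{e}"]) (auto simp: boundary_single)
  qed
  have reach: "\<exists>Y\<subseteq>?B. boundary Y = sym_diff {v} {v0}" if v: "v \<in> verts G" for v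
  proof (cases "v = v0")
    case True
    then show ?thesis by (intro exI[of _ "{}"]) simp
  next
    case False
    then obtain e where e: "e \<in> ?B" "ends G e = {v, ?p v}" using tree_edge[of v] v by blast
    have "?p v \<in> verts G" using e BE G by (auto simp: graph_def)
    then obtain Y where Y: "Y \<subseteq> ?B" "boundary Y = sym_diff {?p v} {v0}" using root[OF par] by blast
    have "v \<noteq> ?p v" using adj[of v] v False by (auto simp: adjacent_def)
    then have "boundary (sym_diff {e} Y) = sym_diff {v} {v0}"
      using boundary_sym_diff[of "{e}" Y] e Y BE by (auto simp: boundary_single)
    then show ?thesis using e(1) Y(1) by (intro exI[of _ "sym_diff {e} Y"]) auto
  qed
  have "basis (graphic_matroid G) ?B"
    unfolding basis_def basis_of_def
  proof (intro conjI allI impI)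
    show "?B \<subseteq> ground (graphic_matroid G)" using BE by (simp add: graphic_matroid_def)
    show "indep (graphic_matroid G) ?B" using forest by simp
    fix K assume K: "?B \<subset> K \<and> K \<subseteq> ground (graphic_matroid G)"
    then obtain e where e: "e \<in> K" "e \<notin> ?B" by blast
    have eE: "e \<in> edges G" using e K by (auto simp: graphic_matroid_def)
    have "ends G e \<subseteq> verts G" using G eE by (simp add: graph_def)
    then have "\<exists>s\<in>{v0}. \<exists>Y\<subseteq>?B. boundary Y = sym_diff {v} {s}" if "v \<in> ends G e" for v
      using reach[of v] that by blast
    then obtain Y where Y: "Y \<subseteq> insert e ?B" "e \<in> Y" "boundary Y \<subseteq> {v0}"
      using special_join[OF BE eE e(2), of "{v0}"] by blast
    have "Y \<subseteq> edges G" using Y(1) eE BE by blast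
    then have "even (card (boundary Y))" by (rule even_card_boundary)
    then have "boundary Y = {}" using Y(3) by (auto simp: subset_singleton_iff)
    moreover have "Y \<subseteq> K" using Y(1) e(1) K by blast
    ultimately show "\<not> indep (graphic_matroid G) K" using forest_even[of K Y] Y(2) by auto
  qed
  then show ?thesis
    by unfold_locales (use leaf in \<open>auto simp: card_insert_if\<close>)
qed

section \<open>From multicomplexes to O-sequences\<close>

text \<open>
  The variables are renamed along an enumeration \<open>f\<close> of \<open>S\<close>; \<open>g\<close> and \<open>h\<close> are the induced
  order isomorphisms of monomials.
\<close>

lemma pure_O_sequenceI:
  assumes fin: "finite S" and P: "pure_multicomplex S P"
  shows "pure_O_sequence (degree_seq S P)"
proof -
  define n where "n = card S"
  obtain f where f: "bij_betw f {..<n} S"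
    using ex_bij_betw_nat_finite[OF fin] by (auto simp: n_def atLeast0LessThan)
  define g :: "('a \<Rightarrow> nat) \<Rightarrow> nat \<Rightarrow> nat" where "g a = (\<lambda>i. if i < n then a (f i) else 0)" for a
  define h :: "(nat \<Rightarrow> nat) \<Rightarrow> 'a \<Rightarrow> nat" where
    "h b = (\<lambda>j. if j \<in> S then b (the_inv_into {..<n} f j) else 0)" for b
  have inj: "inj_on f {..<n}" and img: "f ` {..<n} = S" using f by (auto simp: bij_betw_def)
  have hg: "h (g a) = a" if "a \<in> monomials S" for a
  proof
    fix j show "h (g a) j = a j"
    proof (cases "j \<in> S")
      case True
      then have "the_inv_into {..<n} f j < n" "f (the_inv_into {..<n} f j) = j"
        using the_inv_into_into[OF inj, of j "{..<n}"] f_the_inv_into_f[OF inj, of j] img by auto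
      then show ?thesis using True by (simp add: h_def g_def)
    qed (use that in \<open>simp add: h_def monomials_def\<close>)
  qed
  have gh: "g (h b) = b" if "b \<in> monomials {..<n}" for b
  proof
    fix i show "g (h b) i = b i"
    proof (cases "i < n")
      case True
      then have "f i \<in> S" "the_inv_into {..<n} f (f i) = i"
        using img the_inv_into_f_f[OF inj] by auto
      then show ?thesis using True by (simp add: h_def g_def)
    qed (use that in \<open>simp add: g_def monomials_def\<close>)
  qed
  have gmono: "g a \<le> g b" if "a \<le> b" for a b using that by (simp add: le_fun_def g_def)
  have hmono: "h a \<le> h b" if "a \<le> b" for a b using that by (simp add: le_fun_def h_def)
  have gmon: "g a \<in> monomials {..<n}" for a by (simp add: g_def monomials_def)
  have gsum: "sum (g a) {..<n} = sum a S" for a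
    using sum.reindex_bij_betw[OF f, of a] by (simp add: g_def)
  have PS: "P \<subseteq> monomials S" and finP: "finite P"
    and down: "\<And>a b. a \<in> P \<Longrightarrow> b \<le> a \<Longrightarrow> b \<in> P"
    using P by (auto simp: pure_multicomplex_def multicomplex_def)
  have mc: "multicomplex {..<n} (g ` P)"
    unfolding multicomplex_def
  proof (intro conjI ballI allI impI)
    show "finite (g ` P)" using finP by simp
    show "g ` P \<subseteq> monomials {..<n}" using gmon by blast
    fix a b assume a: "a \<in> g ` P" and b: "b \<le> a"
    obtain a0 where a0: "a0 \<in> P" "a = g a0" using a by blast
    have "b i = 0" if "i \<notin> {..<n}" for i
    proof -
      have "b i \<le> a i" using b by (simp add: le_fun_def)
      then show ?thesis using that a0(2) by (simp add: g_def)
    qed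
    then have bm: "b \<in> monomials {..<n}" by (simp add: monomials_def)
    have "h b \<le> a0" using hmono[OF b] hg[of a0] a0 PS by auto
    then have "h b \<in> P" using down a0(1) by blast
    then show "b \<in> g ` P" using gh[OF bm] by (metis image_eqI)
  qed
  have max: "maximal_in P a" if "maximal_in (g ` P) (g a)" "a \<in> P" for a
    unfolding maximal_in_def
  proof (intro conjI ballI impI)
    fix b assume b: "b \<in> P" "a \<le> b"
    have "g b = g a" using that(1) b gmono by (auto simp: maximal_in_def)
    then have "h (g b) = h (g a)" by simp
    then show "b = a" using hg b(1) that(2) PS by (metis subsetD)
  qed (rule that(2))
  have "sum a {..<n} = sum b {..<n}" if ab: "maximal_in (g ` P) a" "maximal_in (g ` P) b" for a b
  proof -
    obtain a0 b0 where 0: "a0 \<in> P" "a = g a0" "b0 \<in> P" "b = g b0"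
      using ab unfolding maximal_in_def by blast
    then have "maximal_in P a0" "maximal_in P b0" using max ab by auto
    then have "sum a0 S = sum b0 S" using P unfolding pure_multicomplex_def by blast
    then show ?thesis using 0 gsum by simp
  qed
  then have pure: "pure_multicomplex {..<n} (g ` P)" using mc unfolding pure_multicomplex_def by blast
  have injg: "inj_on g P" by (rule inj_on_inverseI[of _ h]) (use hg PS in blast)
  have "degree_seq {..<n} (g ` P) k = degree_seq S P k" for k
  proof -
    have "{a \<in> g ` P. sum a {..<n} = k} = g ` {a \<in> P. sum a S = k}" using gsum by auto
    moreover have "inj_on g {a \<in> P. sum a S = k}" using injg by (rule inj_on_subset) auto
    ultimately show ?thesis by (simp add: degree_seq_def card_image)
  qed
  then show ?thesis unfolding pure_O_sequence_def using pure by blast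
qed

lemma dominating_spine_pure_O_sequence:
  assumes G: "graph G" and sp: "dominating_spine G v0 v1 v2"
  shows "pure_O_sequence (h_vector (graphic_matroid G))"
proof -
  let ?B = "canonical_tree G v0 v1 v2"
  interpret spined_graph G ?B "{v0, v1, v2}" using canonical_tree_spined[OF assms] .
  obtain F where F: "fibre_system (graphic_matroid G) ?B F"
    using exists_fibre_system[OF finite_R no_obstruction] by blast
  show ?thesis
    using pure_O_sequenceI[OF finite_R relaxed_coparking_pure(1)[OF F]] relaxed_coparking_pure(2)[OF F]
    by simp
qed

section \<open>Triconed, biconed and coned graphs\<close>

lemma star_canonical_tree:
  assumes "graph G"
  shows "star G v0 = canonical_tree G v0 v0 v0"
proof -
  interpret finite_multigraph G by unfold_locales (use assms in \<open>auto simp: graph_def\<close>)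
  have par: "canonical_parent G v0 v0 v0 v = v0" for v by (simp add: canonical_parent_def)
  have "v0 \<in> ends G e \<longleftrightarrow> (\<exists>v\<in>verts G - {v0}. ends G e = {v, v0})" if e: "e \<in> edges G" for e
  proof
    assume "v0 \<in> ends G e"
    then obtain u where u: "ends G e = {u, v0}" "u \<noteq> v0" using other_end[OF e] by blast
    moreover have "ends G e \<subseteq> verts G" using e assms by (simp add: graph_def)
    ultimately show "\<exists>v\<in>verts G - {v0}. ends G e = {v, v0}" by blast
  next
    assume "\<exists>v\<in>verts G - {v0}. ends G e = {v, v0}"
    then show "v0 \<in> ends G e" by fastforce
  qed
  then show ?thesis unfolding star_def canonical_tree_def par by blast
qed

text \<open>
  Besides \<open>i\<close>, the circuit contains exactly the edges from the two ends of \<open>i\<close> to \<open>v0\<close>, by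
  \<open>circuit_end\<close> and \<open>circuit_leaf\<close>.
\<close>

lemma coned_circuit_triangle:
  assumes G: "graph G" and c: "coned_at G v0" and i: "i \<in> cobasis (graphic_matroid G) (star G v0)"
  shows "card (fund_circuit (graphic_matroid G) (star G v0) i) = 3"
proof -
  interpret spined_graph G "star G v0" "{v0, v0, v0}"
    using canonical_tree_spined[OF G coned_spine[OF c]] by (simp add: star_canonical_tree[OF G])
  have iE: "i \<in> edges G" "v0 \<notin> ends G i" using i by (auto simp: cobasis_def ground_eq star_def)
  obtain x y where xy: "ends G i = {x, y}" "x \<noteq> y" using card_ends[OF iE(1)] by (auto simp: card_2_iff)
  obtain e where e: "e \<in> star G v0" "e \<in> C i" "x \<in> ends G e" using circuit_leaf[OF i, of x] xy by auto
  obtain f where f: "f \<in> star G v0" "f \<in> C i" "y \<in> ends G f" using circuit_leaf[OF i, of y] xy by auto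
  have root: "v0 \<in> ends G h" "h \<in> edges G" if "h \<in> star G v0" for h using that by (auto simp: star_def)
  have ne0: "x \<noteq> v0" "y \<noteq> v0" using xy iE(2) by auto
  have "e \<noteq> f"
  proof
    assume "e = f"
    then have "{v0, x, y} \<subseteq> ends G e" using e(3) f(3) root[OF e(1)] by blast
    then have "card {v0, x, y} \<le> 2" using card_mono[OF finite_ends] card_ends root(2)[OF e(1)] by metis
    then show False using ne0 xy(2) by auto
  qed
  have "C i = {i, e, f}"
  proof (intro equalityI subsetI)
    fix h assume h: "h \<in> C i"
    show "h \<in> {i, e, f}"
    proof (cases "h = i")
      case False
      then have hs: "h \<in> star G v0" using fund_circuit(3)[OF i] h by blast
      then obtain w where w: "ends G h = {w, v0}" "w \<noteq> v0" using other_end root by blast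
      have "w \<in> ends G i" by (rule circuit_end[OF i hs h]) (use w in auto)
      then have "w = x \<or> w = y" using xy by auto
      then show ?thesis using leaf[OF _ hs e(1), of w] leaf[OF _ hs f(1), of w] e(3) f(3) w by auto
    qed simp
  qed (use e f fund_circuit(2)[OF i] in auto)
  moreover have "i \<noteq> e" "i \<noteq> f" using R_not_B[OF i] e(1) f(1) by auto
  ultimately show ?thesis using \<open>e \<noteq> f\<close> by simp
qed

theorem theorem6p2:
  fixes G :: "('v, 'e) multigraph"
  assumes "graph G"
  shows "(\<forall>v0 v1 v2. triconed_at G v0 v1 v2 \<longrightarrow>
            (let M = graphic_matroid G; B0 = canonical_tree G v0 v1 v2 in
               basis M B0 \<and>
               (\<forall>F \<sigma>. fibres_below M B0 F \<sigma> \<longrightarrow> \<not> obstructed M B0 F \<sigma>) \<and>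
               (\<forall>F. fibre_system M B0 F \<longrightarrow>
                  pure_multicomplex (cobasis M B0) (relaxed_coparking M B0 F) \<and>
                  degree_seq (cobasis M B0) (relaxed_coparking M B0 F) = h_vector M)))
       \<and> (triconed G \<or> biconed G \<or> coned G \<longrightarrow> pure_O_sequence (h_vector (graphic_matroid G)))
       \<and> (\<forall>v0. coned_at G v0 \<longrightarrow>
            (let M = graphic_matroid G; B0 = star G v0 in
               basis M B0 \<and>
               (\<forall>\<sigma>. stratum M B0 \<sigma> \<longrightarrow> live M B0 \<sigma>) \<and>
               (\<forall>i\<in>cobasis M B0. card (fund_circuit M B0 i) = 3) \<and>
               cycle_system M B0 \<and>
               (\<forall>F. fibre_system M B0 F \<longrightarrow> relaxed_coparking M B0 F = coparking M B0)))"
proof (intro conjI allI impI)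
  fix v0 v1 v2 assume "triconed_at G v0 v1 v2"
  then interpret spined_graph G "canonical_tree G v0 v1 v2" "{v0, v1, v2}"
    by (rule canonical_tree_spined[OF assms triconed_spine])
  show "let M = graphic_matroid G; B0 = canonical_tree G v0 v1 v2 in
               basis M B0 \<and>
               (\<forall>F \<sigma>. fibres_below M B0 F \<sigma> \<longrightarrow> \<not> obstructed M B0 F \<sigma>) \<and>
               (\<forall>F. fibre_system M B0 F \<longrightarrow>
                  pure_multicomplex (cobasis M B0) (relaxed_coparking M B0 F) \<and>
                  degree_seq (cobasis M B0) (relaxed_coparking M B0 F) = h_vector M)"
    unfolding Let_def using tree no_obstruction relaxed_coparking_pure by blast
next
  assume "triconed G \<or> biconed G \<or> coned G"
  then have "\<exists>v0 v1 v2. dominating_spine G v0 v1 v2"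
  proof (elim disjE)
    assume "biconed G"
    then obtain v0 v1 where "adjacent G v0 v1" "dominates G {v0, v1}" "no_parallel_at G v0"
      "no_parallel_at G v1" by (auto simp: biconed_def)
    then have "dominating_spine G v0 v1 v1" by (simp add: dominating_spine_def adjacent_sym)
    then show ?thesis by blast
  next
    assume "triconed G"
    then obtain v0 v1 v2 where "triconed_at G v0 v1 v2" by (auto simp: triconed_def)
    then show ?thesis using triconed_spine by metis
  next
    assume "coned G"
    then obtain v0 where "coned_at G v0" by (auto simp: coned_def)
    then show ?thesis using coned_spine by metis
  qed
  then show "pure_O_sequence (h_vector (graphic_matroid G))"
    using dominating_spine_pure_O_sequence[OF assms] by blast
next
  fix v0 assume c: "coned_at G v0"
  let ?M = "graphic_matroid G" and ?B = "star G v0"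
  interpret spined_graph G ?B "{v0, v0, v0}"
    using canonical_tree_spined[OF assms coned_spine[OF c]] by (simp add: star_canonical_tree[OF assms])
  have alive: "live ?M ?B \<sigma>" if "stratum ?M ?B \<sigma>" for \<sigma>
    using no_dead_if_single[of \<sigma>] that by (simp add: live_def dead_def)
  then have "\<not> dead ?M ?B \<sigma>" for \<sigma> by (auto simp: live_def dead_def)
  then have "relaxed_coparking ?M ?B F = coparking ?M ?B" for F
    by (auto simp: relaxed_coparking_def coparking_def)
  moreover have "cycle_system ?M ?B" using alive by (auto simp: cycle_system_def live_def)
  ultimately show "let M = ?M; B0 = ?B in
               basis M B0 \<and>
               (\<forall>\<sigma>. stratum M B0 \<sigma> \<longrightarrow> live M B0 \<sigma>) \<and>
               (\<forall>i\<in>cobasis M B0. card (fund_circuit M B0 i) = 3) \<and>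
               cycle_system M B0 \<and>
               (\<forall>F. fibre_system M B0 F \<longrightarrow> relaxed_coparking M B0 F = coparking M B0)"
    unfolding Let_def using tree alive coned_circuit_triangle[OF assms c] by blast
qed

end
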